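(* Let $K$ be an imaginary quadratic field. For each $\mathfrak{p} \in P_K$ let $K_{\mathfrak{p}}^\times \to DR_K^\times$ be the group homomorphism induced, via groupification of $O_{\mathfrak{p}}^*$, by the monoid homomorphism $O_{\mathfrak{p}}^* \to DR_K^\times$, $\rho_{\mathfrak{p}} \mapsto \sigma_{\mathfrak{p}}$, where $\sigma_{\mathfrak{p}}$ is the unique element of $DR_K^\times$ with $\rho_{\mathfrak{p}} \cdot \sigma_{\mathfrak{p}} \in I_K$. Let $\mathbb{A}_{K,f}^\times$ be the restricted product of the groups $K_{\mathfrak{p}}^\times$ with respect to the subgroups $O_{\mathfrak{p}}^\times$. Then the multiplicative group $K^\times$ is isomorphic to the kernel of the homomorphism $$\mathbb{A}_{K,f}^\times \to DR_K^\times = \mathbb{A}_K^\times / \overline{K^\times \cdot K_\infty^{\times,\circ}}$$ naturally defined from the group homomorphisms $K_{\mathfrak{p}}^\times \to DR_K^\times$ ($\mathfrak{p} \in P_K$) induced by $\rho_{\mathfrak{p}} \mapsto \sigma_{\mathfrak{p}}$.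
   Context: For a number field $K$ with ring of integers $O_K$: $P_K$ is the set of maximal ideals of $O_K$; $O_{\mathfrak{p}}$ is the completion of $O_K$ at $\mathfrak{p}$ (the ring of integers of the local field $K_{\mathfrak{p}}$) and $O_{\mathfrak{p}}^* = O_{\mathfrak{p}} \setminus \{0\}$, a multiplicative monoid; $\hat{O}_K = \prod_{\mathfrak{p} \in P_K} O_{\mathfrak{p}}$ is the profinite completion of $O_K$; $\mathbb{A}_K^\times$ is the idele group and $\mathbb{A}_{K,f}^\times$ the finite idele group; $K_\infty^{\times,\circ}$ is the identity component of $K_\infty^\times = (K \otimes_{\mathbb{Q}} \mathbb{R})^\times$; the overline denotes closure in $\mathbb{A}_K^\times$; $G_K^{ab}$ is the Galois group of the maximal abelian extension of $K$, identified by class field theory with $\mathbb{A}_K^\times / \overline{K^\times \cdot K_\infty^{\times,\circ}}$; $\mathrm{rec}: \mathbb{A}_{K,f}^\times \to G_K^{ab}$ is the restriction of the global Artin reciprocity map to finite ideles (extended by $1$ at the archimedean places). The Deligne-Ribet monoid of $K$ is the profinite (commutative topological) monoid $$DR_K = \hat{O}_K \times_{\hat{O}_K^\times} G_K^{ab},$$ the quotient of the multiplicative monoid $\hat{O}_K \times G_K^{ab}$ by the relation $(\rho, s) \sim (\rho u, \mathrm{rec}(u)^{-1} s)$ for $u \in \hat{O}_K^\times$, with componentwise multiplication and the quotient topology. The class of $(\rho,s)$ is denoted $[\rho,s]$. Its unit group $DR_K^\times$ is identified with $G_K^{ab}$ via $s \mapsto [1,s]$. $O_{\mathfrak{p}}$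 is embedded as a multiplicative submonoid of $DR_K$ by sending $\rho_{\mathfrak{p}}$ to $[\rho,1]$, where $\rho \in \hat{O}_K$ has $\mathfrak{p}$-component $\rho_{\mathfrak{p}}$ and all other components $1$; the product $\rho_{\mathfrak{p}} \cdot \sigma_{\mathfrak{p}}$ is taken in $DR_K$. $I_K$ is the monoid of non-zero integral ideals of $O_K$, regarded as a submonoid of $DR_K$ by sending an ideal $\mathfrak{a}$ to $[\rho, \mathrm{rec}(\rho)^{-1}]$, where $\rho \in \hat{O}_K \cap \mathbb{A}_{K,f}^\times$ is any element with $\rho \hat{O}_K = \mathfrak{a}\hat{O}_K$. For each $\rho_{\mathfrak{p}} \in O_{\mathfrak{p}}^*$ there is exactly one $\sigma_{\mathfrak{p}} \in DR_K^\times$ with $\rho_{\mathfrak{p}} \cdot \sigma_{\mathfrak{p}} \in I_K$. The homomorphism $\mathbb{A}_{K,f}^\times \to DR_K^\times$ naturally defined from the maps $K_{\mathfrak{p}}^\times \to DR_K^\times$ is the unique continuous homomorphism whose restriction to each $K_{\mathfrak{p}}^\times$ (embedded in the $\mathfrak{p}$-component) is the given map. *)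

theory Defs
  imports
    "HOL-Analysis.Analysis"
    "HOL-Algebra.Algebra"
    "HOL-Algebra.Algebraic_Closure_Type"
begin

section \<open>Generic constructions\<close>

definition quotient_topology :: "'a topology \<Rightarrow> ('a \<Rightarrow> 'b) \<Rightarrow> 'b topology" where
  "quotient_topology T f =
     topology (\<lambda>U. U \<subseteq> f ` topspace T \<and> openin T {x \<in> topspace T. f x \<in> U})"

lemma openin_quotient_topology:
  fixes f :: "'a \<Rightarrow> 'b"
  shows "openin (quotient_topology T f) U \<longleftrightarrow>
     U \<subseteq> f ` topspace T \<and> openin T {x \<in> topspace T. f x \<in> U}"
proof -
  have "istopology (\<lambda>U. U \<subseteq> f ` topspace T \<and> openin T {x \<in> topspace T. f x \<in> U})"
    unfolding istopology_def
  proof (intro conjI allI impI)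
    fix S S2
    assume "S \<subseteq> f ` topspace T \<and> openin T {x \<in> topspace T. f x \<in> S}"
      and "S2 \<subseteq> f ` topspace T \<and> openin T {x \<in> topspace T. f x \<in> S2}"
    moreover have "{x \<in> topspace T. f x \<in> S \<inter> S2} =
        {x \<in> topspace T. f x \<in> S} \<inter> {x \<in> topspace T. f x \<in> S2}" by auto
    ultimately show "openin T {x \<in> topspace T. f x \<in> S \<inter> S2}" by auto
    show "S \<inter> S2 \<subseteq> f ` topspace T"
      using \<open>S \<subseteq> f ` topspace T \<and> _\<close> by blast
  next
    fix \<K> :: "'b set set"
    assume *: "\<forall>S\<in>\<K>. S \<subseteq> f ` topspace T \<and> openin T {x \<in> topspace T. f x \<in> S}"
    have "{x \<in> topspace T. f x \<in> \<Union>\<K>} = (\<Union>S\<in>\<K>. {x \<in> topspace T. f x \<in> S})" by auto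
    with * show "openin T {x \<in> topspace T. f x \<in> \<Union>\<K>}" by auto
    from * show "\<Union>\<K> \<subseteq> f ` topspace T" by blast
  qed
  then show ?thesis
    by (simp add: quotient_topology_def topology_inverse')
qed

lemma topspace_quotient_topology [simp]: "topspace (quotient_topology T f) = f ` topspace T"
proof -
  have "{x \<in> topspace T. f x \<in> f ` topspace T} = topspace T" by auto
  then have "openin (quotient_topology T f) (f ` topspace T)"
    by (simp add: openin_quotient_topology)
  then show ?thesis
    by (meson openin_quotient_topology openin_subset openin_topspace subset_antisym)
qed

lemma quotient_map_quotient_topology: "quotient_map T (quotient_topology T f) f"
  by (auto simp: quotient_map_def openin_quotient_topology)

definition restricted_product ::
  "'i set \<Rightarrow> ('i \<Rightarrow> ('a, 'm) monoid_scheme) \<Rightarrow> ('i \<Rightarrow> 'a set) \<Rightarrow> ('i \<Rightarrow> 'a) monoid" where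
  "restricted_product I G H =
     (product_group I G)
       \<lparr>carrier := {x \<in> carrier (product_group I G). finite {i \<in> I. x i \<notin> H i}}\<rparr>"

definition restricted_product_topology ::
  "'i set \<Rightarrow> ('i \<Rightarrow> 'a topology) \<Rightarrow> ('i \<Rightarrow> 'a set) \<Rightarrow> ('i \<Rightarrow> 'a) topology" where
  "restricted_product_topology I T H =
     topology_generated_by
       {(\<Pi>\<^sub>E i\<in>I. U i) | U. (\<forall>i\<in>I. openin (T i) (U i)) \<and> finite {i \<in> I. U i \<noteq> H i}}"


section \<open>The field and its ring of integers\<close>

text \<open>
  The field \<open>K\<close> is the type \<open>'k\<close>. The constants below are meaningful when \<open>'k\<close> is a number field.
\<close>

abbreviation field_ring :: "'k::field_char_0 ring" where
  "field_ring \<equiv> ring_of_type_algebra"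

definition embeddings :: "('k::field_char_0 \<Rightarrow> complex) set" where
  "embeddings = ring_hom field_ring field_ring"

text \<open>
  \<open>vector_space.dim\<close> is 0 for infinite-dimensional spaces, so the first conjunct does say
  \<open>[K : \<rat>] = 2\<close>.
\<close>
definition imaginary_quadratic_field :: "'k::field_char_0 itself \<Rightarrow> bool" where
  "imaginary_quadratic_field _ \<longleftrightarrow>
     vector_space.dim (\<lambda>(q::rat) (x::'k). of_rat q * x) UNIV = 2 \<and>
     (\<forall>\<sigma>\<in>(embeddings :: ('k \<Rightarrow> complex) set). \<not> range \<sigma> \<subseteq> \<real>)"

definition ring_of_integers :: "'k::field_char_0 ring" where
  "ring_of_integers = field_ring\<lparr>carrier := {x. algebraic_int x}\<rparr>"

definition maximal_ideals :: "'k::field_char_0 set set" where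
  "maximal_ideals = {P. maximalideal P ring_of_integers}"


section \<open>The local fields\<close>

text \<open>
  \<open>localized_power P n\<close> is \<open>P\<^sup>n\<close> extended to the localization of \<open>O\<^sub>K\<close> at \<open>P\<close>, that is, the set
  of those \<open>x\<close> in \<open>K\<close> with \<open>P\<close>-adic valuation at least \<open>n\<close>. These sets form a basis of
  neighbourhoods of \<open>0\<close> for the \<open>P\<close>-adic topology of \<open>K\<close>; the ideals \<open>P\<^sup>n\<close> themselves do not.
\<close>
definition localized_power :: "'k::field_char_0 set \<Rightarrow> nat \<Rightarrow> 'k set" where
  "localized_power P n =
     {a / s | a s. a \<in> P [^]\<^bsub>ideals_set ring_of_integers\<^esub> n \<and> s \<in> carrier ring_of_integers - P}"

definition cauchy_sequences :: "'k::field_char_0 set \<Rightarrow> (nat \<Rightarrow> 'k) ring" where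
  "cauchy_sequences P =
     \<lparr>carrier = {s. \<forall>n. \<exists>N. \<forall>i\<ge>N. \<forall>j\<ge>N. s i - s j \<in> localized_power P n},
      monoid.mult = (\<lambda>s t i. s i * t i), monoid.one = (\<lambda>i. 1), ring.zero = (\<lambda>i. 0), ring.add = (\<lambda>s t i. s i + t i)\<rparr>"

definition null_sequences :: "'k::field_char_0 set \<Rightarrow> (nat \<Rightarrow> 'k) set" where
  "null_sequences P = {s. \<forall>n. \<forall>\<^sub>F i in sequentially. s i \<in> localized_power P n}"

definition local_field :: "'k::field_char_0 set \<Rightarrow> (nat \<Rightarrow> 'k) set ring" where
  "local_field P = cauchy_sequences P Quot null_sequences P"

definition to_local_field :: "'k::field_char_0 set \<Rightarrow> 'k \<Rightarrow> (nat \<Rightarrow> 'k) set" where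
  "to_local_field P x = null_sequences P +>\<^bsub>cauchy_sequences P\<^esub> (\<lambda>i. x)"

definition local_integers :: "'k::field_char_0 set \<Rightarrow> (nat \<Rightarrow> 'k) set ring" where
  "local_integers P = (local_field P)\<lparr>carrier :=
     {null_sequences P +>\<^bsub>cauchy_sequences P\<^esub> s | s.
        s \<in> carrier (cauchy_sequences P) \<and> range s \<subseteq> carrier ring_of_integers}\<rparr>"

definition local_neighbourhood ::
  "'k::field_char_0 set \<Rightarrow> nat \<Rightarrow> (nat \<Rightarrow> 'k) set \<Rightarrow> (nat \<Rightarrow> 'k) set set" where
  "local_neighbourhood P n A =
     {B \<in> carrier (local_field P).
        \<forall>x\<in>A. \<forall>y\<in>B. \<forall>\<^sub>F i in sequentially. y i - x i \<in> localized_power P n}"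

text \<open>
  The predicate below describes a topology when \<open>P\<close> is an ideal of \<open>O\<^sub>K\<close>, because
  \<open>localized_power P\<close> is then decreasing.
\<close>
definition local_topology :: "'k::field_char_0 set \<Rightarrow> (nat \<Rightarrow> 'k) set topology" where
  "local_topology P =
     topology (\<lambda>U. U \<subseteq> carrier (local_field P) \<and> (\<forall>A\<in>U. \<exists>n. local_neighbourhood P n A \<subseteq> U))"

definition local_units_topology :: "'k::field_char_0 set \<Rightarrow> (nat \<Rightarrow> 'k) set topology" where
  "local_units_topology P = subtopology (local_topology P) (Units (local_field P))"

definition local_integers_topology :: "'k::field_char_0 set \<Rightarrow> (nat \<Rightarrow> 'k) set topology" where
  "local_integers_topology P = subtopology (local_topology P) (carrier (local_integers P))"


section \<open>Finite ideles and integral finite adeles\<close>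

definition finite_ideles :: "('k::field_char_0 set \<Rightarrow> (nat \<Rightarrow> 'k) set) monoid" where
  "finite_ideles =
     restricted_product maximal_ideals (\<lambda>P. units_of (local_field P)) (\<lambda>P. Units (local_integers P))"

definition finite_ideles_topology ::
  "('k::field_char_0 set \<Rightarrow> (nat \<Rightarrow> 'k) set) topology" where
  "finite_ideles_topology =
     restricted_product_topology maximal_ideals local_units_topology
       (\<lambda>P. Units (local_integers P))"

definition single_component ::
  "'k::field_char_0 set \<Rightarrow> (nat \<Rightarrow> 'k) set \<Rightarrow> ('k set \<Rightarrow> (nat \<Rightarrow> 'k) set)" where
  "single_component P x = (\<lambda>Q\<in>maximal_ideals. if Q = P then x else \<one>\<^bsub>local_field Q\<^esub>)"

definition integral_adeles :: "('k::field_char_0 set \<Rightarrow> (nat \<Rightarrow> 'k) set) ring" where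
  "integral_adeles =
     \<lparr>carrier = (\<Pi>\<^sub>E P\<in>maximal_ideals. carrier (local_integers P)),
      monoid.mult = (\<lambda>x y. \<lambda>P\<in>maximal_ideals. x P \<otimes>\<^bsub>local_integers P\<^esub> y P),
      monoid.one = (\<lambda>P\<in>maximal_ideals. \<one>\<^bsub>local_integers P\<^esub>),
      ring.zero = (\<lambda>P\<in>maximal_ideals. \<zero>\<^bsub>local_integers P\<^esub>),
      ring.add = (\<lambda>x y. \<lambda>P\<in>maximal_ideals. x P \<oplus>\<^bsub>local_integers P\<^esub> y P)\<rparr>"

definition integral_adeles_topology ::
  "('k::field_char_0 set \<Rightarrow> (nat \<Rightarrow> 'k) set) topology" where
  "integral_adeles_topology = product_topology local_integers_topology maximal_ideals"

definition diagonal :: "'k::field_char_0 \<Rightarrow> ('k set \<Rightarrow> (nat \<Rightarrow> 'k) set)" where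
  "diagonal x = (\<lambda>P\<in>maximal_ideals. to_local_field P x)"


section \<open>The archimedean component and the ideles\<close>

text \<open>
  \<open>K \<otimes>\<^sub>\<rat> \<real>\<close> as the Minkowski space of \<open>K\<close>: the tensor \<open>x \<otimes> r\<close> corresponds to the family
  \<open>(r * \<sigma> x)\<^sub>\<sigma>\<close> over the embeddings \<open>\<sigma>\<close> of \<open>K\<close> into \<open>\<complex>\<close>, and the families that arise are those
  compatible with complex conjugation.
\<close>
definition archimedean_ring :: "(('k::field_char_0 \<Rightarrow> complex) \<Rightarrow> complex) ring" where
  "archimedean_ring =
     \<lparr>carrier = {z \<in> extensional embeddings. \<forall>\<sigma>\<in>embeddings. z (cnj \<circ> \<sigma>) = cnj (z \<sigma>)},
      monoid.mult = (\<lambda>z w. \<lambda>\<sigma>\<in>embeddings. z \<sigma> * w \<sigma>), monoid.one = (\<lambda>\<sigma>\<in>embeddings. 1),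
      ring.zero = (\<lambda>\<sigma>\<in>embeddings. 0), ring.add = (\<lambda>z w. \<lambda>\<sigma>\<in>embeddings. z \<sigma> + w \<sigma>)\<rparr>"

definition archimedean_units_topology ::
  "(('k::field_char_0 \<Rightarrow> complex) \<Rightarrow> complex) topology" where
  "archimedean_units_topology =
     subtopology (product_topology (\<lambda>\<sigma>. euclidean) embeddings) (Units archimedean_ring)"

definition archimedean_identity_component ::
  "(('k::field_char_0 \<Rightarrow> complex) \<Rightarrow> complex) set" where
  "archimedean_identity_component =
     connected_component_of_set archimedean_units_topology \<one>\<^bsub>archimedean_ring\<^esub>"

type_synonym 'k idele =
  "('k set \<Rightarrow> (nat \<Rightarrow> 'k) set) \<times> (('k \<Rightarrow> complex) \<Rightarrow> complex)"

definition ideles :: "'k::field_char_0 idele monoid" where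
  "ideles = finite_ideles \<times>\<times> units_of archimedean_ring"

definition ideles_topology :: "'k::field_char_0 idele topology" where
  "ideles_topology = prod_topology finite_ideles_topology archimedean_units_topology"

definition principal_idele :: "'k::field_char_0 \<Rightarrow> 'k idele" where
  "principal_idele x = (diagonal x, \<lambda>\<sigma>\<in>embeddings. \<sigma> x)"


section \<open>The abelianized Galois group, through class field theory\<close>

text \<open>
  The Galois group of the maximal abelian extension of \<open>K\<close> is taken in its class field theory
  description, as the idele group modulo the closure of \<open>K\<^sup>\<times>\<close> times the identity component of the
  archimedean ideles. The Artin map is then the projection.
\<close>
definition artin_kernel :: "'k::field_char_0 idele set" where
  "artin_kernel =
     ideles_topology closure_of
       (principal_idele ` (UNIV - {0}) <#>\<^bsub>ideles\<^esub>
        ({\<one>\<^bsub>finite_ideles\<^esub>} \<times> archimedean_identity_component))"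

definition galois_ab :: "'k::field_char_0 idele set monoid" where
  "galois_ab = ideles Mod artin_kernel"

definition galois_ab_topology :: "'k::field_char_0 idele set topology" where
  "galois_ab_topology = quotient_topology ideles_topology (\<lambda>x. artin_kernel #>\<^bsub>ideles\<^esub> x)"

definition reciprocity ::
  "('k::field_char_0 set \<Rightarrow> (nat \<Rightarrow> 'k) set) \<Rightarrow> 'k idele set" where
  "reciprocity x = artin_kernel #>\<^bsub>ideles\<^esub> (x, \<one>\<^bsub>archimedean_ring\<^esub>)"


section \<open>The Deligne-Ribet monoid\<close>

type_synonym 'k dr_pair = "('k set \<Rightarrow> (nat \<Rightarrow> 'k) set) \<times> 'k idele set"

definition dr_relation :: "('k::field_char_0 dr_pair \<times> 'k dr_pair) set" where
  "dr_relation =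
     {((\<rho>, s), (\<rho> \<otimes>\<^bsub>integral_adeles\<^esub> u, inv\<^bsub>galois_ab\<^esub> (reciprocity u) \<otimes>\<^bsub>galois_ab\<^esub> s)) | \<rho> s u.
        \<rho> \<in> carrier integral_adeles \<and> s \<in> carrier galois_ab \<and> u \<in> Units integral_adeles}"

definition dr_class ::
  "('k::field_char_0 set \<Rightarrow> (nat \<Rightarrow> 'k) set) \<Rightarrow> 'k idele set \<Rightarrow> 'k dr_pair set" where
  "dr_class \<rho> s = dr_relation `` {(\<rho>, s)}"

definition deligne_ribet :: "'k::field_char_0 dr_pair set monoid" where
  "deligne_ribet =
     \<lparr>carrier = carrier (integral_adeles \<times>\<times> galois_ab) // dr_relation,
      monoid.mult = (\<lambda>A B. \<Union>a\<in>A. \<Union>b\<in>B. dr_relation `` {a \<otimes>\<^bsub>integral_adeles \<times>\<times> galois_ab\<^esub> b}),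
      monoid.one = dr_class \<one>\<^bsub>integral_adeles\<^esub> \<one>\<^bsub>galois_ab\<^esub>\<rparr>"

definition deligne_ribet_topology :: "'k::field_char_0 dr_pair set topology" where
  "deligne_ribet_topology =
     quotient_topology (prod_topology integral_adeles_topology galois_ab_topology)
       (\<lambda>(\<rho>, s). dr_class \<rho> s)"

definition deligne_ribet_units_topology :: "'k::field_char_0 dr_pair set topology" where
  "deligne_ribet_units_topology = subtopology deligne_ribet_topology (Units deligne_ribet)"

text \<open>
  The image of the monoid of nonzero integral ideals: the equation between generated ideals of
  \<open>integral_adeles\<close> says that \<open>\<rho>\<close> and \<open>\<aa>\<close> generate the same ideal.
\<close>
definition ideal_monoid :: "'k::field_char_0 dr_pair set set" where
  "ideal_monoid =
     {dr_class \<rho> (inv\<^bsub>galois_ab\<^esub> (reciprocity \<rho>)) | \<rho> \<aa>.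
        ideal \<aa> ring_of_integers \<and> \<aa> \<noteq> {0} \<and>
        \<rho> \<in> carrier integral_adeles \<inter> carrier finite_ideles \<and>
        PIdl\<^bsub>integral_adeles\<^esub> \<rho> = Idl\<^bsub>integral_adeles\<^esub> (diagonal ` \<aa>)}"

definition local_embedding ::
  "'k::field_char_0 set \<Rightarrow> (nat \<Rightarrow> 'k) set \<Rightarrow> 'k dr_pair set" where
  "local_embedding P \<rho> = dr_class (single_component P \<rho>) \<one>\<^bsub>galois_ab\<^esub>"


section \<open>The homomorphism from the finite ideles to the units\<close>

definition local_sigma ::
  "'k::field_char_0 set \<Rightarrow> (nat \<Rightarrow> 'k) set \<Rightarrow> 'k dr_pair set" where
  "local_sigma P \<rho> =
     (THE \<sigma>. \<sigma> \<in> Units deligne_ribet \<and>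
        local_embedding P \<rho> \<otimes>\<^bsub>deligne_ribet\<^esub> \<sigma> \<in> ideal_monoid)"

text \<open>
  The multiplicative group of \<open>local_field P\<close> is the groupification of the monoid of nonzero
  elements of \<open>local_integers P\<close>, so a homomorphism on it is determined by its values there.
  Extensionality makes the homomorphism unique as a HOL function.
\<close>
definition local_hom ::
  "'k::field_char_0 set \<Rightarrow> (nat \<Rightarrow> 'k) set \<Rightarrow> 'k dr_pair set" where
  "local_hom P =
     (THE \<phi>. \<phi> \<in> hom (units_of (local_field P)) (units_of deligne_ribet) \<inter>
             extensional (Units (local_field P)) \<and>
        (\<forall>\<rho>\<in>carrier (local_integers P) - {\<zero>\<^bsub>local_integers P\<^esub>}. \<phi> \<rho> = local_sigma P \<rho>))"

definition idele_hom ::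
  "('k::field_char_0 set \<Rightarrow> (nat \<Rightarrow> 'k) set) \<Rightarrow> 'k dr_pair set" where
  "idele_hom =
     (THE \<Phi>. \<Phi> \<in> hom finite_ideles (units_of deligne_ribet) \<inter>
             extensional (carrier finite_ideles) \<and>
        continuous_map finite_ideles_topology deligne_ribet_units_topology \<Phi> \<and>
        (\<forall>P\<in>maximal_ideals. \<forall>x\<in>Units (local_field P).
           \<Phi> (single_component P x) = local_hom P x))"

end

theory Submission
  imports Defs
begin

text \<open>
  For \<open>x\<close> in \<open>K\<^sub>P\<^sup>\<times>\<close>, seen as an idele concentrated at \<open>P\<close>, the element \<open>\<sigma>\<close> is \<open>[1, rec(x)\<^sup>-\<^sup>1]\<close>: if
  \<open>[x, s] = [\<rho>, rec(\<rho>)\<^sup>-\<^sup>1]\<close>, then \<open>\<rho> = x u\<close> for a unit \<open>u\<close> and hence \<open>s = rec(x)\<^sup>-\<^sup>1\<close>. By density of the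
  ideles of finite support the homomorphism on all finite ideles is \<open>x \<mapsto> [1, rec(x)\<^sup>-\<^sup>1]\<close>, and its
  kernel consists of those \<open>x\<close> for which \<open>(x, 1)\<close> lies in the closure of \<open>K\<^sup>\<times> K\<^sub>\<infinity>\<^sup>\<times>\<close>. As \<open>K\<close> is
  imaginary quadratic, the archimedean part \<open>\<complex>\<^sup>\<times>\<close> is connected, and \<open>K\<^sup>\<times>\<close> meets the units of the
  integral adeles in a finite group, so that it is closed in the finite ideles. The closure is
  therefore \<open>K\<^sup>\<times> \<times> \<complex>\<^sup>\<times>\<close>, and the kernel is the diagonal image of \<open>K\<^sup>\<times>\<close>.
\<close>

section \<open>Imaginary quadratic fields\<close>

text \<open>The map is defined through three nested definite descriptions,
  \<open>local_sigma\<close>, \<open>local_hom\<close> and \<open>idele_hom\<close>, so each must be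
  shown to have exactly one solution before the kernel can be computed. The last one is the
  obstacle: a continuous homomorphism is determined by its values on a dense subgroup once its
  target is Hausdorff, but here the target inherits its topology from a quotient of
  \<open>integral_adeles\<close> times \<open>galois_ab\<close>. Its separation is derived from the
  closedness of K^* in the finite ideles, the same fact that keeps the kernel from being larger than
  K^*. Finiteness of the unit group gives this closedness because a coset of the integral units
  through an idele outside K^* meets K^* in a finite set, which congruences at finitely many places
  avoid. The arithmetic rests on rational coordinates with respect to 1 and a square root \<omega>
  of an integer \<open>D\<close>: integrality is read off trace and norm, finiteness of residue
  rings off scaled coordinates, and a uniformizer at P comes from the fact that the product of P
  with its conjugate is generated by a rational integer.\<close>

lemma of_rat_real: "(of_rat r :: complex) \<in> \<real>"
proof -
  have "(of_rat r :: complex) = of_int (fst (quotient_of r)) / of_int (snd (quotient_of r))"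
    using quotient_of_div[of r "fst (quotient_of r)" "snd (quotient_of r)"]
    by (metis of_rat_divide of_rat_of_int_eq prod.collapse)
  then show ?thesis by (metis Reals_divide Reals_of_int)
qed

text \<open>Basis exchange: 1 replaces one of two basis vectors, and the remaining vector is
  irrational because otherwise 1 alone would span and the dimension would be at most 1.\<close>

lemma dim_2_imp_generator:
  assumes "vector_space.dim (\<lambda>(q::rat) (x::'k::field_char_0). of_rat q * x) UNIV = 2"
  obtains b :: "'k::field_char_0" where "b \<notin> \<rat>" "\<And>x. \<exists>p q. x = of_rat p + of_rat q * b"
proof -
  note obtain_rule = that
  interpret V: vector_space "\<lambda>(q::rat) (x::'k). of_rat q * x"
    by unfold_locales (auto simp: algebra_simps of_rat_add of_rat_mult)
  obtain B where B: "V.independent B" "V.span B = UNIV" "card B = 2"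
    using V.basis_exists[of UNIV] assms
    by (smt (verit, del_insts) top.extremum_uniqueI)
  then obtain b1 b2 where b: "B = {b1, b2}" "b1 \<noteq> b2"
    by (meson card_2_iff)
  have ex: "\<exists>p q. x = of_rat p * b1 + of_rat q * b2" for x
  proof -
    have "x \<in> V.span {b1, b2}" using B b by auto
    then show ?thesis
      unfolding V.span_insert V.span_singleton
      by (auto simp: algebra_simps)
  qed
  \<comment> \<open>Stated for an ordered pair of spanning vectors, since it is not known in advance
    which of \<open>b1\<close> and \<open>b2\<close> has a nonzero coefficient in the expansion of
    1.\<close>
  have gen: thesis if u: "u = 0 \<or> u \<noteq> 0" and c: "c \<noteq> 0" and 1: "1 = of_rat c * x + of_rat d * y"
    and ex: "\<And>z. \<exists>p q. z = of_rat p * x + of_rat q * y" for u c d :: rat and x y :: 'k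
  proof -
    have x: "x = of_rat (1 / c) + of_rat (- d / c) * y"
      using c 1 by (simp add: of_rat_divide of_rat_minus field_simps)
    have g: "\<exists>p q. z = of_rat p + of_rat q * y" for z
    proof -
      obtain p q where "z = of_rat p * x + of_rat q * y" using ex by blast
      then have "z = of_rat (p / c) + of_rat (q - p * d / c) * y"
        by (subst (asm) x) (simp add: of_rat_divide of_rat_minus of_rat_diff of_rat_mult field_simps)
      then show ?thesis by blast
    qed
    have "y \<notin> \<rat>"
    proof
      assume "y \<in> \<rat>"
      then obtain r where r: "y = of_rat r" by (auto elim: Rats_cases)
      have "\<exists>p. z = of_rat p" for z :: 'k
        using g[of z] unfolding r by (metis of_rat_add of_rat_mult)
      then have "V.span {1::'k} = UNIV"
        unfolding V.span_singleton by (auto simp: image_iff)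
      then have "V.dim (UNIV :: 'k set) \<le> card {1::'k}"
        by (metis V.dim_le_card finite.emptyI finite.insertI subset_UNIV)
      then show False using assms by simp
    qed
    then show thesis using g obtain_rule by blast
  qed
  obtain p q where pq: "1 = of_rat p * b1 + of_rat q * b2" using ex by blast
  show thesis
  proof (cases "p = 0")
    case False
    then show ?thesis using gen[of 0 p b1 q b2] pq ex by blast
  next
    case True
    then have "q \<noteq> 0" using pq by auto
    moreover have "\<exists>p q. z = of_rat p * b2 + of_rat q * b1" for z
      using ex[of z] by (metis add.commute)
    ultimately show ?thesis using gen[of 0 q b2 p b1] pq by (simp add: add.commute)
  qed
qed

text \<open>Clearing denominators produces an integer \<open>D\<close> that may have square factors,
  so the span of 1 and \<omega> over the integers is an order that can be smaller than the ring of
  integers. The latter is therefore handled through trace and norm and up to the denominator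
  \<open>2 * D\<close>, never through a basis.\<close>

locale quadratic_field =
  fixes \<omega> :: "'k::field_char_0" and D :: int
  assumes omega_sq: "\<omega> * \<omega> = of_int D"
    and omega_irr: "\<omega> \<notin> \<rat>"
    and generates: "\<And>x. \<exists>p q. x = of_rat p + of_rat q * \<omega>"
begin

lemma coords_unique:
  assumes "of_rat p + of_rat q * \<omega> = of_rat p' + of_rat q' * \<omega>"
  shows "p = p' \<and> q = q'"
proof -
  have "of_rat (q - q') * \<omega> = of_rat (p' - p)"
    using assms by (simp add: of_rat_diff algebra_simps)
  moreover have "\<omega> = of_rat ((p' - p) / (q - q'))" if "q \<noteq> q'"
    using calculation that by (simp add: of_rat_divide field_simps of_rat_diff)
  ultimately have "q = q'" using omega_irr by (metis Rats_of_rat)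
  then show ?thesis using assms by simp
qed

definition re :: "'k \<Rightarrow> rat" where "re x = fst (THE (p, q). x = of_rat p + of_rat q * \<omega>)"
definition im :: "'k \<Rightarrow> rat" where "im x = snd (THE (p, q). x = of_rat p + of_rat q * \<omega>)"

lemma re_im_of [simp]:
  "re (of_rat p + of_rat q * \<omega>) = p" "im (of_rat p + of_rat q * \<omega>) = q"
proof -
  have "(THE (p', q'). of_rat p + of_rat q * \<omega> = of_rat p' + of_rat q' * \<omega>) = (p, q)"
    by (rule the_equality) (auto dest: coords_unique)
  then show "re (of_rat p + of_rat q * \<omega>) = p" "im (of_rat p + of_rat q * \<omega>) = q"
    by (simp_all add: re_def im_def)
qed

lemma expand: "x = of_rat (re x) + of_rat (im x) * \<omega>"
  using generates[of x] by auto

lemma eqI: "re x = re y \<Longrightarrow> im x = im y \<Longrightarrow> x = y"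
  by (metis expand)

lemma re_im_add [simp]: "re (x + y) = re x + re y" "im (x + y) = im x + im y"
proof -
  have "x + y = of_rat (re x + re y) + of_rat (im x + im y) * \<omega>"
    by (subst expand[of x], subst expand[of y]) (simp add: of_rat_add algebra_simps)
  then show "re (x + y) = re x + re y" "im (x + y) = im x + im y"
    by (metis re_im_of)+
qed

lemma re_im_mult [simp]:
  "re (x * y) = re x * re y + of_int D * (im x * im y)" "im (x * y) = re x * im y + im x * re y"
proof -
  have "x * y = of_rat (re x * re y + of_int D * (im x * im y)) + of_rat (re x * im y + im x * re y) * \<omega>"
    by (subst expand[of x], subst expand[of y])
      (simp add: of_rat_add of_rat_mult algebra_simps omega_sq[symmetric])
  then show "re (x * y) = re x * re y + of_int D * (im x * im y)" "im (x * y) = re x * im y + im x * re y"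
    by (metis re_im_of)+
qed

lemma re_im_of_rat [simp]: "re (of_rat p) = p" "im (of_rat p) = 0"
  using re_im_of[of p 0] by simp_all

lemma re_im_of_int [simp]: "re (of_int n) = of_int n" "im (of_int n) = 0"
  using re_im_of_rat[of "of_int n"] by simp_all

lemma re_im_0 [simp]: "re 0 = 0" "im 0 = 0" using re_im_of_rat[of 0] by simp_all
lemma re_im_1 [simp]: "re 1 = 1" "im 1 = 0" using re_im_of_rat[of 1] by simp_all

lemma re_im_minus [simp]: "re (- x) = - re x" "im (- x) = - im x"
  using re_im_add[of x "-x"] by simp_all

lemma re_im_omega [simp]: "re \<omega> = 0" "im \<omega> = 1"
  using re_im_of[of 0 1] by simp_all

section \<open>Conjugation, trace and norm\<close>

definition cj :: "'k \<Rightarrow> 'k" where "cj x = of_rat (re x) - of_rat (im x) * \<omega>"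
definition tr :: "'k \<Rightarrow> rat" where "tr x = 2 * re x"
definition nm :: "'k \<Rightarrow> rat" where "nm x = (re x)\<^sup>2 - of_int D * (im x)\<^sup>2"

lemma re_im_cj [simp]: "re (cj x) = re x" "im (cj x) = - im x"
proof -
  have "cj x = of_rat (re x) + of_rat (- im x) * \<omega>" by (simp add: cj_def of_rat_minus)
  then show "re (cj x) = re x" "im (cj x) = - im x" by (metis re_im_of)+
qed

lemma cj_hom [simp]: "cj (x + y) = cj x + cj y" "cj (x * y) = cj x * cj y" "cj (of_rat r) = of_rat r"
  "cj (cj x) = x" "cj 0 = 0" "cj 1 = 1" "cj (of_int n) = of_int n" "cj (- x) = - cj x"
  by (auto intro!: eqI)

lemma add_cj: "x + cj x = of_rat (tr x)"
  by (auto intro!: eqI simp: tr_def)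

lemma mult_cj: "x * cj x = of_rat (nm x)"
  by (auto intro!: eqI simp: nm_def power2_eq_square)

lemma nm_mult: "nm (x * y) = nm x * nm y"
  by (simp add: nm_def algebra_simps power2_eq_square)
lemma cj_eq_0_iff [simp]: "cj x = 0 \<longleftrightarrow> x = 0"
  by (metis cj_hom(4,5))

lemma nm_eq_0_iff [simp]: "nm x = 0 \<longleftrightarrow> x = 0"
  by (metis cj_eq_0_iff mult_cj mult_eq_0_iff of_rat_eq_0_iff)

section \<open>The algebraic integers of K\<close>

lemma algebraic_int_quadratic:
  assumes "x * x = of_int a * x + of_int b" shows "algebraic_int (x::'a::field_char_0)"
proof (rule algebraic_int.intros[of "[:- of_int b, - of_int a, 1:]"])
  show "poly [:- of_int b, - of_int a, 1:] x = 0"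
    using assms by (simp add: algebra_simps)
qed (auto simp: coeff_pCons split: nat.splits)

lemma of_rat_Ints_iff: "(of_rat r :: 'a::field_char_0) \<in> \<int> \<longleftrightarrow> r \<in> \<int>"
  by (metis Ints_cases Ints_of_int of_rat_eq_iff of_rat_of_int_eq)

lemma algebraic_int_of_rat: "algebraic_int (of_rat r :: 'a :: field_char_0) \<longleftrightarrow> r \<in> \<int>"
  using rational_algebraic_int_is_int[of "of_rat r :: 'a"] of_rat_Ints_iff[of r, where 'a = 'a]
    int_imp_algebraic_int[of "of_rat r :: 'a"] by auto

text \<open>The order generated by \<omega>, used as a fixed reference lattice against which
  denominators are measured.\<close>

definition zlattice :: "'k set" where "zlattice = {x. re x \<in> \<int> \<and> im x \<in> \<int>}"

lemma zlattice_closed: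
  "x \<in> zlattice \<Longrightarrow> y \<in> zlattice \<Longrightarrow> x + y \<in> zlattice" "x \<in> zlattice \<Longrightarrow> y \<in> zlattice \<Longrightarrow> x * y \<in> zlattice"
  "of_int n \<in> zlattice" "x \<in> zlattice \<Longrightarrow> cj x \<in> zlattice" "x \<in> zlattice \<Longrightarrow> - x \<in> zlattice"
  by (auto simp: zlattice_def)

lemma zlattice_sum: "(\<And>i. i \<in> I \<Longrightarrow> f i \<in> zlattice) \<Longrightarrow> sum f I \<in> zlattice"
  using zlattice_closed(1) zlattice_closed(3)[of 0] by (induction I rule: infinite_finite_induct) auto

lemma zlattice_scale: "\<exists>N>0. of_int N * x \<in> zlattice"
proof -
  obtain a b where ab: "quotient_of (re x) = (a, b)" by fastforce
  obtain c d where cd: "quotient_of (im x) = (c, d)" by fastforce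
  have pos: "b > 0" "d > 0" using ab cd quotient_of_denom_pos by blast+
  have "re x = of_int a / of_int b" "im x = of_int c / of_int d"
    using ab cd quotient_of_div by blast+
  then have "of_int (b * d) * re x = of_int (a * d)" "of_int (b * d) * im x = of_int (b * c)"
    using pos by simp_all
  then have "of_int (b * d) * x \<in> zlattice"
    unfolding zlattice_def by (simp del: of_int_mult)
  then show ?thesis using pos by (metis mult_pos_pos)
qed

lemma zlattice_scale_finite:
  "finite I \<Longrightarrow> \<exists>N>0. \<forall>i\<in>I. of_int N * f i \<in> zlattice"
proof (induction I rule: finite_induct)
  case empty
  show ?case by (rule exI[of _ 1]) simp
next
  case (insert i I)
  obtain N M where N: "N > 0" "\<forall>i\<in>I. of_int N * f i \<in> zlattice" "M > 0" "of_int M * f i \<in> zlattice"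
    using insert zlattice_scale by blast
  have "of_int (N * M) * f j \<in> zlattice" if "j \<in> insert i I" for j
  proof (cases "j = i")
    case True
    have "of_int (N * M) * f j = of_int N * (of_int M * f i)" using True by simp
    then show ?thesis using N zlattice_closed by presburger
  next
    case False
    have "of_int (N * M) * f j = of_int M * (of_int N * f j)" by simp
    then show ?thesis using N zlattice_closed that False by (metis insertE)
  qed
  then show ?case using N by (metis mult_pos_pos)
qed

text \<open>
  An element is integral iff its powers have a common denominator; this criterion makes the
  closure of the integers under addition immediate.
\<close>
definition almost_integral :: "'k \<Rightarrow> bool" where
  "almost_integral x \<longleftrightarrow> (\<exists>N>0. \<forall>k. of_int N * x ^ k \<in> zlattice)"

text \<open>A monic equation of degree \<open>n\<close> rewrites every power from the
  \<open>n\<close>-th on as an integral combination of lower ones, so a common denominator of the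
  first \<open>n\<close> powers serves all of them.\<close>

lemma algebraic_int_imp_almost_integral:
  assumes "algebraic_int x" shows "almost_integral x"
proof -
  obtain p where p: "Polynomial.lead_coeff p = 1" "\<forall>i. Polynomial.coeff p i \<in> \<int>" "Polynomial.poly p x = 0"
    using assms by (auto simp: algebraic_int.simps)
  define n where "n = Polynomial.degree p"
  obtain N where N: "N > 0" "\<forall>i\<in>{..<n}. of_int N * x ^ i \<in> zlattice"
    using zlattice_scale_finite[of "{..<n}" "\<lambda>i. x ^ i"] by auto
  have xn: "x ^ n = (\<Sum>i<n. - Polynomial.coeff p i * x ^ i)"
  proof -
    have "0 = (\<Sum>i\<le>n. Polynomial.coeff p i * x ^ i)" using p by (simp add: poly_altdef n_def)
    also have "\<dots> = (\<Sum>i<n. Polynomial.coeff p i * x ^ i) + x ^ n"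
      using p by (simp add: lessThan_Suc_atMost[symmetric] n_def)
    finally show ?thesis by (simp add: sum_negf eq_neg_iff_add_eq_0 add.commute)
  qed
  have "of_int N * x ^ k \<in> zlattice" for k
  proof (induction k rule: less_induct)
    case (less k)
    show ?case
    proof (cases "k < n")
      case True then show ?thesis using N by auto
    next
      case False
      then have "of_int N * x ^ k = of_int N * (x ^ n * x ^ (k - n))"
        by (simp add: power_add[symmetric])
      also have "\<dots> = (\<Sum>i<n. - Polynomial.coeff p i * (of_int N * x ^ (i + (k - n))))"
        by (simp add: xn sum_distrib_left sum_distrib_right power_add algebra_simps)
      also have "\<dots> \<in> zlattice"
      proof (rule zlattice_sum)
        fix i assume "i \<in> {..<n}"
        then have "of_int N * x ^ (i + (k - n)) \<in> zlattice" using less False by auto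
        moreover have "- Polynomial.coeff p i \<in> zlattice"
          using p(2) zlattice_closed by (metis Ints_cases)
        ultimately show "- Polynomial.coeff p i * (of_int N * x ^ (i + (k - n))) \<in> zlattice"
          by (rule zlattice_closed(2)[rotated])
      qed
      finally show ?thesis .
    qed
  qed
  then show ?thesis using N unfolding almost_integral_def by blast
qed

text \<open>In the binomial expansion each term is a power of \<open>x\<close> times a power of
  \<open>y\<close>, so the product of the two denominators works for all exponents at once.\<close>

lemma almost_integral_add:
  assumes "almost_integral x" "almost_integral y" shows "almost_integral (x + y)"
proof -
  obtain N M where N: "N > 0" "\<forall>k. of_int N * x ^ k \<in> zlattice" and M: "M > 0" "\<forall>k. of_int M * y ^ k \<in> zlattice"
    using assms unfolding almost_integral_def by blast
  have "of_int (N * M) * (x + y) ^ k \<in> zlattice" for k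
  proof -
    have "of_int (N * M) * (x + y) ^ k =
        (\<Sum>i\<le>k. of_int (int (k choose i)) * ((of_int N * x ^ i) * (of_int M * y ^ (k - i))))"
      by (simp add: binomial_ring sum_distrib_left algebra_simps)
    also have "\<dots> \<in> zlattice"
    proof (rule zlattice_sum)
      fix i
      have "(of_int N * x ^ i) * (of_int M * y ^ (k - i)) \<in> zlattice"
        using N M zlattice_closed(2) by blast
      then show "of_int (int (k choose i)) * ((of_int N * x ^ i) * (of_int M * y ^ (k - i))) \<in> zlattice"
        by (rule zlattice_closed(2)[OF zlattice_closed(3)])
    qed
    finally show ?thesis .
  qed
  then show ?thesis using N M unfolding almost_integral_def by (metis mult_pos_pos)
qed

lemma almost_integral_mult:
  assumes "almost_integral x" "almost_integral y" shows "almost_integral (x * y)"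
proof -
  obtain N M where N: "N > 0" "\<forall>k. of_int N * x ^ k \<in> zlattice" and M: "M > 0" "\<forall>k. of_int M * y ^ k \<in> zlattice"
    using assms unfolding almost_integral_def by blast
  have "of_int (N * M) * (x * y) ^ k \<in> zlattice" for k
  proof -
    have "of_int (N * M) * (x * y) ^ k = (of_int N * x ^ k) * (of_int M * y ^ k)"
      by (simp add: power_mult_distrib)
    then show ?thesis using N M zlattice_closed by presburger
  qed
  then show ?thesis using N M unfolding almost_integral_def by (metis mult_pos_pos)
qed

lemma cj_power: "cj (x ^ k) = cj x ^ k"
  by (induction k) auto

lemma almost_integral_cj: "almost_integral x \<Longrightarrow> almost_integral (cj x)"
  unfolding almost_integral_def by (metis cj_hom(2,7) cj_power zlattice_closed(4))

text \<open>For a reduced fraction a/b, a common denominator of all powers is divisible by every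
  power of b, which forces b = 1.\<close>

lemma almost_integral_of_rat:
  assumes "almost_integral (of_rat r)" shows "r \<in> \<int>"
proof -
  obtain a b where ab: "quotient_of r = (a, b)" by fastforce
  have b: "b > 0" and cop: "coprime a b" and r: "r = of_int a / of_int b"
    using ab quotient_of_denom_pos quotient_of_coprime quotient_of_div by blast+
  obtain N where N: "N > 0" "\<And>k. of_int N * of_rat r ^ k \<in> zlattice"
    using assms unfolding almost_integral_def by blast
  have le: "b ^ k \<le> N" for k
  proof -
    have "of_int N * of_rat r ^ k = (of_rat (of_int N * r ^ k) :: 'k)"
      by (simp add: of_rat_mult of_rat_power)
    then have "of_int N * r ^ k \<in> \<int>"
      using N(2)[of k] by (metis zlattice_def mem_Collect_eq re_im_of_rat(1))
    then obtain c where "of_int N * r ^ k = of_int c" by (elim Ints_cases)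
    then have "of_int (N * a ^ k) = (of_int (c * b ^ k) :: rat)"
      using b by (simp add: r power_divide field_simps)
    then have "b ^ k dvd N * a ^ k" by (metis dvd_triv_right of_int_eq_iff)
    moreover have "coprime (b ^ k) (a ^ k)" using cop by (simp add: coprime_commute)
    ultimately have "b ^ k dvd N" using coprime_dvd_mult_left_iff by blast
    then show ?thesis using N zdvd_imp_le by blast
  qed
  have "b = 1"
  proof (rule ccontr)
    assume "b \<noteq> 1"
    \<comment> \<open>The exponent N itself is large enough, because 2^N exceeds N.\<close>
    then have "2 ^ nat N \<le> b ^ nat N" using b by (intro power_mono) auto
    then have "2 ^ nat N \<le> N" using le order_trans by blast
    moreover have "int (nat N) < 2 ^ nat N" by (metis of_nat_less_two_power)
    ultimately show False using N by simp
  qed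
  then show ?thesis using r by simp
qed

text \<open>A closed chain of implications: an algebraic integer is almost integral; trace and norm
  of an almost integral element are almost integral rationals, hence integers; and an element with
  integral trace and norm is a root of the monic polynomial X^2 - tr X + nm.\<close>

lemma algebraic_int_iff_almost: "algebraic_int x \<longleftrightarrow> almost_integral x"
  and algebraic_int_iff: "algebraic_int x \<longleftrightarrow> tr x \<in> \<int> \<and> nm x \<in> \<int>"
proof -
  have *: "tr x \<in> \<int> \<and> nm x \<in> \<int>" if "almost_integral x"
    using that almost_integral_of_rat almost_integral_cj almost_integral_add almost_integral_mult
    by (metis add_cj mult_cj)
  have "algebraic_int x" if *: "tr x \<in> \<int>" "nm x \<in> \<int>"
  proof -
    obtain a b where "tr x = of_int a" "nm x = of_int b" using * by (elim Ints_cases)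
    then have ab: "x + cj x = of_int a" "x * cj x = of_int b" using add_cj mult_cj by (metis of_rat_of_int_eq)+
    have "x * x = (x + cj x) * x + - (x * cj x)" by (simp add: algebra_simps)
    then have "x * x = of_int a * x + of_int (- b)" unfolding ab by simp
    then show ?thesis by (rule algebraic_int_quadratic)
  qed
  then show "algebraic_int x \<longleftrightarrow> almost_integral x" "algebraic_int x \<longleftrightarrow> tr x \<in> \<int> \<and> nm x \<in> \<int>"
    using algebraic_int_imp_almost_integral * by blast+
qed

lemma algebraic_int_closed:
  "algebraic_int x \<Longrightarrow> algebraic_int y \<Longrightarrow> algebraic_int (x + y)"
  "algebraic_int x \<Longrightarrow> algebraic_int y \<Longrightarrow> algebraic_int (x * y)"
  "algebraic_int x \<Longrightarrow> algebraic_int y \<Longrightarrow> algebraic_int (x - y)"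
  "algebraic_int x \<Longrightarrow> algebraic_int (cj x)"
  "algebraic_int (of_int n)" 
  using algebraic_int_iff_almost almost_integral_add almost_integral_mult almost_integral_cj
  by (metis, metis, metis algebraic_int_minus diff_conv_add_uminus, metis,
      metis Ints_of_int int_imp_algebraic_int)

lemma zlattice_imp_algebraic_int: "x \<in> zlattice \<Longrightarrow> algebraic_int x"
  unfolding algebraic_int_iff zlattice_def tr_def nm_def by auto

lemma D_neq_0 [simp]: "D \<noteq> 0"
  using omega_sq omega_irr by auto

text \<open>The square of \<open>2 * D * im x\<close> equals \<open>D\<close> times (trace squared
  minus 4 times the norm), an integer, and a rational number whose square is an integer is an
  integer.\<close>

lemma scaled_coords_Ints:
  assumes "algebraic_int x"
  shows "of_int (2 * D) * re x \<in> \<int>" "of_int (2 * D) * im x \<in> \<int>"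
proof -
  have tn: "2 * re x \<in> \<int>" "nm x \<in> \<int>" using assms by (auto simp: algebraic_int_iff tr_def)
  then have "of_int D * (2 * re x) \<in> \<int>" by auto
  then show "of_int (2 * D) * re x \<in> \<int>" by (simp add: algebra_simps)
  let ?y = "of_int (2 * D) * im x"
  have "?y * ?y = of_int D * ((2 * re x) * (2 * re x) - 4 * nm x)"
    by (simp add: nm_def algebra_simps power2_eq_square)
  also have "\<dots> \<in> \<int>" 
    by (rule Ints_mult[OF Ints_of_int Ints_diff[OF Ints_mult[OF tn(1) tn(1)] Ints_mult[OF Ints_numeral tn(2)]]])
  finally obtain b where "?y * ?y = of_int b" by (elim Ints_cases)
  then have "algebraic_int (of_rat ?y :: rat)"
    using algebraic_int_quadratic[of ?y 0 b] by simp
  then show "?y \<in> \<int>" unfolding algebraic_int_of_rat .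
qed

text \<open>Finiteness of the ring of integers modulo \<open>N\<close>, phrased as an invariant with
  finitely many values so that it can feed pigeonhole arguments. The invariant consists of the
  coordinates scaled by \<open>2 * D\<close>, which are integers, reduced modulo
  \<open>2 * D * N\<close>; equal values make both coordinates of the difference integral multiples
  of \<open>N\<close>.\<close>

lemma finite_residues:
  assumes "N \<noteq> 0"
  shows "\<exists>f :: 'k \<Rightarrow> int \<times> int. finite (f ` {x. algebraic_int x}) \<and>
    (\<forall>x y. algebraic_int x \<longrightarrow> algebraic_int y \<longrightarrow> f x = f y \<longrightarrow> (\<exists>z. algebraic_int z \<and> x - y = of_int N * z))"
proof -
  define M where "M = 2 * D * N"
  have M: "M \<noteq> 0" using assms by (simp add: M_def)
  define f where "f = (\<lambda>x. (\<lfloor>of_int (2 * D) * re x\<rfloor> mod M, \<lfloor>of_int (2 * D) * im x\<rfloor> mod M))"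
  \<comment> \<open>The interval is symmetric because the modulus may be negative, and
    \<open>mod\<close> takes the sign of the modulus.\<close>
  have "range (\<lambda>z. z mod M) \<subseteq> {- \<bar>M\<bar>..\<bar>M\<bar>}"
  proof clarify
    fix z
    have "\<bar>z mod M\<bar> < \<bar>M\<bar>" using M by (rule abs_mod_less)
    then show "z mod M \<in> {- \<bar>M\<bar>..\<bar>M\<bar>}" by (simp add: abs_less_iff)
  qed
  then have "f ` {x. algebraic_int x} \<subseteq> {- \<bar>M\<bar>..\<bar>M\<bar>} \<times> {- \<bar>M\<bar>..\<bar>M\<bar>}"
    by (auto simp: f_def)
  then have "finite (f ` {x. algebraic_int x})" by (rule finite_subset) simp
  moreover have "\<exists>z. algebraic_int z \<and> x - y = of_int N * z"
    if xy: "algebraic_int x" "algebraic_int y" and eq: "f x = f y" for x y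
  proof -
    have *: "\<exists>k. u - v = of_int N * of_int k"
      if u: "of_int (2 * D) * u \<in> \<int>" and v: "of_int (2 * D) * v \<in> \<int>" and
        e: "\<lfloor>of_int (2 * D) * u\<rfloor> mod M = \<lfloor>of_int (2 * D) * v\<rfloor> mod M" for u v :: rat
    proof -
      obtain a b where ab: "of_int (2 * D) * u = of_int a" "of_int (2 * D) * v = of_int b"
        using u v by (elim Ints_cases)
      then have "M dvd a - b" using e unfolding ab by (simp add: mod_eq_dvd_iff)
      then obtain k where "a - b = 2 * D * N * k" by (auto simp: M_def)
      then have "of_int (2 * D) * (u - v) = of_int (2 * D) * (of_int N * of_int k)"
        using ab by (simp add: algebra_simps flip: of_int_diff)
      then show ?thesis using D_neq_0 by (metis mult_left_cancel of_int_eq_0_iff mult_eq_0_iff zero_neq_numeral)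
    qed
    obtain k l where kl: "re x - re y = of_int N * of_int k" "im x - im y = of_int N * of_int l"
      using *[OF scaled_coords_Ints(1)[OF xy(1)] scaled_coords_Ints(1)[OF xy(2)]]
        *[OF scaled_coords_Ints(2)[OF xy(1)] scaled_coords_Ints(2)[OF xy(2)]] eq by (auto simp: f_def)
    have d: "re (x - y) = re x - re y" "im (x - y) = im x - im y"
      using re_im_add[of x "- y"] by simp_all
    have "algebraic_int (of_int k + of_int l * \<omega>)"
      by (rule zlattice_imp_algebraic_int) (simp add: zlattice_def)
    moreover have "x - y = of_int N * (of_int k + of_int l * \<omega>)"
      by (rule eqI) (simp_all add: d kl)
    ultimately show ?thesis by blast
  qed
  ultimately show ?thesis by blast
qed

end

section \<open>Positivity of the norm and finiteness of the unit group\<close>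

locale imaginary_quadratic = quadratic_field \<omega> D for \<omega> :: "'k::field_char_0" and D +
  assumes D_neg: "D < 0"
begin

lemma nm_nonneg: "nm x \<ge> 0"
proof -
  have "of_int D * (im x)\<^sup>2 \<le> 0" using D_neg by (simp add: mult_nonpos_nonneg)
  then show ?thesis by (simp add: nm_def) (smt (verit) zero_le_power2 order.trans)
qed

text \<open>A unit has norm 1, since norms are nonnegative integers and multiplicative. As
  \<open>D\<close> is negative, the norm is a sum of two nonnegative terms, so both coordinates are
  bounded by 1 in absolute value and the scaled coordinates are integers in a fixed box.\<close>

lemma finite_units: "finite {x :: 'k. algebraic_int x \<and> algebraic_int (inverse x)}" (is "finite ?U")
proof -
  define f where "f = (\<lambda>x. (\<lfloor>of_int (2 * D) * re x\<rfloor>, \<lfloor>of_int (2 * D) * im x\<rfloor>))"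
  define M where "M = 2 * \<bar>D\<bar>"
  have *: "f x \<in> {- M..M} \<times> {- M..M}" "of_int (fst (f x)) = of_int (2 * D) * re x"
      "of_int (snd (f x)) = of_int (2 * D) * im x" if x: "x \<in> ?U" for x
  proof -
    show c: "of_int (fst (f x)) = of_int (2 * D) * re x" "of_int (snd (f x)) = of_int (2 * D) * im x"
      using scaled_coords_Ints x by (simp_all add: f_def)
    show "f x \<in> {- M..M} \<times> {- M..M}"
    proof (cases "x = 0")
      \<comment> \<open>The number 0 belongs to the set as well, because
        \<open>inverse 0 = 0\<close>.\<close>
      case True then show ?thesis by (simp add: f_def M_def)
    next
      case False
      have "nm x * nm (inverse x) = 1"
        using False by (simp flip: nm_mult) (simp add: nm_def)
      moreover obtain a b where "nm x = of_int a" "nm (inverse x) = of_int b"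
        using x unfolding algebraic_int_iff mem_Collect_eq by (metis Ints_cases)
      ultimately have "a * b = 1" "a \<ge> 0" using nm_nonneg[of x]
        by (simp_all flip: of_int_mult) 
      then have "nm x = 1" using \<open>nm x = of_int a\<close> by (simp add: zmult_eq_1_iff)
      then have e: "(re x)\<^sup>2 + of_int (- D) * (im x)\<^sup>2 = 1" by (simp add: nm_def)
      have "1 \<le> - D" using D_neg by simp
      then have D1: "(1::rat) \<le> of_int (- D)" by (metis of_int_1 of_int_le_iff)
      have i: "(im x)\<^sup>2 \<le> of_int (- D) * (im x)\<^sup>2" using mult_right_mono[OF D1, of "(im x)\<^sup>2"] by simp
      have "(re x)\<^sup>2 \<le> 1" "(im x)\<^sup>2 \<le> 1" using e i zero_le_power2[of "re x"] zero_le_power2[of "im x"] by linarith+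
      then have "\<bar>re x\<bar> \<le> 1" "\<bar>im x\<bar> \<le> 1" by (simp_all add: abs_square_le_1)
      then have "\<bar>of_int (2 * D) * re x\<bar> \<le> of_int M" "\<bar>of_int (2 * D) * im x\<bar> \<le> of_int M"
        unfolding abs_mult M_def by (simp_all add: mult_left_le abs_mult)
      then have "\<bar>fst (f x)\<bar> \<le> M" "\<bar>snd (f x)\<bar> \<le> M"
        unfolding c[symmetric] by (simp_all flip: of_int_abs)
      then show ?thesis by (auto simp: mem_Times_iff abs_le_iff)
    qed
  qed
  have "inj_on f ?U"
  proof (rule inj_onI)
    fix x y assume xy: "x \<in> ?U" "y \<in> ?U" "f x = f y"
    then have "of_int (2 * D) * re x = of_int (2 * D) * re y" "of_int (2 * D) * im x = of_int (2 * D) * im y"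
      using * by metis+
    then have "re x = re y" "im x = im y"
      by (simp_all)
    then show "x = y" by (rule eqI)
  qed
  moreover have "finite (f ` ?U)"
    by (rule finite_subset[of _ "{- M..M} \<times> {- M..M}"]) (use *(1) in blast, simp)
  ultimately show ?thesis using finite_imageD by blast
qed

end

section \<open>Embeddings into the complex numbers\<close>

context quadratic_field begin

definition emb :: "complex \<Rightarrow> 'k \<Rightarrow> complex" where
  "emb w x = of_rat (re x) + of_rat (im x) * w"

lemma emb_in_embeddings:
  assumes "w * w = of_int D" shows "emb w \<in> embeddings"
  unfolding embeddings_def ring_of_type_algebra_def
  by (rule ring_hom_memI)
    (auto simp: emb_def of_rat_add of_rat_mult algebra_simps assms[symmetric])

text \<open>A ring homomorphism fixes the rational numbers, so it is determined by the image of
  \<omega>, which must be one of the two square roots of \<open>D\<close>.\<close>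

lemma embeddings_subset:
  assumes "w * w = of_int D" and \<tau>: "\<tau> \<in> embeddings"
  shows "\<tau> = emb w \<or> \<tau> = emb (- w)"
proof -
  have h: "\<tau> (x + y) = \<tau> x + \<tau> y" "\<tau> (x * y) = \<tau> x * \<tau> y" "\<tau> 1 = 1" for x y
    using \<tau> unfolding embeddings_def ring_of_type_algebra_def
    by (auto dest: ring_hom_add ring_hom_mult ring_hom_one simp: ring_hom_def)
  have h0: "\<tau> 0 = 0" using h(1)[of 0 0] by simp
  have hm: "\<tau> (- x) = - \<tau> x" for x using h(1)[of x "- x"] h0 by (simp add: eq_neg_iff_add_eq_0 add.commute)
  have hn: "\<tau> (of_nat n) = of_nat n" for n by (induction n) (auto simp: h h0)
  have hi: "\<tau> (of_int n) = of_int n" for n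
  proof (cases n)
    case (neg k)
    have "of_int n = - (of_nat (Suc k) :: 'k)" "of_int n = - (of_nat (Suc k) :: complex)"
      by (simp_all add: neg)
    then show ?thesis using hm hn by metis
  qed (simp add: hn)
  have hr: "\<tau> (of_rat r) = of_rat r" for r
  proof -
    obtain a b where ab: "quotient_of r = (a, b)" by fastforce
    have b: "b > 0" and r: "r = of_int a / of_int b"
      using ab quotient_of_denom_pos quotient_of_div by blast+
    have "of_int b * of_rat r = (of_int a :: 'k)" "of_int b * of_rat r = (of_int a :: complex)"
      using b by (simp_all add: r of_rat_divide)
    then have "of_int b * \<tau> (of_rat r) = of_int b * of_rat r" by (metis h(2) hi)
    then show ?thesis using b by simp
  qed
  have "\<tau> \<omega> * \<tau> \<omega> = w * w" by (metis assms(1) h(2) hi omega_sq)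
  then have "\<tau> \<omega> = w \<or> \<tau> \<omega> = - w" using square_eq_iff by metis
  moreover have "\<tau> = emb (\<tau> \<omega>)"
  proof
    fix x
    show "\<tau> x = emb (\<tau> \<omega>) x"
      unfolding emb_def by (subst expand[of x]) (simp only: h hr)
  qed
  ultimately show ?thesis by metis
qed

lemma emb_omega [simp]: "emb w \<omega> = w" by (simp add: emb_def)

end

text \<open>The square roots of the negative number \<open>D\<close> are purely imaginary and
  nonzero, so complex conjugation exchanges them: there is exactly one archimedean place, and it is
  complex.\<close>

lemma (in imaginary_quadratic) embeddings_eq:
  obtains \<sigma> where "\<sigma> \<in> embeddings" "embeddings = {\<sigma>, cnj \<circ> \<sigma>}" "\<sigma> \<noteq> cnj \<circ> (\<sigma> :: 'k \<Rightarrow> complex)"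
    "cnj \<circ> (cnj \<circ> \<sigma>) = \<sigma>"
proof -
  define w where "w = \<i> * complex_of_real (sqrt (of_int (- D)))"
  have "complex_of_real (sqrt (of_int (- D))) * complex_of_real (sqrt (of_int (- D))) = of_int (- D)"
    using D_neg by (simp flip: of_real_mult)
  then have w: "w * w = of_int D"
    unfolding w_def by (simp add: algebra_simps) 
  have cw: "cnj w = - w" by (simp add: w_def)
  have of_rat_cnj: "cnj (of_rat r) = of_rat r" for r
    by (metis Reals_cnj_iff of_rat_real)
  have e: "cnj \<circ> emb w = emb (- w)" by (auto simp: emb_def fun_eq_iff of_rat_cnj cw)
  have "w \<noteq> - w" using w D_neq_0 by auto
  then have "emb w \<noteq> emb (- w)" by (metis emb_omega)
  moreover have "embeddings = {emb w, emb (- w)}"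
    using emb_in_embeddings[of w] emb_in_embeddings[of "- w"] embeddings_subset[of w] w by auto
  moreover have "cnj \<circ> emb (- w) = emb w" unfolding e[symmetric] by (simp add: fun_eq_iff)
  ultimately show ?thesis using that[of "emb w"] e by (metis insertI1)
qed

text \<open>Completing the square in the quadratic equation of a generator gives \<theta> with
  rational square u/v, and \<omega> = v \<theta> has the integral square u v. If u v were
  nonnegative, its real square root would define an embedding with real image, contrary to the
  hypothesis.\<close>

lemma imaginary_quadratic_field_obtain:
  assumes "imaginary_quadratic_field TYPE('k::field_char_0)"
  obtains \<omega> :: "'k::field_char_0" and D where "imaginary_quadratic \<omega> D"
proof -
  obtain b :: 'k where b: "b \<notin> \<rat>" "\<And>x. \<exists>p q. x = of_rat p + of_rat q * b"
    using dim_2_imp_generator assms unfolding imaginary_quadratic_field_def by metis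
  obtain r s where rs: "b * b = of_rat r + of_rat s * b" using b by blast
  define \<theta> where "\<theta> = b - of_rat (s / 2)"
  have \<theta>: "\<theta> * \<theta> = of_rat (r + s\<^sup>2 / 4)"
  proof -
    have "\<theta> * \<theta> = b * b - of_rat s * b + of_rat (s / 2) * of_rat (s / 2)"
      by (simp add: \<theta>_def algebra_simps of_rat_divide)
    also have "\<dots> = of_rat (r + s\<^sup>2 / 4)" unfolding rs
      by (simp add: of_rat_add of_rat_divide power2_eq_square of_rat_mult)
    finally show ?thesis .
  qed
  obtain u v where uv: "quotient_of (r + s\<^sup>2 / 4) = (u, v)" by fastforce
  have v: "v > 0" and d: "r + s\<^sup>2 / 4 = of_int u / of_int v"
    using uv quotient_of_denom_pos quotient_of_div by blast+
  define \<omega> where "\<omega> = of_int v * \<theta>"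
  have "\<omega> * \<omega> = of_int v * of_int v * (\<theta> * \<theta>)" by (simp add: \<omega>_def)
  also have "\<dots> = of_int (u * v)" unfolding \<theta> d using v by (simp add: of_rat_divide)
  finally have 1: "\<omega> * \<omega> = of_int (u * v)" .
  have b\<omega>: "b = of_rat (1 / of_int v) * \<omega> + of_rat (s / 2)"
    using v by (simp add: \<omega>_def \<theta>_def of_rat_divide)
  interpret quadratic_field \<omega> "u * v"
  proof
    show "\<omega> \<notin> \<rat>" using b(1) b\<omega> by (metis Rats_add Rats_mult Rats_of_rat)
    fix x
    obtain p q where "x = of_rat p + of_rat q * b" using b by blast
    then have "x = of_rat (p + q * (s / 2)) + of_rat (q * (1 / of_int v)) * \<omega>"
      by (subst (asm) b\<omega>) (simp only: of_rat_add of_rat_mult algebra_simps)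
    then show "\<exists>p q. x = of_rat p + of_rat q * \<omega>" by blast
  qed (rule 1)
  have "u * v < 0"
  proof (rule ccontr)
    assume "\<not> u * v < 0"
    then have D_real: "real_of_int (u * v) \<ge> 0" by (metis not_less of_int_0_le_iff)
    then have "complex_of_real (sqrt (of_int (u * v))) * complex_of_real (sqrt (of_int (u * v))) = of_int (u * v)"
      unfolding of_real_mult[symmetric] real_sqrt_mult_self abs_of_nonneg[OF D_real] by simp
    then have "emb (complex_of_real (sqrt (of_int (u * v)))) \<in> embeddings" (is "?\<sigma> \<in> _") by (rule emb_in_embeddings)
    moreover have "range ?\<sigma> \<subseteq> \<real>"
      by (auto simp: emb_def intro!: Reals_add Reals_mult of_rat_real)
    ultimately show False using assms unfolding imaginary_quadratic_field_def by blast
  qed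
  then have "imaginary_quadratic \<omega> (u * v)"
    by unfold_locales
  then show ?thesis by (rule that)
qed

section \<open>The localization of the ring of integers at a maximal ideal\<close>

text \<open>
  What is needed about the prime \<open>P\<close>: its localization \<open>R\<close> is a discrete valuation ring with
  uniformizer \<open>\<pi>\<close> in which the ring of integers is dense.
\<close>
locale local_dvr =
  fixes P :: "'k::field_char_0 set" and R :: "'k set" and \<pi> :: 'k
  assumes R_1: "1 \<in> R" and R_diff: "x \<in> R \<Longrightarrow> y \<in> R \<Longrightarrow> x - y \<in> R"
    and R_mult: "x \<in> R \<Longrightarrow> y \<in> R \<Longrightarrow> x * y \<in> R"
    and pi_R: "\<pi> \<in> R" and pi_nz: "\<pi> \<noteq> 0" and pi_inv: "inverse \<pi> \<notin> R"
    and factor: "x \<noteq> 0 \<Longrightarrow> \<exists>n u. u \<in> R \<and> inverse u \<in> R \<and> (x = \<pi> ^ n * u \<or> x = inverse (\<pi> ^ n) * u)"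
    and localized: "localized_power P n = (\<lambda>r. \<pi> ^ n * r) ` R"
    and integers_R: "algebraic_int x \<Longrightarrow> x \<in> R"
    and integers_dense: "x \<in> R \<Longrightarrow> \<exists>a. algebraic_int a \<and> x - a \<in> localized_power P n"
begin

abbreviation L :: "nat \<Rightarrow> 'k set" where "L \<equiv> localized_power P"

lemma R_0: "0 \<in> R" using R_diff[OF R_1 R_1] by simp
lemma R_minus: "x \<in> R \<Longrightarrow> - x \<in> R" using R_diff[OF R_0] by simp
lemma R_add: "x \<in> R \<Longrightarrow> y \<in> R \<Longrightarrow> x + y \<in> R" using R_diff[of x "- y"] R_minus by simp
lemma R_power: "x \<in> R \<Longrightarrow> x ^ n \<in> R" by (induction n) (auto intro: R_1 R_mult)

lemma L_iff: "x \<in> L n \<longleftrightarrow> inverse (\<pi> ^ n) * x \<in> R"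
proof
  show "x \<in> L n \<Longrightarrow> inverse (\<pi> ^ n) * x \<in> R"
    using pi_nz by (auto simp: localized mult.assoc[symmetric])
  show "inverse (\<pi> ^ n) * x \<in> R \<Longrightarrow> x \<in> L n"
    using pi_nz by (auto simp: localized intro!: image_eqI[of _ _ "inverse (\<pi> ^ n) * x"])
qed

lemma L_zero: "L 0 = R" by (auto simp: L_iff)

lemma L_0 [simp]: "0 \<in> L n" by (simp add: L_iff R_0)
lemma L_diff: "x \<in> L n \<Longrightarrow> y \<in> L n \<Longrightarrow> x - y \<in> L n"
  by (simp add: L_iff right_diff_distrib R_diff)
lemma L_add: "x \<in> L n \<Longrightarrow> y \<in> L n \<Longrightarrow> x + y \<in> L n"
  by (simp add: L_iff distrib_left R_add)
lemma L_minus: "x \<in> L n \<Longrightarrow> - x \<in> L n"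
  using L_diff[OF L_0] by simp
lemma L_diff_commute: "x - y \<in> L n \<Longrightarrow> y - x \<in> L n"
  using L_minus by fastforce
lemma L_mult: "x \<in> L m \<Longrightarrow> y \<in> L n \<Longrightarrow> x * y \<in> L (m + n)"
  using R_mult[of "inverse (\<pi> ^ m) * x" "inverse (\<pi> ^ n) * y"]
  by (simp add: L_iff power_add mult_ac)

lemma L_antimono: "m \<le> n \<Longrightarrow> L n \<subseteq> L m"
proof
  fix x assume "m \<le> n" "x \<in> L n"
  then have "\<pi> ^ (n - m) * (inverse (\<pi> ^ n) * x) \<in> R"
    by (intro R_mult[OF R_power[OF pi_R]]) (simp add: L_iff)
  moreover have "\<pi> ^ (n - m) * (inverse (\<pi> ^ n) * x) = inverse (\<pi> ^ m) * x"
    using pi_nz \<open>m \<le> n\<close> by (simp add: power_diff field_simps)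
  ultimately show "x \<in> L m" by (simp add: L_iff)
qed

lemma L_mult_R: "x \<in> L n \<Longrightarrow> r \<in> R \<Longrightarrow> x * r \<in> L n" "x \<in> L n \<Longrightarrow> r \<in> R \<Longrightarrow> r * x \<in> L n"
  using L_mult[of x n r 0] L_mult[of r 0 x n] L_zero by auto

lemma one_notin_L1: "1 \<notin> L 1" using pi_inv by (simp add: L_iff)

lemma pi_power_L: "\<pi> ^ n \<in> L n" using pi_nz by (simp add: L_iff R_1)

text \<open>Non-membership in \<open>L n\<close> says that the valuation of \<open>y\<close> is less
  than \<open>n\<close>, so the quotient of \<pi>^n by \<open>y\<close> has positive valuation. This
  replaces computing with a valuation function.\<close>

lemma nonmember_inverse:
  assumes "y \<notin> L n" shows "\<pi> ^ n * inverse y \<in> L 1"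
proof -
  have y: "y \<noteq> 0" using assms by auto
  obtain k u where u: "u \<in> R" "inverse u \<in> R" "y = \<pi> ^ k * u \<or> y = inverse (\<pi> ^ k) * u"
    using factor[OF y] by blast
  from u(3) show ?thesis
  proof
    assume y: "y = \<pi> ^ k * u"
    then have "k < n" using assms pi_power_L[of k] L_antimono[of n k] L_mult_R(1)[of "\<pi> ^ k" n u] u
      by (meson not_le subsetD)
    have "\<pi> ^ n * inverse y = \<pi> ^ (n - k) * inverse u"
      using y pi_nz \<open>k < n\<close> by (simp add: power_diff field_simps)
    also have "\<dots> \<in> L (n - k)" by (intro L_mult_R pi_power_L u)
    finally show ?thesis using L_antimono[of 1 "n - k"] \<open>k < n\<close> by (simp add: subset_iff)
  next
    assume y: "y = inverse (\<pi> ^ k) * u"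
    show ?thesis
    proof (cases "n + k = 0")
      case True
      then have "y \<in> L n" using y u L_zero by simp
      with assms show ?thesis by simp
    next
      case False
      have "\<pi> ^ n * inverse y = \<pi> ^ (n + k) * inverse u"
        using pi_nz unfolding y by (simp add: power_add mult_ac)
      also have "\<dots> \<in> L (n + k)" by (intro L_mult_R pi_power_L u)
      finally show ?thesis using L_antimono[of 1 "n + k"] False by (simp add: subset_iff)
    qed
  qed
qed

lemma inverse_R: "x \<in> R \<Longrightarrow> x \<notin> L 1 \<Longrightarrow> inverse x \<in> R"
  using nonmember_inverse[of x 1] L_iff[of "\<pi> * inverse x" 1] pi_nz by (simp add: field_simps)

text \<open>An element congruent to 1 cannot lie in the maximal ideal \<open>L 1\<close>, since then
  1 would lie there too; what is outside the maximal ideal is invertible.\<close>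

lemma one_plus_L1:
  assumes "x - 1 \<in> L 1" shows "x \<in> R" "inverse x \<in> R" "x \<noteq> 0"
proof -
  have "(x - 1) + 1 \<in> R" using assms L_antimono[of 0 1] L_zero by (intro R_add R_1) auto
  then show "x \<in> R" by simp
  have "x \<notin> L 1" using L_diff[of x 1 "x - 1"] assms one_notin_L1 by auto
  then show "inverse x \<in> R" "x \<noteq> 0" using inverse_R \<open>x \<in> R\<close> by auto
qed

lemma bounded_denominator: "\<exists>n. \<pi> ^ n * x \<in> R"
proof (cases "x = 0")
  case False
  then obtain n u where u: "u \<in> R" "x = \<pi> ^ n * u \<or> x = inverse (\<pi> ^ n) * u"
    using factor by blast
  then have "\<pi> ^ n * x = \<pi> ^ n * (\<pi> ^ n * u) \<or> \<pi> ^ n * x = u" using pi_nz by auto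
  then have "\<pi> ^ n * x \<in> R" using u R_mult R_power pi_R by metis
  then show ?thesis by blast
qed (auto simp: R_0)

text \<open>Continuity of multiplication by a fixed element at 0: a denominator \<pi>^k of
  \<open>x\<close> costs \<open>k\<close> steps of precision.\<close>

lemma mult_in_L: "\<exists>m. \<forall>y\<in>L m. x * y \<in> L n"
proof -
  obtain k where k: "\<pi> ^ k * x \<in> R" using bounded_denominator by blast
  have "x * y \<in> L n" if "y \<in> L (k + n)" for y
  proof -
    have "(\<pi> ^ k * x) * (inverse (\<pi> ^ (k + n)) * y) \<in> R" using k that by (intro R_mult[of "\<pi> ^ k * x"]) (auto simp: L_iff)
    then show ?thesis using pi_nz by (simp add: L_iff power_add field_simps)
  qed
  then show ?thesis by blast
qed

text \<open>Separatedness of the P-adic topology. Multiplication by the inverse of \<open>x\<close>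
  maps some \<open>L m\<close> into \<open>L 1\<close>; if \<open>x\<close> were in that
  \<open>L m\<close>, then 1 would lie in \<open>L 1\<close>.\<close>

lemma nonzero_notin_L: "x \<noteq> 0 \<Longrightarrow> \<exists>n. x \<notin> L n"
proof -
  assume "x \<noteq> 0"
  obtain m where "\<forall>y\<in>L m. inverse x * y \<in> L 1" using mult_in_L by blast
  then have "x \<notin> L m" using one_notin_L1 \<open>x \<noteq> 0\<close> by force
  then show ?thesis by blast
qed

end


section \<open>Ideals of the ring of integers\<close>

context quadratic_field begin

abbreviation ints :: "'k set" where "ints \<equiv> {x. algebraic_int x}"

lemma ring_of_integers_simps [simp]:
  "carrier ring_of_integers = ints" "x \<otimes>\<^bsub>ring_of_integers\<^esub> y = x * (y::'k)"
  "x \<oplus>\<^bsub>ring_of_integers\<^esub> y = x + (y::'k)" "\<one>\<^bsub>ring_of_integers\<^esub> = (1::'k)" "\<zero>\<^bsub>ring_of_integers\<^esub> = (0::'k)"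
  by (simp_all add: ring_of_integers_def ring_of_type_algebra_def)

lemma algebraic_int_1 [simp]: "algebraic_int (1::'k)"
  using algebraic_int_closed(5)[of 1] by simp

lemma algebraic_int_power: "algebraic_int (x::'k) \<Longrightarrow> algebraic_int (x ^ n)"
  by (induction n) (auto intro: algebraic_int_closed)

lemma cring_integers: "cring (ring_of_integers :: 'k ring)"
proof (rule cringI)
  show "abelian_group (ring_of_integers :: 'k ring)"
  proof (rule abelian_groupI)
    fix x :: 'k assume "x \<in> carrier ring_of_integers"
    then show "\<exists>y\<in>carrier ring_of_integers. y \<oplus>\<^bsub>ring_of_integers\<^esub> x = \<zero>\<^bsub>ring_of_integers\<^esub>"
      by (intro bexI[of _ "- x"]) auto
  qed (auto intro: algebraic_int_closed simp: algebra_simps)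
  show "comm_monoid (ring_of_integers :: 'k ring)"
    by (rule comm_monoidI) (auto intro: algebraic_int_closed)
qed (auto simp: algebra_simps)

lemma ideal_integersD:
  assumes "ideal I (ring_of_integers :: 'k ring)"
  shows "I \<subseteq> ints" "0 \<in> I" "x \<in> I \<Longrightarrow> y \<in> I \<Longrightarrow> x + y \<in> I" "x \<in> I \<Longrightarrow> algebraic_int r \<Longrightarrow> r * x \<in> I"
    "x \<in> I \<Longrightarrow> y \<in> I \<Longrightarrow> x - y \<in> I"
proof -
  interpret ideal I "ring_of_integers :: 'k ring" by fact
  have add: "x + y \<in> I" if "x \<in> I" "y \<in> I" for x y
    using additive_subgroup.a_closed[OF additive_subgroup_axioms that] by simp
  show "I \<subseteq> ints" "0 \<in> I" using a_subset additive_subgroup.zero_closed[OF additive_subgroup_axioms] by auto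
  have mult: "r * x \<in> I" if "x \<in> I" "algebraic_int r" for r x
    using I_l_closed[of x r] that by simp
  show "x \<in> I \<Longrightarrow> y \<in> I \<Longrightarrow> x + y \<in> I" "x \<in> I \<Longrightarrow> algebraic_int r \<Longrightarrow> r * x \<in> I"
    by (fact add, fact mult)
  show "x \<in> I \<Longrightarrow> y \<in> I \<Longrightarrow> x - y \<in> I" using add[of x "- 1 * y"] mult[of y "- 1"] by simp
qed

lemma ideal_integersI:
  assumes "I \<subseteq> ints" "0 \<in> I" "\<And>x y. x \<in> I \<Longrightarrow> y \<in> I \<Longrightarrow> x + y \<in> I"
    "\<And>x r. x \<in> I \<Longrightarrow> algebraic_int r \<Longrightarrow> r * x \<in> I"
  shows "ideal I (ring_of_integers :: 'k ring)"
proof (rule idealI)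
  interpret cring "ring_of_integers :: 'k ring" by (rule cring_integers)
  show "ring (ring_of_integers :: 'k ring)" by (rule ring_axioms)
  show "subgroup I (add_monoid ring_of_integers)"
  proof (rule add.subgroupI)
    fix a assume a: "a \<in> I"
    have "\<ominus>\<^bsub>ring_of_integers\<^esub> a = - a"
      using a assms(1) by (intro minus_equality) auto
    then show "\<ominus>\<^bsub>ring_of_integers\<^esub> a \<in> I"
      using assms(4)[OF a, of "- 1"] by simp
  qed (use assms(1-3) in auto)
qed (use assms(4) in \<open>auto simp: mult.commute\<close>)

text \<open>An ideal containing \<open>x\<close> contains its norm \<open>N\<close>, which is
  \<open>x\<close> times its conjugate. Hence it is a union of residue classes modulo
  \<open>N\<close> and is determined by its image under the finite-valued invariant of
  \<open>finite_residues\<close>.\<close>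

lemma finite_ideals_containing:
  assumes "x \<noteq> 0" "algebraic_int (x::'k)"
  shows "finite {I. ideal I ring_of_integers \<and> x \<in> I}"
proof -
  obtain N where N: "nm x = of_int N" using assms(2) unfolding algebraic_int_iff by (elim conjE Ints_cases) blast
  then have "N \<noteq> 0" using assms(1) nm_eq_0_iff by fastforce
  then obtain f :: "'k \<Rightarrow> int \<times> int" where f: "finite (f ` ints)"
    "\<And>x y. algebraic_int x \<Longrightarrow> algebraic_int y \<Longrightarrow> f x = f y \<Longrightarrow> \<exists>z. algebraic_int z \<and> x - y = of_int N * z"
    using finite_residues by blast
  have NI: "of_int N * z \<in> I" if "ideal I ring_of_integers" "x \<in> I" "algebraic_int z" for I z
  proof -
    have "of_int N * z = (z * cj x) * x" using mult_cj[of x] N by (simp add: algebra_simps)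
    then show ?thesis using ideal_integersD(4)[OF that(1,2)] that(3) assms(2) algebraic_int_closed by presburger
  qed
  have "inj_on (\<lambda>I. f ` I) {I. ideal I ring_of_integers \<and> x \<in> I}"
  proof (rule inj_onI)
    have sub: "I \<subseteq> J" if I: "ideal I ring_of_integers" "x \<in> I" and J: "ideal J ring_of_integers" "x \<in> J"
      and eq: "f ` I = f ` J" for I J
    proof
      fix a assume a: "a \<in> I"
      then obtain b where b: "b \<in> J" "f a = f b" using eq by blast
      then obtain z where "algebraic_int z" "a - b = of_int N * z"
        using f(2)[of a b] a ideal_integersD(1) I J by blast
      then have "(a - b) + b \<in> J" using NI[OF J] b ideal_integersD(3)[OF J(1)] by metis
      then show "a \<in> J" by simp
    qed
    fix I J
    assume "I \<in> {I. ideal I ring_of_integers \<and> x \<in> I}" "J \<in> {I. ideal I ring_of_integers \<and> x \<in> I}" "f ` I = f ` J"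
    then show "I = J" using sub[of I J] sub[of J I] by auto
  qed
  moreover have "finite ((\<lambda>I. f ` I) ` {I. ideal I ring_of_integers \<and> x \<in> I})"
    by (rule finite_subset[OF _ finite_Pow_iff[THEN iffD2, OF f(1)]]) (use ideal_integersD(1) in blast)
  ultimately show ?thesis using finite_imageD by blast
qed

lemma maximal_idealD:
  assumes "P \<in> maximal_ideals"
  shows "ideal P (ring_of_integers :: 'k ring)" "1 \<notin> P"
    "algebraic_int s \<Longrightarrow> s \<notin> P \<Longrightarrow> \<exists>t. algebraic_int t \<and> 1 - s * t \<in> P"
    "algebraic_int s \<Longrightarrow> algebraic_int t \<Longrightarrow> s \<notin> P \<Longrightarrow> t \<notin> P \<Longrightarrow> s * t \<notin> P"
proof -
  interpret maximalideal P "ring_of_integers :: 'k ring"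
    using assms by (simp add: maximal_ideals_def)
  show id: "ideal P (ring_of_integers :: 'k ring)" by (rule is_ideal)
  note I = ideal_integersD[OF id]
  show one: "1 \<notin> P"
  proof
    assume "1 \<in> P"
    then have "ints \<subseteq> P" using I(4)[of 1] by auto
    then show False using I_notcarr I(1) by auto
  qed
  have ex: "\<exists>t. algebraic_int t \<and> 1 - s * t \<in> P" if s: "algebraic_int s" "s \<notin> P" for s
  proof -
    define J where "J = {p + s * t | p t. p \<in> P \<and> algebraic_int t}"
    have JI: "p + s * t \<in> J" if "p \<in> P" "algebraic_int t" for p t using that by (auto simp: J_def)
    have "ideal J ring_of_integers"
    proof (rule ideal_integersI)
      show "J \<subseteq> ints" using I(1) s algebraic_int_closed by (auto simp: J_def)
      show "0 \<in> J" using JI[of 0 0] I(2) by simp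
      fix x assume "x \<in> J"
      then obtain p t where x: "x = p + s * t" "p \<in> P" "algebraic_int t" by (auto simp: J_def)
      show "r * x \<in> J" if "algebraic_int r" for r
        using JI[of "r * p" "r * t"] x that I algebraic_int_closed by (simp add: algebra_simps)
      fix y assume "y \<in> J"
      then obtain q u where y: "y = q + s * u" "q \<in> P" "algebraic_int u" by (auto simp: J_def)
      show "x + y \<in> J"
        using JI[of "p + q" "t + u"] x y I algebraic_int_closed by (simp add: algebra_simps)
    qed
    moreover have "P \<subseteq> J" using JI[of _ 0] by auto
    moreover have "s \<in> J" using JI[of 0 1] I(2) by simp
    moreover have "J \<subseteq> ints" using \<open>ideal J ring_of_integers\<close> ideal_integersD(1) by blast
    ultimately have "J = ints" using I_maximal[of J] s by auto
    then have "1 \<in> J" by simp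
    then obtain p t where "1 = p + s * t" "p \<in> P" "algebraic_int t" by (auto simp: J_def)
    then have "1 - s * t = p" by (simp add: algebra_simps)
    then show ?thesis using \<open>p \<in> P\<close> \<open>algebraic_int t\<close> by blast
  qed
  then show "algebraic_int s \<Longrightarrow> s \<notin> P \<Longrightarrow> \<exists>t. algebraic_int t \<and> 1 - s * t \<in> P" by blast
  show "s * t \<notin> P" if st: "algebraic_int s" "algebraic_int t" "s \<notin> P" "t \<notin> P"
  proof
    assume "s * t \<in> P"
    obtain u v where "algebraic_int u" "1 - s * u \<in> P" "algebraic_int v" "1 - t * v \<in> P" using ex st by metis
    moreover have "1 = (1 - s * u) + (s * u) * (1 - t * v) + (u * v) * (s * t)" by (simp add: algebra_simps)
    ultimately have "1 \<in> P" using I \<open>s * t \<in> P\<close> st algebraic_int_closed(2) by metis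
    with one show False ..
  qed
qed

text \<open>If P were zero, every nonzero integer would be invertible, but 1/2 is not an algebraic
  integer.\<close>

lemma maximal_ideal_nonzero:
  assumes "P \<in> maximal_ideals" shows "\<exists>x\<in>P. x \<noteq> (0::'k)"
proof (rule ccontr)
  assume "\<not> ?thesis"
  then have P0: "P \<subseteq> {0}" by auto
  have "algebraic_int (2::'k)" using algebraic_int_closed(5)[of 2] by simp
  then obtain t :: 'k where "algebraic_int t" "1 - 2 * t \<in> P"
    using maximal_idealD(3)[OF assms, of 2] P0 by fastforce
  then have "2 * t = 1" using P0 by auto
  then have "t = of_rat (1 / 2)" by (simp add: of_rat_divide field_simps)
  then have "(1/2::rat) \<in> \<int>" using \<open>algebraic_int t\<close> algebraic_int_of_rat by metis
  then obtain n where "(1/2::rat) = of_int n" by (elim Ints_cases)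
  then have "of_int 1 = (of_int (2 * n) :: rat)" by simp
  then have "1 = 2 * n" by (metis of_int_eq_iff)
  then show False by presburger
qed

text \<open>
  The ideals containing a nonzero element are finitely many, so no form of Zorn's lemma is needed.
\<close>
lemma ideal_in_maximal_ideal:
  assumes I: "ideal I (ring_of_integers :: 'k ring)" and x: "x \<in> I" "x \<noteq> 0" and 1: "1 \<notin> I"
  shows "\<exists>P\<in>maximal_ideals. I \<subseteq> P"
proof -
  define \<I> where "\<I> = {J. ideal J (ring_of_integers :: 'k ring) \<and> I \<subseteq> J \<and> 1 \<notin> J}"
  have "\<I> \<subseteq> {I. ideal I ring_of_integers \<and> x \<in> I}" using x by (auto simp: \<I>_def)
  then have "finite \<I>" using finite_ideals_containing[of x] ideal_integersD(1)[OF I] x finite_subset by blast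
  moreover have "I \<in> \<I>" using I 1 by (simp add: \<I>_def)
  ultimately obtain P where P: "P \<in> \<I>" "\<And>J. J \<in> \<I> \<Longrightarrow> P \<subseteq> J \<Longrightarrow> P = J"
    using finite_has_maximal2[of \<I> I] by auto
  have "maximalideal P ring_of_integers"
  proof (rule maximalidealI)
    show "ideal P ring_of_integers" using P by (simp add: \<I>_def)
    show "carrier ring_of_integers \<noteq> P" using P(1) by (auto simp: \<I>_def)
    fix J assume J: "ideal J ring_of_integers" "P \<subseteq> J" "J \<subseteq> carrier ring_of_integers"
    show "J = P \<or> J = carrier ring_of_integers"
    proof (cases "1 \<in> J")
      case True
      then have "ints \<subseteq> J" using ideal_integersD(4)[OF J(1), of 1] by auto
      then show ?thesis using J(3) by auto
    next
      case False
      then show ?thesis using P(2)[of J] J P(1) by (auto simp: \<I>_def)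
    qed
  qed
  then show ?thesis using P(1) by (auto simp: maximal_ideals_def \<I>_def)
qed

text \<open>\<open>J\<close> consists of multiples of its least positive element, which therefore
  divides the greatest common divisor of any subset, even an infinite one; this puts the divisor
  back into \<open>J\<close>.\<close>

lemma int_ideal_Gcd:
  fixes J :: "int set"
  assumes sub: "\<And>a b. a \<in> J \<Longrightarrow> b \<in> J \<Longrightarrow> a - b \<in> J" and mult: "\<And>a n. a \<in> J \<Longrightarrow> n * a \<in> J"
    and TJ: "T \<subseteq> J" and T: "t \<in> T" "t \<noteq> 0"
  shows "Gcd T \<in> J"
proof -
  define d where "d = (LEAST n. n > 0 \<and> int n \<in> J)"
  have "\<bar>t\<bar> \<in> J" using mult[of t "sgn t"] TJ T by (auto simp: abs_sgn mult.commute)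
  then have "nat \<bar>t\<bar> > 0 \<and> int (nat \<bar>t\<bar>) \<in> J" using T by auto
  then have d: "d > 0" "int d \<in> J" unfolding d_def by (metis (mono_tags, lifting) LeastI)+
  have "int d dvd a" if "a \<in> J" for a
  proof (rule ccontr)
    assume nd: "\<not> int d dvd a"
    have "a mod int d = a - (a div int d) * int d" by (simp add: minus_div_mult_eq_mod)
    then have "a mod int d \<in> J" using sub mult that d by metis
    moreover have "a mod int d > 0" using nd d
      by (metis dvd_eq_mod_eq_0 of_nat_0_less_iff order_le_less pos_mod_sign)
    moreover have "a mod int d < int d" using d by simp
    ultimately have "nat (a mod int d) > 0 \<and> int (nat (a mod int d)) \<in> J" "nat (a mod int d) < d" by auto
    then show False unfolding d_def using not_less_Least by blast
  qed
  then have "int d dvd Gcd T" using TJ by (auto intro: Gcd_greatest)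
  then show ?thesis using mult[OF d(2)] by (metis dvd_def mult.commute)
qed

text \<open>
  The product of \<open>P\<close> with its conjugate is generated by the greatest common divisor \<open>g\<close> of the
  traces and norms of its elements, because \<open>a * cj b / g\<close> is integral for all \<open>a\<close>, \<open>b\<close> in \<open>P\<close>.
\<close>
lemma uniformizer_exists:
  assumes P: "P \<in> maximal_ideals"
  shows "\<exists>\<pi>\<in>P. \<pi> \<noteq> (0::'k) \<and> (\<exists>s. algebraic_int s \<and> s \<notin> P \<and> (\<forall>a\<in>P. \<exists>c. algebraic_int c \<and> s * a = \<pi> * c))"
proof -
  note I = ideal_integersD[OF maximal_idealD(1)[OF P]]
  \<comment> \<open>The first alternative is the trace of \<open>a * cj b\<close>, the second the
    norm of \<open>a\<close>. Norms are included so that \<open>g\<close> also controls the norm of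
    a quotient by \<open>g\<close>, and they make \<open>g\<close> nonzero.\<close>
  define T where "T = {t :: int. \<exists>a\<in>P. \<exists>b\<in>P. of_int t = a * cj b + b * cj a \<or> of_int t = a * cj a}"
  have T_tr: "\<exists>t\<in>T. tr (a * cj b) = of_int t" and T_nm: "\<exists>t\<in>T. nm a = of_int t"
    if ab: "a \<in> P" "b \<in> P" for a b
  proof -
    have "algebraic_int a" "algebraic_int b" using ab I(1) by auto
    then have "tr (a * cj b) \<in> \<int>" "nm a \<in> \<int>"
      using algebraic_int_closed(2,4) algebraic_int_iff by blast+
    then obtain t u where "tr (a * cj b) = of_int t" "nm a = of_int u"
      by (metis Ints_cases)
    moreover have "a * cj b + b * cj a = of_rat (tr (a * cj b))" "a * cj a = of_rat (nm a)"
      using add_cj[of "a * cj b"] mult_cj[of a] by (simp_all add: mult.commute)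
    ultimately have "of_int t = a * cj b + b * cj a" "of_int u = a * cj a" by simp_all
    then have "t \<in> T" "u \<in> T" using ab unfolding T_def by auto
    then show "\<exists>t\<in>T. tr (a * cj b) = of_int t" "\<exists>t\<in>T. nm a = of_int t"
      using \<open>tr (a * cj b) = of_int t\<close> \<open>nm a = of_int u\<close> by blast+
  qed
  obtain x where x: "x \<in> P" "x \<noteq> 0" using maximal_ideal_nonzero[OF P] by blast
  obtain n0 where n0: "n0 \<in> T" "nm x = of_int n0" using T_nm[OF x(1) x(1)] by blast
  then have "n0 \<noteq> 0" using x nm_eq_0_iff by fastforce
  define g where "g = Gcd T"
  have g0: "g \<noteq> 0" using n0 \<open>n0 \<noteq> 0\<close> by (auto simp: g_def)
  have gd: "g dvd t" if "t \<in> T" for t using that by (simp add: g_def)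
  \<comment> \<open>The trace of \<open>a * cj b\<close> is divisible by \<open>g\<close>, and its
    norm is the product of two norms, each divisible by \<open>g\<close>; so the quotient has
    integral trace and norm.\<close>
  have int: "algebraic_int (a * cj b / of_int g)" if ab: "a \<in> P" "b \<in> P" for a b
  proof -
    let ?z = "a * cj b / of_int g"
    obtain t n m where t: "t \<in> T" "tr (a * cj b) = of_int t" "n \<in> T" "nm a = of_int n" "m \<in> T" "nm b = of_int m"
      using T_tr T_nm ab by metis
    obtain t' n' m' where g: "t = g * t'" "n = g * n'" "m = g * m'" using gd t by (meson dvdE)
    have "?z = of_rat (1 / of_int g) * (a * cj b)" by (simp add: of_rat_divide)
    then have "tr ?z = tr (a * cj b) / of_int g" "nm ?z = nm a * nm b / (of_int g)\<^sup>2"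
      by (simp_all add: tr_def nm_mult) (simp add: nm_def power_divide)
    then have "tr ?z = of_int t'" "nm ?z = of_int (n' * m')"
      using g0 by (simp_all add: t g power2_eq_square)
    then show ?thesis unfolding algebraic_int_iff by auto
  qed
  \<comment> \<open>If all \<open>a * cj b / g\<close> were in P, then every member of
    \<open>T\<close> divided by \<open>g\<close> would be in P, and so would
    \<open>g / g = 1\<close> by the property of greatest common divisors.\<close>
  define J where "J = {n. of_int n / of_int g \<in> P}"
  have "\<exists>a\<in>P. \<exists>b\<in>P. a * cj b / of_int g \<notin> P"
  proof (rule ccontr)
    assume "\<not> ?thesis"
    then have all: "a * cj b / of_int g \<in> P" if "a \<in> P" "b \<in> P" for a b using that by blast
    have "Gcd T \<in> J"
    proof (rule int_ideal_Gcd)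
      show "T \<subseteq> J"
      proof
        fix t assume "t \<in> T"
        then obtain a b where ab: "a \<in> P" "b \<in> P" "of_int t = a * cj b + b * cj a \<or> of_int t = a * cj a"
          by (auto simp: T_def)
        then have "of_int t / of_int g = a * cj b / of_int g + b * cj a / of_int g \<or>
           of_int t / of_int g = a * cj a / of_int g" by (auto simp: add_divide_distrib)
        then show "t \<in> J" unfolding J_def mem_Collect_eq using all ab I(3) by metis
      qed
      show "n0 \<in> T" "n0 \<noteq> 0" by fact+
      fix a b n assume "a \<in> J"
      then show "n * a \<in> J" using I(4)[of "of_int a / of_int g" "of_int n"] algebraic_int_closed(5)
        by (simp add: J_def)
      assume "b \<in> J"
      then show "a - b \<in> J" using I(5) \<open>a \<in> J\<close> by (simp add: J_def diff_divide_distrib)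
    qed
    then have "1 \<in> P" using g0 by (simp add: J_def flip: g_def)
    then show False using maximal_idealD(2)[OF P] by blast
  qed
  then obtain a b where ab: "a \<in> P" "b \<in> P" "a * cj b / of_int g \<notin> P" by blast
  show ?thesis
  \<comment> \<open>The uniformizer is \<open>a\<close>, with cofactor s = a * cj b / g outside P.
    For \<open>c\<close> in P one has s * c = a * (c * cj b / g), and the bracket is integral; so
    \<open>a\<close> generates P once s is inverted.\<close>
  proof (intro bexI[of _ a] conjI exI[of _ "a * cj b / of_int g"])
    show "a \<noteq> 0" using ab I(2) by auto
    show "\<forall>c\<in>P. \<exists>d. algebraic_int d \<and> a * cj b / of_int g * c = a * d"
    proof
      fix c assume "c \<in> P"
      then show "\<exists>d. algebraic_int d \<and> a * cj b / of_int g * c = a * d"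
        using int[of c b] ab by (intro exI[of _ "c * cj b / of_int g"]) simp
    qed
  qed (use ab int in auto)
qed

section \<open>The localization at a maximal ideal and its uniformizer\<close>

definition localization :: "'k set \<Rightarrow> 'k set" where
  "localization P = {a / s | a s. algebraic_int a \<and> algebraic_int s \<and> s \<notin> P}"

abbreviation ipow :: "'k set \<Rightarrow> nat \<Rightarrow> 'k set" where
  "ipow P n \<equiv> P [^]\<^bsub>ideals_set ring_of_integers\<^esub> n"

lemma one_ideals_set [simp]: "\<one>\<^bsub>ideals_set ring_of_integers\<^esub> = ints"
  by (simp add: ideals_set_def)

lemma ipow:
  assumes P: "ideal P (ring_of_integers :: 'k ring)"
  shows ipow_0: "ipow P 0 = ints" and ipow_Suc: "ipow P (Suc n) = ideal_prod ring_of_integers (ipow P n) P"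
    and ipow_ideal: "ideal (ipow P n) ring_of_integers"
    and ipow_power: "x \<in> P \<Longrightarrow> x ^ n \<in> ipow P n"
proof -
  interpret cring "ring_of_integers :: 'k ring" by (rule cring_integers)
  show 0: "ipow P 0 = ints" by (simp add: nat_pow_def ideals_set_def)
  show S: "ipow P (Suc n) = ideal_prod ring_of_integers (ipow P n) P" for n
    by (simp add: nat_pow_def ideals_set_def)
  show id: "ideal (ipow P n) ring_of_integers"
    by (induction n) (simp_all only: S 0, use oneideal in simp, use ideal_prod_is_ideal P in blast)
  show "x ^ n \<in> ipow P n" if "x \<in> P"
  proof (induction n)
    case (Suc n)
    then show ?case unfolding S using ideal_prod.prod[of "x ^ n" "ipow P n" x P ring_of_integers] that
      by (simp add: mult.commute)
  qed simp
qed

lemma localized_power_eq: "localized_power P n = {a / s | a s. a \<in> ipow P n \<and> algebraic_int s \<and> s \<notin> (P :: 'k set)}"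
  by (auto simp: localized_power_def)

text \<open>The element supplied by \<open>uniformizer_exists\<close> generates P after localization
  because its cofactor \<open>s\<close> becomes a unit. Each nonzero integer divides some power of
  it locally, and the least such power gives the factorization into a power of \<pi> and a
  unit.\<close>

lemma local_dvr_localization:
  assumes P: "P \<in> maximal_ideals"
  obtains \<pi> where "\<pi> \<in> P" "local_dvr P (localization P) \<pi>"
proof -
  note I = ideal_integersD[OF maximal_idealD(1)[OF P]]
  note prime = maximal_idealD(4)[OF P]
  note ip = ipow[OF maximal_idealD(1)[OF P]]
  obtain \<pi> s where \<pi>: "\<pi> \<in> P" "\<pi> \<noteq> 0" and s: "algebraic_int s" "s \<notin> P"
    and gen: "\<And>a. a \<in> P \<Longrightarrow> \<exists>c. algebraic_int c \<and> s * a = \<pi> * c"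
    using uniformizer_exists[OF P] by blast
  let ?R = "localization P"
  have nz: "t \<noteq> 0" if "t \<notin> P" for t using that I(2) by auto
  have locI: "a / t \<in> ?R" if "algebraic_int a" "algebraic_int t" "t \<notin> P" for a t
    using that by (auto simp: localization_def)
  have locE: "\<exists>a t. x = a / t \<and> algebraic_int a \<and> algebraic_int t \<and> t \<notin> P" if "x \<in> ?R" for x
    using that by (auto simp: localization_def)
  have intR: "x \<in> ?R" if "algebraic_int x" for x
    using locI[of x 1] that maximal_idealD(2)[OF P] by simp
  have mult: "x * y \<in> ?R" and diff: "x - y \<in> ?R" if xy: "x \<in> ?R" "y \<in> ?R" for x y
  proof -
    obtain a t b u where x: "x = a / t" "algebraic_int a" "algebraic_int t" "t \<notin> P"
      and y: "y = b / u" "algebraic_int b" "algebraic_int u" "u \<notin> P" using locE[OF xy(1)] locE[OF xy(2)] by blast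
    have "x * y = (a * b) / (t * u)" "x - y = (a * u - b * t) / (t * u)"
      using x y nz[of t] nz[of u] by (simp_all add: field_simps)
    moreover have "algebraic_int (t * u)" "t * u \<notin> P" "algebraic_int (a * b)" "algebraic_int (a * u - b * t)"
      by (simp_all add: prime x(2-) y(2-) algebraic_int_closed)
    ultimately show "x * y \<in> ?R" "x - y \<in> ?R" using locI by metis+
  qed
  have pow: "x ^ n \<in> ?R" if "x \<in> ?R" for x n
    by (induction n) (use intR mult that in auto)
  have \<pi>alg: "algebraic_int \<pi>" using \<pi> I(1) by blast
  have \<pi>inv: "inverse \<pi> \<notin> ?R"
  proof
    assume "inverse \<pi> \<in> ?R"
    then obtain a t where at: "inverse \<pi> = a / t" "algebraic_int a" "algebraic_int t" "t \<notin> P" using locE by blast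
    then have "t = a * \<pi>" using \<pi>(2) nz[of t] by (simp add: field_simps)
    then show False using I(4)[OF \<pi>(1) at(2)] at(4) by simp
  qed
  \<comment> \<open>The relation s * a = \<pi> * c with \<open>s\<close> outside P turns a / \<pi>
    into the legitimate fraction c / s.\<close>
  have PR: "inverse \<pi> * a \<in> ?R" if a: "a \<in> P" for a
  proof -
    obtain c where c: "algebraic_int c" "s * a = \<pi> * c" using gen[OF a] by blast
    then have "inverse \<pi> * a = c / s" using \<pi> nz[OF s(2)] by (simp add: field_simps)
    then show ?thesis using locI[of c s] c s by simp
  qed
  have ipR: "inverse (\<pi> ^ n) * a \<in> ?R" if "a \<in> ipow P n" for a n
    using that
  proof (induction n arbitrary: a)
    case 0 then show ?case using intR by (simp add: ip(1))
  next
    case (Suc n)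
    from Suc.prems show ?case unfolding ip(2)
    proof (induction rule: ideal_prod.induct)
      case (prod i j)
      have "inverse (\<pi> ^ Suc n) * (i \<otimes>\<^bsub>ring_of_integers\<^esub> j) = (inverse (\<pi> ^ n) * i) * (inverse \<pi> * j)" by simp
      then show ?case using mult[OF Suc.IH[OF prod(1)] PR[OF prod(2)]] by presburger
    next
      case (sum x y)
      have "inverse (\<pi> ^ Suc n) * (x \<oplus>\<^bsub>ring_of_integers\<^esub> y) =
          inverse (\<pi> ^ Suc n) * x - (0 - inverse (\<pi> ^ Suc n) * y)" by (simp add: algebra_simps)
      then show ?case using diff[OF sum(3) diff[OF intR[OF algebraic_int_0] sum(4)]] by metis
    qed
  qed
  have localized: "localized_power P n = (\<lambda>r. \<pi> ^ n * r) ` ?R" for n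
  proof
    show "localized_power P n \<subseteq> (\<lambda>r. \<pi> ^ n * r) ` ?R"
    proof
      fix x assume "x \<in> localized_power P n"
      then obtain a t where x: "x = a / t" "a \<in> ipow P n" "algebraic_int t" "t \<notin> P"
        by (auto simp: localized_power_eq)
      have "(inverse (\<pi> ^ n) * a) * (1 / t) \<in> ?R" using mult[OF ipR[OF x(2)] locI[of 1 t]] x by simp
      then show "x \<in> (\<lambda>r. \<pi> ^ n * r) ` ?R"
        by (rule image_eqI[rotated]) (use \<pi> x in simp)
    qed
    show "(\<lambda>r. \<pi> ^ n * r) ` ?R \<subseteq> localized_power P n"
    proof clarify
      fix r assume "r \<in> ?R"
      then obtain a t where at: "r = a / t" "algebraic_int a" "algebraic_int t" "t \<notin> P" using locE by blast
      have "a * \<pi> ^ n \<in> ipow P n" using ideal_integersD(4)[OF ip(3)] ip(4)[OF \<pi>(1)] at by blast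
      then show "\<pi> ^ n * r \<in> localized_power P n" unfolding localized_power_eq
        using at by (auto simp: mult.commute)
    qed
  qed
  have unit_of_P: "inverse (1 - p) \<in> ?R" if "p \<in> P" for p
  proof -
    have "1 - p \<notin> P" using I(3)[of "1 - p" p] that maximal_idealD(2)[OF P] by auto
    then show ?thesis using locI[of 1 "1 - p"] that I(1) algebraic_int_closed(3)[of 1 p] by (auto simp: inverse_eq_divide)
  qed
  \<comment> \<open>Pigeonhole: two powers \<pi>^m and \<pi>^n with m < n agree modulo the norm of
    \<open>x\<close>, so \<pi>^m (1 - \<pi>^(n-m)) is a multiple of \<open>x\<close>. The bracket is
    1 minus an element of P, hence a unit of the localization.\<close>
  have pow_dvd: "\<exists>n. \<pi> ^ n * inverse x \<in> ?R" if x: "x \<noteq> 0" "algebraic_int x" for x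
  proof -
    obtain N where N: "nm x = of_int N" using x(2) unfolding algebraic_int_iff by (elim conjE Ints_cases) blast
    then have "N \<noteq> 0" using x nm_eq_0_iff by fastforce
    then obtain f :: "'k \<Rightarrow> int \<times> int" where f: "finite (f ` ints)"
      "\<And>x y. algebraic_int x \<Longrightarrow> algebraic_int y \<Longrightarrow> f x = f y \<Longrightarrow> \<exists>z. algebraic_int z \<and> x - y = of_int N * z"
      using finite_residues by blast
    have "\<not> inj (\<lambda>n::nat. f (\<pi> ^ n))"
    proof
      assume "inj (\<lambda>n::nat. f (\<pi> ^ n))"
      moreover have "range (\<lambda>n::nat. f (\<pi> ^ n)) \<subseteq> f ` ints" using algebraic_int_power \<pi>alg by auto
      ultimately show False using f(1) by (meson finite_imageD finite_subset infinite_UNIV_nat)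
    qed
    then obtain m n where "m \<noteq> n" "f (\<pi> ^ m) = f (\<pi> ^ n)" by (auto simp: inj_def)
    then obtain m n :: nat where mn: "m < n" "f (\<pi> ^ m) = f (\<pi> ^ n)" by (metis nat_neq_iff)
    then obtain z where z: "algebraic_int z" "\<pi> ^ m - \<pi> ^ n = of_int N * z"
      using f(2) algebraic_int_power \<pi>alg by blast
    have "\<pi> ^ (n - m) \<in> P"
    proof -
      have "\<pi> ^ (n - m) = \<pi> ^ (n - m - 1) * \<pi>" using mn by (metis power_minus_mult zero_less_diff)
      then show ?thesis using I(4)[OF \<pi>(1)] algebraic_int_power \<pi>alg by metis
    qed
    then have u: "inverse (1 - \<pi> ^ (n - m)) \<in> ?R" by (rule unit_of_P)
    have nz1: "1 - \<pi> ^ (n - m) \<noteq> 0" using \<open>\<pi> ^ (n - m) \<in> P\<close> maximal_idealD(2)[OF P] by auto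
    have "\<pi> ^ m * (1 - \<pi> ^ (n - m)) = \<pi> ^ m - \<pi> ^ n"
      using mn by (simp add: right_diff_distrib flip: power_add)
    also have "\<dots> = x * (cj x * z)"
      unfolding z(2) using N mult_cj[of x] by (simp only: of_rat_of_int_eq mult.assoc[symmetric])
    finally have "\<pi> ^ m * (1 - \<pi> ^ (n - m)) = x * (cj x * z)" .
    moreover have "a * inverse x = q * inverse w" if "a * w = x * q" "w \<noteq> 0" for a q w
      using that x(1) by (simp add: field_simps)
    ultimately have "\<pi> ^ m * inverse x = (cj x * z) * inverse (1 - \<pi> ^ (n - m))"
      using nz1 by blast
    also have "\<dots> \<in> ?R" using mult[OF intR u, of "cj x * z"] algebraic_int_closed(2)[OF algebraic_int_closed(4)[OF x(2)] z(1)]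
      by simp
    finally show ?thesis by blast
  qed
  have unitR: "inverse y \<in> ?R" if y: "y \<in> ?R" "y \<notin> localized_power P 1" for y
  proof -
    obtain a t where at: "y = a / t" "algebraic_int a" "algebraic_int t" "t \<notin> P" using locE[OF y(1)] by blast
    have "a \<notin> P"
    proof
      assume "a \<in> P"
      then have "\<pi> ^ 1 * ((inverse \<pi> * a) * (1 / t)) \<in> localized_power P 1"
        unfolding localized power_one_right using mult[OF PR locI[of 1 t]] at by blast
      moreover have "\<pi> ^ 1 * ((inverse \<pi> * a) * (1 / t)) = y" unfolding at(1) using \<pi>(2) by simp
      ultimately show False using y(2) by metis
    qed
    then show ?thesis using locI[of t a] at by simp
  qed
  have factor: "\<exists>n u. u \<in> ?R \<and> inverse u \<in> ?R \<and> x = \<pi> ^ n * u" if x: "x \<noteq> 0" "algebraic_int x" for x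
  proof -
    obtain n where n: "\<pi> ^ n * inverse x \<in> ?R" using pow_dvd[OF x] by blast
    \<comment> \<open>The least exponent for which \<open>x\<close> divides \<pi>^k. By minimality
      the quotient is not divisible by \<pi>, so it is a unit.\<close>
    define k where "k = (LEAST k. \<pi> ^ k * inverse x \<in> ?R)"
    have k: "\<pi> ^ k * inverse x \<in> ?R" unfolding k_def using n by (rule LeastI)
    have "x * inverse (\<pi> ^ k) \<in> ?R"
    proof (cases k)
      case 0 then show ?thesis using x intR by simp
    next
      case (Suc j)
      have "\<pi> ^ k * inverse x \<notin> localized_power P 1"
      proof
        assume "\<pi> ^ k * inverse x \<in> localized_power P 1"
        then have "\<pi> ^ j * inverse x \<in> ?R" using \<pi> Suc by (auto simp: localized)
        then have "k \<le> j" unfolding k_def by (rule Least_le)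
        then show False using Suc by simp
      qed
      from unitR[OF k this] show ?thesis by (simp add: mult.commute)
    qed
    moreover have "inverse (x * inverse (\<pi> ^ k)) = \<pi> ^ k * inverse x" "x = \<pi> ^ k * (x * inverse (\<pi> ^ k))"
      using \<pi>(2) by (simp_all add: mult.commute)
    ultimately show ?thesis using k by metis
  qed
  have "local_dvr P ?R \<pi>"
  proof
    fix x :: 'k assume "x \<noteq> 0"
    \<comment> \<open>A general \<open>x\<close> is a quotient of the two integers N x and N. Their
      factorizations are divided, and the difference of the exponents decides which of the two forms
      results.\<close>
    obtain N where N: "N > 0" "of_int N * x \<in> zlattice" using zlattice_scale by blast
    then have 1: "algebraic_int (of_int N * x)" using zlattice_imp_algebraic_int by blast
    have "of_int N \<noteq> (0::'k)" "of_int N * x \<noteq> 0" using N \<open>x \<noteq> 0\<close> by auto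
    then obtain n u m v where u: "u \<in> ?R" "inverse u \<in> ?R" "of_int N * x = \<pi> ^ n * u"
      and v: "v \<in> ?R" "inverse v \<in> ?R" "of_int N = \<pi> ^ m * v"
      using factor 1 algebraic_int_closed(5) by metis
    have v0: "v \<noteq> 0" using v \<open>of_int N \<noteq> (0::'k)\<close> by auto
    have x: "x * \<pi> ^ m = \<pi> ^ n * (u * inverse v)" using u(3) v(3) v0 by (simp add: field_simps)
    have uv: "u * inverse v \<in> ?R" "inverse (u * inverse v) \<in> ?R" using u v mult by auto
    show "\<exists>n u. u \<in> ?R \<and> inverse u \<in> ?R \<and> (x = \<pi> ^ n * u \<or> x = inverse (\<pi> ^ n) * u)"
    proof (cases "m \<le> n")
      case True
      then have "\<pi> ^ n = \<pi> ^ (n - m) * \<pi> ^ m" by (simp flip: power_add)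
      then have "x * \<pi> ^ m = (\<pi> ^ (n - m) * (u * inverse v)) * \<pi> ^ m" unfolding x by (simp only: mult_ac)
      then have "x = \<pi> ^ (n - m) * (u * inverse v)" using \<pi>(2) by simp
      then show ?thesis using uv by blast
    next
      case False
      then have "\<pi> ^ m = \<pi> ^ (m - n) * \<pi> ^ n" by (simp flip: power_add)
      then have "(x * \<pi> ^ (m - n)) * \<pi> ^ n = (u * inverse v) * \<pi> ^ n" using x by (simp only: mult_ac)
      then have "x * \<pi> ^ (m - n) = u * inverse v" using \<pi>(2) by simp
      then have "x = inverse (\<pi> ^ (m - n)) * (u * inverse v)" using \<pi>(2)
        by (metis mult.commute mult.left_commute mult_1_left left_inverse power_not_zero)
      then show ?thesis using uv by blast
    qed
  next
    fix x n assume "x \<in> ?R"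
    then obtain a t where at: "x = a / t" "algebraic_int a" "algebraic_int t" "t \<notin> P" using locE by blast
    obtain u where u: "algebraic_int u" "1 - t * u \<in> P" using maximal_idealD(3)[OF P] at by blast
    define p where "p = 1 - t * u"
    have p: "p \<in> P" "algebraic_int p" using u p_def I(1) by auto
    \<comment> \<open>Approximate inversion of the denominator \<open>t\<close> by a geometric
      series: starting from an inverse \<open>u\<close> modulo P, the correction w + u p^n improves
      the error from p^n to p^(n+1). The numerator times \<open>w\<close> is then the integral
      approximation of a / t.\<close>
    have "\<exists>w. algebraic_int w \<and> 1 - t * w = p ^ n" for n
    proof (induction n)
      case 0 show ?case by (intro exI[of _ 0]) simp
    next
      case (Suc n)
      then obtain w where w: "algebraic_int w" "1 - t * w = p ^ n" by blast
      have "p ^ Suc n = 1 - t * (w + u * p ^ n)"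
        unfolding power_Suc w(2)[symmetric] by (simp add: p_def algebra_simps)
      then show ?case using w u p algebraic_int_closed algebraic_int_power by (intro exI[of _ "w + u * p ^ n"]) auto
    qed
    then obtain w where w: "algebraic_int w" "1 - t * w = p ^ n" by blast
    have "x - a * w = a * (1 - t * w) / t" using at nz[of t] by (simp add: field_simps)
    also have "\<dots> = (a * p ^ n) / t" by (simp add: w)
    also have "\<dots> \<in> localized_power P n"
      unfolding localized_power_eq using at ideal_integersD(4)[OF ip(3)] ip(4)[OF p(1)] by blast
    finally show "\<exists>a. algebraic_int a \<and> x - a \<in> localized_power P n"
      using at w algebraic_int_closed(2) by blast
  qed (use localized mult diff intR \<pi> \<pi>alg \<pi>inv in auto)
  with \<pi>(1) show ?thesis by (rule that)
qed

lemma finite_maximal_ideals_containing: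
  "x \<noteq> 0 \<Longrightarrow> algebraic_int (x::'k) \<Longrightarrow> finite {P \<in> maximal_ideals. x \<in> P}"
  by (rule finite_subset[OF _ finite_ideals_containing]) (use maximal_idealD(1) in auto)

text \<open>Only maximal ideals that contain a fixed denominator of \<open>x\<close> can matter, and
  a nonzero integer lies in finitely many of them.\<close>

lemma localization_almost_all:
  assumes "x \<noteq> 0" shows "finite {P \<in> maximal_ideals. x \<notin> localization P}"
proof -
  obtain N where N: "N > 0" "of_int N * x \<in> zlattice" using zlattice_scale by blast
  have "of_int N \<noteq> (0::'k)" using N by simp
  have "{P \<in> maximal_ideals. x \<notin> localization P} \<subseteq> {P \<in> maximal_ideals. of_int N \<in> P}"
  proof clarify
    fix P :: "'k set" assume "x \<notin> localization P" "P \<in> maximal_ideals"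
    moreover have "x = (of_int N * x) / of_int N" using \<open>of_int N \<noteq> (0::'k)\<close> by simp
    ultimately show "of_int N \<in> P" unfolding localization_def
      using N zlattice_imp_algebraic_int algebraic_int_closed(5) by blast
  qed
  then show ?thesis
    using finite_maximal_ideals_containing[OF \<open>of_int N \<noteq> (0::'k)\<close> algebraic_int_closed(5)] finite_subset by blast
qed

text \<open>The denominators of \<open>x\<close> form a nonzero ideal. Were it proper, it would lie
  in a maximal ideal P, while local integrality at P supplies a denominator outside P.\<close>

lemma integral_if_locally_integral:
  assumes "\<And>P. P \<in> maximal_ideals \<Longrightarrow> x \<in> localization P" shows "algebraic_int (x::'k)"
proof (rule ccontr)
  assume nx: "\<not> algebraic_int x"
  define I where "I = {s. algebraic_int s \<and> algebraic_int (s * x)}"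
  have "ideal I ring_of_integers"
    by (rule ideal_integersI) (auto simp: I_def distrib_right mult.assoc intro: algebraic_int_closed)
  moreover obtain N where N: "N > 0" "of_int N * x \<in> zlattice" using zlattice_scale by blast
  then have "of_int N \<in> I" "of_int N \<noteq> (0::'k)"
    using zlattice_imp_algebraic_int algebraic_int_closed(5) by (auto simp: I_def)
  moreover have "1 \<notin> I" using nx by (simp add: I_def)
  ultimately obtain P where P: "P \<in> maximal_ideals" "I \<subseteq> P" using ideal_in_maximal_ideal by blast
  then obtain a s where "x = a / s" "algebraic_int a" "algebraic_int s" "s \<notin> P"
    using assms[OF P(1)] by (auto simp: localization_def)
  moreover from this have "s \<noteq> 0" using ideal_integersD(2)[OF maximal_idealD(1)[OF P(1)]] by auto
  ultimately have "s \<in> I" by (simp add: I_def)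
  then show False using P \<open>s \<notin> P\<close> by blast
qed

end

section \<open>The local fields\<close>

context ring begin

lemma minus_add_cancel: "x \<in> carrier R \<Longrightarrow> y \<in> carrier R \<Longrightarrow> (x \<ominus> y) \<oplus> y = x"
  by (simp add: a_minus_def a_assoc l_neg)

lemma minus_telescope:
  "x \<in> carrier R \<Longrightarrow> y \<in> carrier R \<Longrightarrow> z \<in> carrier R \<Longrightarrow> (x \<ominus> y) \<oplus> (y \<ominus> z) = x \<ominus> z"
  by (simp add: a_minus_def a_assoc r_neg1)

lemma minus_distr:
  assumes "x \<in> carrier R" "y \<in> carrier R" "z \<in> carrier R"
  shows "z \<otimes> (x \<ominus> y) = z \<otimes> x \<ominus> z \<otimes> y" "(x \<ominus> y) \<otimes> z = x \<otimes> z \<ominus> y \<otimes> z"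
  using assms by (simp_all add: a_minus_def l_distr r_distr l_minus r_minus)

end

section \<open>Cauchy sequences modulo null sequences\<close>

context local_dvr begin

abbreviation C where "C \<equiv> cauchy_sequences P"
abbreviation N where "N \<equiv> null_sequences P"
abbreviation K where "K \<equiv> local_field P"
abbreviation cls where "cls s \<equiv> N +>\<^bsub>C\<^esub> s"

lemma C_simps [simp]:
  "s \<otimes>\<^bsub>C\<^esub> t = (\<lambda>i. s i * t i)" "s \<oplus>\<^bsub>C\<^esub> t = (\<lambda>i. s i + t i)"
  "\<one>\<^bsub>C\<^esub> = (\<lambda>i. 1)" "\<zero>\<^bsub>C\<^esub> = (\<lambda>i. 0)"
  by (simp_all add: cauchy_sequences_def)

lemma C_iff: "s \<in> carrier C \<longleftrightarrow> (\<forall>n. \<exists>M. \<forall>i\<ge>M. \<forall>j\<ge>M. s i - s j \<in> L n)"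
  by (simp add: cauchy_sequences_def)

lemma N_iff: "s \<in> N \<longleftrightarrow> (\<forall>n. \<forall>\<^sub>F i in sequentially. s i \<in> L n)"
  by (simp add: null_sequences_def)

text \<open>Ultrametric criterion: comparing all late terms with a single one suffices, because the
  sets \<open>L n\<close> are closed under differences.\<close>

lemma C_I:
  assumes "\<And>n. \<exists>M0. \<forall>i\<ge>M0. s i - s M0 \<in> L n" shows "s \<in> carrier C"
  unfolding C_iff
proof
  fix n
  obtain M where M: "\<And>i. i \<ge> M \<Longrightarrow> s i - s M \<in> L n" using assms by blast
  have "s i - s j \<in> L n" if "i \<ge> M" "j \<ge> M" for i j
    using L_diff[OF M[OF that(1)] M[OF that(2)]] by simp
  then show "\<exists>M. \<forall>i\<ge>M. \<forall>j\<ge>M. s i - s j \<in> L n" by blast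
qed

lemma C_D: "s \<in> carrier C \<Longrightarrow> \<exists>M. \<forall>i\<ge>M. s i - s M \<in> L n"
  unfolding C_iff by blast

lemma C_const [simp]: "(\<lambda>i. x) \<in> carrier C" by (simp add: C_iff)

text \<open>The boundedness of a Cauchy sequence, in the form needed for products: late terms differ
  from one fixed term by elements of \<open>L 0\<close>, so one \<open>m\<close> works for all of
  them.\<close>

lemma C_mult_L:
  assumes "s \<in> carrier C" shows "\<exists>m. \<forall>\<^sub>F i in sequentially. \<forall>y\<in>L m. s i * y \<in> L n"
proof -
  obtain M where M: "\<forall>i\<ge>M. s i - s M \<in> L 0" using C_D[OF assms] by blast
  obtain m where m: "\<forall>y\<in>L m. s M * y \<in> L n" using mult_in_L by blast
  have "s i * y \<in> L n" if "i \<ge> M" "y \<in> L (max m n)" for i y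
  proof -
    have y: "y \<in> L m" "y \<in> L n" using that(2) L_antimono[of m "max m n"] L_antimono[of n "max m n"] by auto
    have "(s i - s M) * y \<in> L n" using L_mult[of "s i - s M" 0 y n] M that(1) y by simp
    then have "s M * y + (s i - s M) * y \<in> L n" using m y L_add by blast
    then show ?thesis by (simp add: algebra_simps)
  qed
  then show ?thesis unfolding eventually_sequentially by blast
qed

lemma C_add: "s \<in> carrier C \<Longrightarrow> t \<in> carrier C \<Longrightarrow> (\<lambda>i. s i + t i) \<in> carrier C"
  unfolding C_iff
proof
  fix n
  assume "\<forall>n. \<exists>M. \<forall>i\<ge>M. \<forall>j\<ge>M. s i - s j \<in> L n" "\<forall>n. \<exists>M. \<forall>i\<ge>M. \<forall>j\<ge>M. t i - t j \<in> L n"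
  then obtain M M' where M: "\<And>i j. i \<ge> M \<Longrightarrow> j \<ge> M \<Longrightarrow> s i - s j \<in> L n" "\<And>i j. i \<ge> M' \<Longrightarrow> j \<ge> M' \<Longrightarrow> t i - t j \<in> L n"
    by meson
  have "(s i + t i) - (s j + t j) \<in> L n" if "i \<ge> max M M'" "j \<ge> max M M'" for i j
    using L_add[OF M(1)[of i j] M(2)[of i j]] that by (simp add: algebra_simps)
  then show "\<exists>M. \<forall>i\<ge>M. \<forall>j\<ge>M. (s i + t i) - (s j + t j) \<in> L n" by blast
qed

lemma C_minus: "s \<in> carrier C \<Longrightarrow> (\<lambda>i. - s i) \<in> carrier C"
  unfolding C_iff by (simp add: minus_diff_commute) (meson L_diff_commute)

lemma C_mult:
  assumes "s \<in> carrier C" "t \<in> carrier C" shows "(\<lambda>i. s i * t i) \<in> carrier C"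
  unfolding C_iff
proof
  fix n
  obtain m m' where "\<forall>\<^sub>F i in sequentially. \<forall>y\<in>L m. s i * y \<in> L n" "\<forall>\<^sub>F i in sequentially. \<forall>y\<in>L m'. t i * y \<in> L n"
    using C_mult_L assms by blast
  then obtain M M' where M: "\<And>i y. i \<ge> M \<Longrightarrow> y \<in> L m \<Longrightarrow> s i * y \<in> L n" "\<And>i y. i \<ge> M' \<Longrightarrow> y \<in> L m' \<Longrightarrow> t i * y \<in> L n"
    unfolding eventually_sequentially by meson
  obtain Q Q' where Q: "\<And>i j. i \<ge> Q \<Longrightarrow> j \<ge> Q \<Longrightarrow> s i - s j \<in> L m'" "\<And>i j. i \<ge> Q' \<Longrightarrow> j \<ge> Q' \<Longrightarrow> t i - t j \<in> L m"
    using assms unfolding C_iff by meson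
  have "s i * t i - s j * t j \<in> L n" if "i \<ge> max (max M M') (max Q Q')" "j \<ge> max (max M M') (max Q Q')" for i j
    using L_add[OF M(1)[of i "t i - t j"] M(2)[of j "s i - s j"]] Q that by (simp add: algebra_simps)
  then show "\<exists>M. \<forall>i\<ge>M. \<forall>j\<ge>M. s i * t i - s j * t j \<in> L n" by blast
qed

lemma N_diff: assumes "s \<in> N" "t \<in> N" shows "(\<lambda>i. s i - t i) \<in> N"
  unfolding N_iff
proof
  fix n
  have "\<forall>\<^sub>F i in sequentially. s i \<in> L n" "\<forall>\<^sub>F i in sequentially. t i \<in> L n"
    using assms N_iff by blast+
  then show "\<forall>\<^sub>F i in sequentially. s i - t i \<in> L n" by eventually_elim (rule L_diff)
qed

lemma N_mult:
  assumes "s \<in> carrier C" "t \<in> N" shows "(\<lambda>i. s i * t i) \<in> N"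
  unfolding N_iff
proof
  fix n
  obtain m where m: "\<forall>\<^sub>F i in sequentially. \<forall>y\<in>L m. s i * y \<in> L n" using C_mult_L assms by blast
  have "\<forall>\<^sub>F i in sequentially. t i \<in> L m" using assms N_iff by blast
  with m show "\<forall>\<^sub>F i in sequentially. s i * t i \<in> L n" by eventually_elim blast
qed

lemma N_0 [simp]: "(\<lambda>i. 0) \<in> N" by (simp add: N_iff)

lemma N_subset: "N \<subseteq> carrier C"
proof
  fix s assume "s \<in> N"
  then have "\<exists>M. \<forall>i\<ge>M. s i - s M \<in> L n" for n
    unfolding N_iff eventually_sequentially using L_diff by (meson order_refl)
  then show "s \<in> carrier C" by (rule C_I)
qed

lemma N_minus: "s \<in> N \<Longrightarrow> (\<lambda>i. - s i) \<in> N" using N_diff[OF N_0] by simp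
lemma N_add: "s \<in> N \<Longrightarrow> t \<in> N \<Longrightarrow> (\<lambda>i. s i + t i) \<in> N"
  using N_diff[OF _ N_minus] by simp

sublocale C: cring C
proof (rule cringI)
  show "abelian_group C"
  proof (rule abelian_groupI)
    fix s assume "s \<in> carrier C"
    then show "\<exists>t\<in>carrier C. t \<oplus>\<^bsub>C\<^esub> s = \<zero>\<^bsub>C\<^esub>"
      by (intro bexI[of _ "\<lambda>i. - s i"]) (auto intro: C_minus)
  qed (auto intro: C_add simp: algebra_simps)
  show "comm_monoid C"
    by (rule comm_monoidI) (auto intro: C_mult simp: algebra_simps)
qed (auto simp: algebra_simps)

lemma C_a_inv: "s \<in> carrier C \<Longrightarrow> \<ominus>\<^bsub>C\<^esub> s = (\<lambda>i. - s i)"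
  by (rule C.minus_equality) (auto intro: C_minus)

sublocale N: ideal N C
proof (rule idealI)
  show "subgroup N (add_monoid C)"
  proof (rule C.add.subgroupI)
    fix s assume "s \<in> N"
    then show "\<ominus>\<^bsub>C\<^esub> s \<in> N" using C_a_inv N_subset N_minus by auto
  qed (use N_subset N_add N_0 in \<open>auto simp del: N_0\<close>)
  show "ring C" by (rule C.ring_axioms)
  fix s t assume "s \<in> N" "t \<in> carrier C"
  then show "t \<otimes>\<^bsub>C\<^esub> s \<in> N" "s \<otimes>\<^bsub>C\<^esub> t \<in> N"
    using N_mult[of t s] by (simp_all add: mult.commute)
qed

lemma mem_cls: "t \<in> cls s \<longleftrightarrow> (\<lambda>i. t i - s i) \<in> N"
  unfolding a_r_coset_def' by (auto simp: fun_eq_iff intro!: bexI[of _ "\<lambda>i. t i - s i"])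

lemma carrier_K: "carrier K = (\<lambda>s. cls s) ` carrier C"
  by (auto simp: local_field_def FactRing_def A_RCOSETS_def')

lemma cls_carrier [simp]: "s \<in> carrier C \<Longrightarrow> cls s \<in> carrier K"
  by (simp add: carrier_K)

lemma cls_eq_iff: "cls s = cls t \<longleftrightarrow> (\<lambda>i. s i - t i) \<in> N"
proof
  assume "cls s = cls t"
  then show "(\<lambda>i. s i - t i) \<in> N" using mem_cls[of s s] mem_cls[of s t] by simp
next
  assume 1: "(\<lambda>i. s i - t i) \<in> N"
  have "u \<in> cls s \<longleftrightarrow> u \<in> cls t" for u
    using N_add[OF _ 1, of "\<lambda>i. u i - s i"] N_diff[OF _ 1, of "\<lambda>i. u i - t i"]
    by (auto simp: mem_cls)
  then show "cls s = cls t" by blast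
qed

lemma K_simps:
  "s \<in> carrier C \<Longrightarrow> t \<in> carrier C \<Longrightarrow> cls s \<otimes>\<^bsub>K\<^esub> cls t = cls (\<lambda>i. s i * t i)"
  "s \<in> carrier C \<Longrightarrow> t \<in> carrier C \<Longrightarrow> cls s \<oplus>\<^bsub>K\<^esub> cls t = cls (\<lambda>i. s i + t i)"
  "\<one>\<^bsub>K\<^esub> = cls (\<lambda>i. 1)" "\<zero>\<^bsub>K\<^esub> = cls (\<lambda>i. 0)"
proof -
  show "s \<in> carrier C \<Longrightarrow> t \<in> carrier C \<Longrightarrow> cls s \<otimes>\<^bsub>K\<^esub> cls t = cls (\<lambda>i. s i * t i)"
    using N.rcoset_mult_add[of s t] by (simp add: local_field_def FactRing_def)
  show "s \<in> carrier C \<Longrightarrow> t \<in> carrier C \<Longrightarrow> cls s \<oplus>\<^bsub>K\<^esub> cls t = cls (\<lambda>i. s i + t i)"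
    using N.a_rcos_sum[of s t] by (simp add: local_field_def FactRing_def)
  show "\<one>\<^bsub>K\<^esub> = cls (\<lambda>i. 1)" by (simp add: local_field_def FactRing_def)
  show "\<zero>\<^bsub>K\<^esub> = cls (\<lambda>i. 0)"
    by (rule Set.set_eqI) (simp add: mem_cls local_field_def FactRing_def)
qed

text \<open>Beyond the point where all differences are in \<open>L n\<close>, some term
  \<open>x\<close> is outside \<open>L n\<close>. For later terms the quotient by \<open>x\<close>
  differs from 1 by (s i - x) / x, which has positive valuation; so up to a principal unit the
  sequence is eventually constant.\<close>

lemma nonnull_eventually:
  assumes s: "s \<in> carrier C" "s \<notin> N"
  shows "\<exists>x n. x \<noteq> 0 \<and> x \<notin> L n \<and> (\<forall>\<^sub>F i in sequentially. s i * inverse x - 1 \<in> L 1 \<and> s i \<notin> L n)"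
proof -
  obtain n where n: "\<not> (\<forall>\<^sub>F i in sequentially. s i \<in> L n)" using s(2) N_iff by blast
  obtain M where M: "\<forall>i\<ge>M. \<forall>j\<ge>M. s i - s j \<in> L n" using s(1) C_iff by blast
  obtain k where k: "k \<ge> M" "s k \<notin> L n" using n unfolding eventually_sequentially by blast
  have "s i * inverse (s k) - 1 \<in> L 1 \<and> s i \<notin> L n" if "i \<ge> M" for i
  proof -
    have nz: "s k \<noteq> 0" using k by auto
    have d: "s i - s k \<in> L n" using M that k by blast
    have "(inverse (\<pi> ^ n) * (s i - s k)) * (\<pi> ^ n * inverse (s k)) \<in> L 1"
      by (rule L_mult_R(2)[OF nonmember_inverse[OF k(2)] L_iff[THEN iffD1, OF d]])
    moreover have "(inverse (\<pi> ^ n) * (s i - s k)) * (\<pi> ^ n * inverse (s k)) = s i * inverse (s k) - 1"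
      using nz pi_nz by (simp add: field_simps)
    moreover have "s i \<notin> L n" using L_diff[of "s i" n "s i - s k"] d k(2) by auto
    ultimately show ?thesis by simp
  qed
  then show ?thesis using k unfolding eventually_sequentially
    by (metis L_0)
qed

lemma C_inverse:
  assumes s: "s \<in> carrier C" "s \<notin> N" shows "(\<lambda>i. inverse (s i)) \<in> carrier C"
  unfolding C_iff
proof
  fix m
  obtain n where n: "\<forall>\<^sub>F i in sequentially. s i \<notin> L n" 
    using nonnull_eventually[OF s] unfolding eventually_conj_iff by blast
  then obtain M where M: "\<And>i. i \<ge> M \<Longrightarrow> s i \<notin> L n" unfolding eventually_sequentially by blast
  \<comment> \<open>The difference of two inverses is a difference of terms divided by both terms.
    Each division costs at most \<open>n\<close> steps of precision, which explains
    \<open>m + n + n\<close>.\<close>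
  obtain M' where M': "\<And>i j. i \<ge> M' \<Longrightarrow> j \<ge> M' \<Longrightarrow> s i - s j \<in> L (m + n + n)"
    using s(1) unfolding C_iff by meson
  have "inverse (s i) - inverse (s j) \<in> L m" if "i \<ge> max M M'" "j \<ge> max M M'" for i j
  proof -
    have nz: "s i \<noteq> 0" "s j \<noteq> 0" using M[of i] M[of j] that by auto
    have "inverse (\<pi> ^ m) * (inverse (s i) - inverse (s j)) =
      (inverse (\<pi> ^ (m + n + n)) * (s j - s i)) * (\<pi> ^ n * inverse (s i)) * (\<pi> ^ n * inverse (s j))"
      using nz pi_nz by (simp add: field_simps power_add)
    moreover have "inverse (\<pi> ^ (m + n + n)) * (s j - s i) \<in> R" using M'[of j i] that L_iff by auto
    moreover have "\<pi> ^ n * inverse (s i) \<in> R" "\<pi> ^ n * inverse (s j) \<in> R"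
      using nonmember_inverse[OF M[of i]] nonmember_inverse[OF M[of j]] that L_antimono[of 0 1] L_zero by auto
    ultimately show ?thesis using L_iff R_mult by metis
  qed
  then show "\<exists>M. \<forall>i\<ge>M. \<forall>j\<ge>M. inverse (s i) - inverse (s j) \<in> L m" by blast
qed

lemma cring_K: "cring K"
  unfolding local_field_def by (rule N.quotient_is_cring[OF C.is_cring])

text \<open>A Cauchy sequence that is not null is eventually nonzero, so the termwise inverse is an
  inverse up to a null sequence; the value \<open>inverse 0 = 0\<close> enters at finitely many
  indices at most.\<close>

sublocale K: field K
proof -
  interpret K: cring K by (rule cring_K)
  have ne: "\<one>\<^bsub>K\<^esub> \<noteq> \<zero>\<^bsub>K\<^esub>"
    using one_notin_L1 by (auto simp: K_simps cls_eq_iff N_iff intro!: exI[of _ 1])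
  have "A \<in> Units K" if A: "A \<in> carrier K" "A \<noteq> \<zero>\<^bsub>K\<^esub>" for A
  proof -
    obtain s where s: "s \<in> carrier C" "A = cls s" using A carrier_K by auto
    then have "s \<notin> N" using A by (simp add: K_simps cls_eq_iff)
    then have i: "(\<lambda>i. inverse (s i)) \<in> carrier C" and ev: "\<forall>\<^sub>F i in sequentially. s i \<noteq> 0"
      using C_inverse[OF s(1)] nonnull_eventually[OF s(1)] by (auto elim!: eventually_mono)
    have "\<forall>\<^sub>F i in sequentially. s i * inverse (s i) - 1 \<in> L n" for n
      using ev by eventually_elim simp
    then have "A \<otimes>\<^bsub>K\<^esub> cls (\<lambda>i. inverse (s i)) = \<one>\<^bsub>K\<^esub>"
      using s i by (simp add: K_simps cls_eq_iff N_iff)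
    then show ?thesis using A i K.m_comm unfolding Units_def by (auto intro!: bexI[of _ "cls (\<lambda>i. inverse (s i))"])
  qed
  moreover have "A \<noteq> \<zero>\<^bsub>K\<^esub>" if "A \<in> Units K" for A
  proof
    assume "A = \<zero>\<^bsub>K\<^esub>"
    then have "\<one>\<^bsub>K\<^esub> = inv\<^bsub>K\<^esub> A \<otimes>\<^bsub>K\<^esub> \<zero>\<^bsub>K\<^esub>" using K.Units_l_inv[OF that] by simp
    also have "\<dots> = \<zero>\<^bsub>K\<^esub>" using that by (intro K.r_null) simp
    finally show False using ne by simp
  qed
  ultimately have "Units K = carrier K - {\<zero>\<^bsub>K\<^esub>}" using K.Units_closed by blast
  then show "field K" by (rule K.cring_fieldI)
qed

text \<open>The \<open>n\<close>-th power of the maximal ideal of the completed ring: the classes of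
  valuation at least \<open>n\<close>. In particular \<open>M 0\<close> is the ring of integers of
  the local field.\<close>

definition M :: "nat \<Rightarrow> (nat \<Rightarrow> 'k) set set" where
  "M n = {cls s | s. s \<in> carrier C \<and> (\<forall>\<^sub>F i in sequentially. s i \<in> L n)}"

lemma cls_M: "s \<in> carrier C \<Longrightarrow> cls s \<in> M n \<longleftrightarrow> (\<forall>\<^sub>F i in sequentially. s i \<in> L n)"
proof
  assume "s \<in> carrier C" "cls s \<in> M n"
  then obtain t where t: "cls s = cls t" "\<forall>\<^sub>F i in sequentially. t i \<in> L n" by (auto simp: M_def)
  then have "\<forall>\<^sub>F i in sequentially. s i - t i \<in> L n" by (auto simp: cls_eq_iff N_iff)
  with t(2) show "\<forall>\<^sub>F i in sequentially. s i \<in> L n"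
    by eventually_elim (use L_add in force)
qed (auto simp: M_def)

lemma M_carrier: "A \<in> M n \<Longrightarrow> A \<in> carrier K" by (auto simp: M_def)

lemma K_cases: "A \<in> carrier K \<Longrightarrow> (\<And>s. s \<in> carrier C \<Longrightarrow> A = cls s \<Longrightarrow> thesis) \<Longrightarrow> thesis"
  using carrier_K by auto

lemma K_minus: "s \<in> carrier C \<Longrightarrow> \<ominus>\<^bsub>K\<^esub> cls s = cls (\<lambda>i. - s i)"
  by (rule K.minus_equality) (simp_all add: K_simps C_minus cls_eq_iff)

lemma K_diff: "s \<in> carrier C \<Longrightarrow> t \<in> carrier C \<Longrightarrow> cls s \<ominus>\<^bsub>K\<^esub> cls t = cls (\<lambda>i. s i - t i)"
  by (simp add: a_minus_def K_minus K_simps C_minus)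

lemma M_add: assumes "A \<in> M n" "B \<in> M n" shows "A \<oplus>\<^bsub>K\<^esub> B \<in> M n"
proof -
  obtain s t where s: "s \<in> carrier C" "A = cls s" "\<forall>\<^sub>F i in sequentially. s i \<in> L n"
    and t: "t \<in> carrier C" "B = cls t" "\<forall>\<^sub>F i in sequentially. t i \<in> L n" using assms unfolding M_def by blast
  from s(3) t(3) have "\<forall>\<^sub>F i in sequentially. s i + t i \<in> L n" by eventually_elim (rule L_add)
  then show ?thesis unfolding s t K_simps(2)[OF s(1) t(1)] cls_M[OF C_add[OF s(1) t(1)]] .
qed

lemma M_mult: assumes "A \<in> M m" "B \<in> M n" shows "A \<otimes>\<^bsub>K\<^esub> B \<in> M (m + n)"
proof -
  obtain s t where s: "s \<in> carrier C" "A = cls s" "\<forall>\<^sub>F i in sequentially. s i \<in> L m"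
    and t: "t \<in> carrier C" "B = cls t" "\<forall>\<^sub>F i in sequentially. t i \<in> L n" using assms unfolding M_def by blast
  from s(3) t(3) have "\<forall>\<^sub>F i in sequentially. s i * t i \<in> L (m + n)" by eventually_elim (rule L_mult)
  then show ?thesis unfolding s t K_simps(1)[OF s(1) t(1)] cls_M[OF C_mult[OF s(1) t(1)]] .
qed

lemma M_minus: assumes "A \<in> M n" shows "\<ominus>\<^bsub>K\<^esub> A \<in> M n"
proof -
  obtain s where s: "s \<in> carrier C" "A = cls s" "\<forall>\<^sub>F i in sequentially. s i \<in> L n" using assms unfolding M_def by blast
  from s(3) have "\<forall>\<^sub>F i in sequentially. - s i \<in> L n" by eventually_elim (rule L_minus)
  then show ?thesis unfolding s K_minus[OF s(1)] cls_M[OF C_minus[OF s(1)]] .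
qed

lemma M_antimono: assumes "m \<le> n" "A \<in> M n" shows "A \<in> M m"
proof -
  obtain s where s: "s \<in> carrier C" "A = cls s" "\<forall>\<^sub>F i in sequentially. s i \<in> L n" using assms unfolding M_def by blast
  from s(3) have "\<forall>\<^sub>F i in sequentially. s i \<in> L m" by eventually_elim (rule subsetD[OF L_antimono[OF assms(1)]])
  then show ?thesis unfolding s cls_M[OF s(1)] .
qed

lemma M_mult_0: "A \<in> M n \<Longrightarrow> B \<in> M 0 \<Longrightarrow> A \<otimes>\<^bsub>K\<^esub> B \<in> M n" "A \<in> M 0 \<Longrightarrow> B \<in> M n \<Longrightarrow> A \<otimes>\<^bsub>K\<^esub> B \<in> M n"
  using M_mult[of A n B 0] M_mult[of A 0 B n] by auto

lemma M_zero [simp]: "\<zero>\<^bsub>K\<^esub> \<in> M n" by (simp add: K_simps cls_M)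
lemma M_one [simp]: "\<one>\<^bsub>K\<^esub> \<in> M 0" by (simp add: K_simps cls_M L_zero R_1)
lemma one_notin_M1: "\<one>\<^bsub>K\<^esub> \<notin> M 1" using one_notin_L1 by (simp add: K_simps cls_M)

lemma M_Inter: "A \<in> carrier K \<Longrightarrow> (\<And>n. A \<in> M n) \<Longrightarrow> A = \<zero>\<^bsub>K\<^esub>"
  by (elim K_cases) (simp add: cls_M K_simps cls_eq_iff N_iff)

lemma mult_in_M: "A \<in> carrier K \<Longrightarrow> \<exists>m. \<forall>B\<in>M m. A \<otimes>\<^bsub>K\<^esub> B \<in> M n"
proof (elim K_cases)
  fix s assume s: "s \<in> carrier C" "A = cls s"
  obtain m where m: "\<forall>\<^sub>F i in sequentially. \<forall>y\<in>L m. s i * y \<in> L n" using C_mult_L s by blast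
  have "A \<otimes>\<^bsub>K\<^esub> B \<in> M n" if "B \<in> M m" for B
  proof -
    obtain t where t: "t \<in> carrier C" "B = cls t" "\<forall>\<^sub>F i in sequentially. t i \<in> L m" using \<open>B \<in> M m\<close> by (auto simp: M_def)
    have "\<forall>\<^sub>F i in sequentially. s i * t i \<in> L n" using m t(3) by eventually_elim blast
    then show ?thesis using s t by (simp add: K_simps cls_M C_mult)
  qed
  then show ?thesis by blast
qed

section \<open>The embedding of K and the ring of local integers\<close>

lemma to_local_field_hom [simp]:
  "to_local_field P x \<in> carrier K"
  "to_local_field P (x * y) = to_local_field P x \<otimes>\<^bsub>K\<^esub> to_local_field P y"
  "to_local_field P (x + y) = to_local_field P x \<oplus>\<^bsub>K\<^esub> to_local_field P y"
  "to_local_field P (x - y) = to_local_field P x \<ominus>\<^bsub>K\<^esub> to_local_field P y"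
  "to_local_field P 1 = \<one>\<^bsub>K\<^esub>" "to_local_field P 0 = \<zero>\<^bsub>K\<^esub>"
  by (simp_all add: to_local_field_def K_simps K_diff)

lemma to_local_M: "to_local_field P x \<in> M n \<longleftrightarrow> x \<in> L n"
  by (simp add: to_local_field_def cls_M)

lemma to_local_eq_iff [simp]: "to_local_field P x = to_local_field P y \<longleftrightarrow> x = y"
  using nonzero_notin_L[of "x - y"] by (auto simp: to_local_field_def cls_eq_iff N_iff)

lemma to_local_Units: "x \<noteq> 0 \<Longrightarrow> to_local_field P x \<in> Units K"
  using K.field_Units to_local_eq_iff[of x 0] by auto

lemma to_local_inverse: "x \<noteq> 0 \<Longrightarrow> inv\<^bsub>K\<^esub> (to_local_field P x) = to_local_field P (inverse x)"
  by (rule K.inv_char) (simp_all flip: to_local_field_hom(2))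

text \<open>\<open>local_integers\<close> is built from sequences of algebraic integers, whereas
  members of \<open>M 0\<close> have terms in the localization \<open>R\<close>. Density of the
  integers in \<open>R\<close> lets each term be replaced by an integer without changing the
  class.\<close>

lemma carrier_local_integers: "carrier (local_integers P) = M 0"
proof
  show "carrier (local_integers P) \<subseteq> M 0"
  proof
    fix A assume "A \<in> carrier (local_integers P)"
    then obtain s where s: "s \<in> carrier C" "A = cls s" "range s \<subseteq> carrier ring_of_integers"
      by (auto simp: local_integers_def)
    then have "s i \<in> L 0" for i using integers_R by (auto simp: ring_of_integers_def L_zero)
    then show "A \<in> M 0" using s cls_M by simp
  qed
next
  show "M 0 \<subseteq> carrier (local_integers P)"
  proof
    fix A assume "A \<in> M 0"
    then obtain s where s: "s \<in> carrier C" "A = cls s" "\<forall>\<^sub>F i in sequentially. s i \<in> R"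
      by (auto simp: M_def L_zero)
    \<comment> \<open>The precision at index \<open>i\<close> is \<open>i\<close> itself, which
      makes the difference of the two sequences null. The default 0 is taken only at the finitely
      many indices whose term is outside \<open>R\<close>.\<close>
    define t where "t = (\<lambda>i. if s i \<in> R then SOME a. algebraic_int a \<and> s i - a \<in> L i else 0)"
    have t: "algebraic_int (t i) \<and> s i - t i \<in> L i" if "s i \<in> R" for i
      unfolding t_def using that someI_ex[OF integers_dense[OF that, of i]] by auto
    have "algebraic_int (t i)" for i using t[of i] by (cases "s i \<in> R") (auto simp: t_def)
    then have r: "range t \<subseteq> carrier ring_of_integers" by (auto simp: ring_of_integers_def)
    have "\<forall>\<^sub>F i in sequentially. s i - t i \<in> L n" for n
      using s(3) eventually_ge_at_top[of n]
      by eventually_elim (use t L_antimono in blast)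
    then have n: "(\<lambda>i. s i - t i) \<in> N" by (simp add: N_iff)
    then have "A = cls t" using s cls_eq_iff by simp
    moreover have "t \<in> carrier C"
      using C_add[OF s(1) C_minus[OF subsetD[OF N_subset n]]] by simp
    ultimately show "A \<in> carrier (local_integers P)" using r by (auto simp: local_integers_def)
  qed
qed

lemma local_integers_simps [simp]:
  "A \<otimes>\<^bsub>local_integers P\<^esub> B = A \<otimes>\<^bsub>K\<^esub> B" "A \<oplus>\<^bsub>local_integers P\<^esub> B = A \<oplus>\<^bsub>K\<^esub> B"
  "\<one>\<^bsub>local_integers P\<^esub> = \<one>\<^bsub>K\<^esub>" "\<zero>\<^bsub>local_integers P\<^esub> = \<zero>\<^bsub>K\<^esub>"
  by (simp_all add: local_integers_def)

lemma cring_local_integers: "cring (local_integers P)"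
proof (rule cringI)
  show "abelian_group (local_integers P)"
  proof (rule abelian_groupI)
    fix A assume "A \<in> carrier (local_integers P)"
    then show "\<exists>B\<in>carrier (local_integers P). B \<oplus>\<^bsub>local_integers P\<^esub> A = \<zero>\<^bsub>local_integers P\<^esub>"
      by (intro bexI[of _ "\<ominus>\<^bsub>K\<^esub> A"]) (auto simp: carrier_local_integers M_minus M_carrier K.l_neg)
  qed (auto simp: carrier_local_integers M_add M_carrier K.a_ac)
  show "comm_monoid (local_integers P)"
    by (rule comm_monoidI) (auto simp: carrier_local_integers M_mult_0 M_carrier K.m_ac)
qed (auto simp: carrier_local_integers M_carrier K.l_distr)

lemma Units_local_integers:
  "A \<in> Units (local_integers P) \<longleftrightarrow> A \<in> Units K \<and> A \<in> M 0 \<and> inv\<^bsub>K\<^esub> A \<in> M 0"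
proof
  assume "A \<in> Units (local_integers P)"
  then obtain B where B: "A \<in> M 0" "B \<in> M 0" "B \<otimes>\<^bsub>K\<^esub> A = \<one>\<^bsub>K\<^esub>" "A \<otimes>\<^bsub>K\<^esub> B = \<one>\<^bsub>K\<^esub>"
    by (auto simp: Units_def carrier_local_integers)
  then have "A \<in> Units K" "inv\<^bsub>K\<^esub> A = B"
    using M_carrier[OF B(1)] M_carrier[OF B(2)] K.inv_char by (auto simp: Units_def)
  then show "A \<in> Units K \<and> A \<in> M 0 \<and> inv\<^bsub>K\<^esub> A \<in> M 0" using B by simp
next
  assume "A \<in> Units K \<and> A \<in> M 0 \<and> inv\<^bsub>K\<^esub> A \<in> M 0"
  then show "A \<in> Units (local_integers P)"
    by (auto simp: Units_def[of "local_integers P"] carrier_local_integers intro!: bexI[of _ "inv\<^bsub>K\<^esub> A"])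
qed

text \<open>The principal units of level \<open>n\<close>, that is, 1 plus the \<open>n\<close>-th
  power of the maximal ideal. For \<open>n = 0\<close> this is all of \<open>M 0\<close> and
  contains non-units, hence the recurring condition \<open>n \<ge> 1\<close>.\<close>

definition U1 :: "nat \<Rightarrow> (nat \<Rightarrow> 'k) set set" where
  "U1 n = {A \<in> carrier K. A \<ominus>\<^bsub>K\<^esub> \<one>\<^bsub>K\<^esub> \<in> M n}"

text \<open>The terms of a representing sequence are eventually congruent to 1, so they and their
  inverses lie in \<open>R\<close>. The level of the inverse follows from inv A - 1 = - inv A * (A -
  1).\<close>

lemma U1_units:
  assumes n: "n \<ge> 1" and A: "A \<in> U1 n"
  shows "A \<in> Units K" "A \<in> M 0" "inv\<^bsub>K\<^esub> A \<in> M 0" "inv\<^bsub>K\<^esub> A \<in> U1 n"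
proof -
  obtain s where s: "s \<in> carrier C" "A = cls s" using A by (auto simp: U1_def elim: K_cases)
  have m: "(\<lambda>i. s i - 1) \<in> carrier C" using C_add[OF s(1), of "\<lambda>i. - 1"] by simp
  have Am: "A \<ominus>\<^bsub>K\<^esub> \<one>\<^bsub>K\<^esub> \<in> M n" and Ac: "A \<in> carrier K" using A by (auto simp: U1_def)
  then have "A \<ominus>\<^bsub>K\<^esub> \<one>\<^bsub>K\<^esub> \<in> M 1" using M_antimono n by blast
  then have ev: "\<forall>\<^sub>F i in sequentially. s i - 1 \<in> L 1"
    using m s by (simp add: K_simps K_diff cls_M)
  have "A \<noteq> \<zero>\<^bsub>K\<^esub>"
    using \<open>A \<ominus>\<^bsub>K\<^esub> \<one>\<^bsub>K\<^esub> \<in> M 1\<close> M_minus[of "\<ominus>\<^bsub>K\<^esub> \<one>\<^bsub>K\<^esub>" 1] one_notin_M1 by (auto simp: a_minus_def)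
  then show Au: "A \<in> Units K" using Ac K.field_Units by simp
  show A0: "A \<in> M 0" unfolding s(2) cls_M[OF s(1)]
    using ev by eventually_elim (use one_plus_L1 L_zero in blast)
  have "s \<notin> N" using \<open>A \<noteq> \<zero>\<^bsub>K\<^esub>\<close> s by (simp add: K_simps cls_eq_iff)
  then have i: "(\<lambda>i. inverse (s i)) \<in> carrier C" by (rule C_inverse[OF s(1)])
  have "\<forall>\<^sub>F i in sequentially. s i * inverse (s i) - 1 \<in> L n" for n
    using ev by eventually_elim (use one_plus_L1(3) in simp)
  then have "A \<otimes>\<^bsub>K\<^esub> cls (\<lambda>i. inverse (s i)) = \<one>\<^bsub>K\<^esub>"
    using s i by (simp add: K_simps cls_eq_iff N_iff)
  then have inv: "inv\<^bsub>K\<^esub> A = cls (\<lambda>i. inverse (s i))"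
    using K.comm_inv_char[OF Ac] i by simp
  show I0: "inv\<^bsub>K\<^esub> A \<in> M 0" unfolding inv cls_M[OF i]
    using ev by eventually_elim (use one_plus_L1 L_zero in blast)
  have ic: "inv\<^bsub>K\<^esub> A \<in> carrier K" using Au by simp
  have "inv\<^bsub>K\<^esub> A \<ominus>\<^bsub>K\<^esub> \<one>\<^bsub>K\<^esub> = \<ominus>\<^bsub>K\<^esub> (inv\<^bsub>K\<^esub> A \<otimes>\<^bsub>K\<^esub> (A \<ominus>\<^bsub>K\<^esub> \<one>\<^bsub>K\<^esub>))"
    using Au Ac ic by (simp add: a_minus_def K.r_distr K.minus_add K.r_minus K.a_comm)
  then show "inv\<^bsub>K\<^esub> A \<in> U1 n" using M_minus[OF M_mult_0(2)[OF I0 Am]] ic by (simp add: U1_def)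
qed

lemma U1_mult:
  assumes "A \<in> U1 n" "B \<in> U1 n" shows "A \<otimes>\<^bsub>K\<^esub> B \<in> U1 n"
proof -
  have c: "A \<in> carrier K" "B \<in> carrier K" "A \<ominus>\<^bsub>K\<^esub> \<one>\<^bsub>K\<^esub> \<in> M n" "B \<ominus>\<^bsub>K\<^esub> \<one>\<^bsub>K\<^esub> \<in> M n"
    using assms by (auto simp: U1_def)
  have "B = (B \<ominus>\<^bsub>K\<^esub> \<one>\<^bsub>K\<^esub>) \<oplus>\<^bsub>K\<^esub> \<one>\<^bsub>K\<^esub>" using c(2) by (simp add: a_minus_def K.a_assoc K.l_neg)
  then have "B \<in> M 0" using M_add[OF M_antimono[OF _ c(4)] M_one] by simp
  then have "(A \<ominus>\<^bsub>K\<^esub> \<one>\<^bsub>K\<^esub>) \<otimes>\<^bsub>K\<^esub> B \<oplus>\<^bsub>K\<^esub> (B \<ominus>\<^bsub>K\<^esub> \<one>\<^bsub>K\<^esub>) \<in> M n"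
    using c M_add M_mult_0 by blast
  moreover have "(A \<ominus>\<^bsub>K\<^esub> \<one>\<^bsub>K\<^esub>) \<otimes>\<^bsub>K\<^esub> B \<oplus>\<^bsub>K\<^esub> (B \<ominus>\<^bsub>K\<^esub> \<one>\<^bsub>K\<^esub>) = A \<otimes>\<^bsub>K\<^esub> B \<ominus>\<^bsub>K\<^esub> \<one>\<^bsub>K\<^esub>"
    using c(1,2) by (simp add: K.minus_distr K.minus_telescope)
  ultimately show ?thesis using c by (simp add: U1_def)
qed

lemma U1_antimono: "m \<le> n \<Longrightarrow> U1 n \<subseteq> U1 m"
  using M_antimono by (auto simp: U1_def)

lemma U1_one [simp]: "\<one>\<^bsub>K\<^esub> \<in> U1 n" by (simp add: U1_def a_minus_def K.r_neg)

text \<open>A representing sequence is eventually a fixed \<open>x\<close> times principal units.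
  This carries the factorization by powers of \<pi> from K to its completion.\<close>

lemma unit_eq_constant_times_U1:
  assumes "A \<in> Units K"
  shows "\<exists>x W. x \<noteq> 0 \<and> W \<in> U1 1 \<and> A = to_local_field P x \<otimes>\<^bsub>K\<^esub> W"
proof -
  have A: "A \<in> carrier K" "A \<noteq> \<zero>\<^bsub>K\<^esub>" using assms K.field_Units by auto
  then obtain s where s: "s \<in> carrier C" "A = cls s" by (elim K_cases)
  then have "s \<notin> N" using A by (simp add: K_simps cls_eq_iff)
  then obtain x where x: "x \<noteq> 0" "\<forall>\<^sub>F i in sequentially. s i * inverse x - 1 \<in> L 1"
    using nonnull_eventually[OF s(1)] by (auto simp: eventually_conj_iff)
  let ?t = "\<lambda>i. s i * inverse x"
  have t: "?t \<in> carrier C" using C_mult[OF s(1) C_const] .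
  have "cls ?t \<in> U1 1"
    using x(2) t C_add[OF t, of "\<lambda>i. - 1"] by (simp add: U1_def K_simps K_diff cls_M)
  moreover have "A = to_local_field P x \<otimes>\<^bsub>K\<^esub> cls ?t"
  proof -
    have "s = (\<lambda>i. x * (s i * inverse x))" using x(1) by (auto simp: fun_eq_iff)
    then show ?thesis using s t by (simp add: to_local_field_def K_simps)
  qed
  ultimately show ?thesis using x by blast
qed

section \<open>Topologies of the local field, of its units and of its integers\<close>

lemma local_neighbourhood_iff:
  assumes "A \<in> carrier K"
  shows "B \<in> local_neighbourhood P n A \<longleftrightarrow> B \<in> carrier K \<and> B \<ominus>\<^bsub>K\<^esub> A \<in> M n"
proof -
  have "(\<forall>x\<in>A. \<forall>y\<in>B. \<forall>\<^sub>F i in sequentially. y i - x i \<in> L n) \<longleftrightarrow> B \<ominus>\<^bsub>K\<^esub> A \<in> M n"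
    if B: "B \<in> carrier K"
  proof -
    obtain s t where s: "s \<in> carrier C" "A = cls s" and t: "t \<in> carrier C" "B = cls t"
      using assms B by (meson K_cases)
    have "B \<ominus>\<^bsub>K\<^esub> A \<in> M n \<longleftrightarrow> (\<forall>\<^sub>F i in sequentially. t i - s i \<in> L n)"
      using s t C_add[OF t(1) C_minus[OF s(1)]] by (simp add: K_diff cls_M)
    moreover have "s \<in> A" "t \<in> B" using s t by (simp_all add: mem_cls)
    \<comment> \<open>The definition quantifies over all representatives of both classes; changing
      them adds null sequences, which eventually lie in \<open>L n\<close>, so one pair of
      representatives decides.\<close>
    moreover have "\<forall>\<^sub>F i in sequentially. y i - x i \<in> L n"
      if "\<forall>\<^sub>F i in sequentially. t i - s i \<in> L n" "x \<in> A" "y \<in> B" for x y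
    proof -
      have "\<forall>\<^sub>F i in sequentially. x i - s i \<in> L n" "\<forall>\<^sub>F i in sequentially. y i - t i \<in> L n"
        using that(2,3) s t by (auto simp: mem_cls N_iff)
      with that(1) show ?thesis
      proof eventually_elim
        case (elim i)
        have "(y i - t i) + (t i - s i) - (x i - s i) \<in> L n" using elim L_add L_diff by blast
        then show ?case by simp
      qed
    qed
    ultimately show ?thesis by blast
  qed
  then show ?thesis by (auto simp: local_neighbourhood_def)
qed

lemma openin_local_topology:
  "openin (local_topology P) U \<longleftrightarrow>
    U \<subseteq> carrier K \<and> (\<forall>A\<in>U. \<exists>n. \<forall>B\<in>carrier K. B \<ominus>\<^bsub>K\<^esub> A \<in> M n \<longrightarrow> B \<in> U)"
proof -
  let ?P = "\<lambda>U. U \<subseteq> carrier K \<and> (\<forall>A\<in>U. \<exists>n. local_neighbourhood P n A \<subseteq> U)"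
  have anti: "local_neighbourhood P n A \<subseteq> local_neighbourhood P m A" if "m \<le> n" "A \<in> carrier K" for m n A
    using that by (auto simp: local_neighbourhood_iff intro: M_antimono)
  have "istopology ?P"
    unfolding istopology_def
  proof (intro conjI allI impI)
    fix S T assume S: "?P S" and T: "?P T"
    then show "S \<inter> T \<subseteq> carrier K" by blast
    show "\<forall>A\<in>S \<inter> T. \<exists>n. local_neighbourhood P n A \<subseteq> S \<inter> T"
    proof
      fix A assume A: "A \<in> S \<inter> T"
      then obtain m n where "local_neighbourhood P m A \<subseteq> S" "local_neighbourhood P n A \<subseteq> T" using S T by blast
      then show "\<exists>n. local_neighbourhood P n A \<subseteq> S \<inter> T"
        using anti[of m "max m n" A] anti[of n "max m n" A] A S by (intro exI[of _ "max m n"]) auto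
    qed
  next
    fix \<K> assume "\<forall>S\<in>\<K>. ?P S"
    then show "\<Union>\<K> \<subseteq> carrier K" "\<forall>A\<in>\<Union>\<K>. \<exists>n. local_neighbourhood P n A \<subseteq> \<Union>\<K>"
      by blast (meson Sup_upper UnionE \<open>\<forall>S\<in>\<K>. ?P S\<close> subset_trans)
  qed
  then have "openin (local_topology P) U \<longleftrightarrow> ?P U" by (simp add: local_topology_def topology_inverse')
  also have "\<dots> \<longleftrightarrow> U \<subseteq> carrier K \<and> (\<forall>A\<in>U. \<exists>n. \<forall>B\<in>carrier K. B \<ominus>\<^bsub>K\<^esub> A \<in> M n \<longrightarrow> B \<in> U)"
  proof (rule conj_cong[OF refl])
    assume U: "U \<subseteq> carrier K"
    have "local_neighbourhood P n A \<subseteq> U \<longleftrightarrow> (\<forall>B\<in>carrier K. B \<ominus>\<^bsub>K\<^esub> A \<in> M n \<longrightarrow> B \<in> U)"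
      if "A \<in> U" for n A
      using local_neighbourhood_iff[of A] that U by blast
    then show "(\<forall>A\<in>U. \<exists>n. local_neighbourhood P n A \<subseteq> U) \<longleftrightarrow>
        (\<forall>A\<in>U. \<exists>n. \<forall>B\<in>carrier K. B \<ominus>\<^bsub>K\<^esub> A \<in> M n \<longrightarrow> B \<in> U)" by blast
  qed
  finally show ?thesis .
qed

text \<open>Additive balls around a unit \<open>A\<close> and the sets of products of
  \<open>A\<close> with principal units are cofinal: multiplication by \<open>A\<close> in one
  direction, and by its inverse in the other, is continuous at 0. The subspace topology is thus a
  group topology with the principal units as basis at 1.\<close>

lemma openin_local_units_topology:
  "openin (local_units_topology P) U \<longleftrightarrow>
    U \<subseteq> Units K \<and> (\<forall>A\<in>U. \<exists>n\<ge>1. \<forall>W\<in>U1 n. A \<otimes>\<^bsub>K\<^esub> W \<in> U)"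
proof
  assume "openin (local_units_topology P) U"
  then obtain T where T: "openin (local_topology P) T" and U: "U = T \<inter> Units K"
    unfolding local_units_topology_def openin_subtopology by blast
  have "\<exists>n\<ge>1. \<forall>W\<in>U1 n. A \<otimes>\<^bsub>K\<^esub> W \<in> U" if A: "A \<in> U" for A
  proof -
    have Au: "A \<in> Units K" "A \<in> carrier K" using A U by auto
    obtain n where n: "\<And>B. B \<in> carrier K \<Longrightarrow> B \<ominus>\<^bsub>K\<^esub> A \<in> M n \<Longrightarrow> B \<in> T"
      using T A U unfolding openin_local_topology by blast
    obtain m where m: "\<And>B. B \<in> M m \<Longrightarrow> A \<otimes>\<^bsub>K\<^esub> B \<in> M n" using mult_in_M[OF Au(2)] by blast
    have "A \<otimes>\<^bsub>K\<^esub> W \<in> U" if W: "W \<in> U1 (max 1 m)" for W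
    proof -
      have Wu: "W \<in> Units K" "W \<in> carrier K" using U1_units(1)[OF _ W] by auto
      have "W \<ominus>\<^bsub>K\<^esub> \<one>\<^bsub>K\<^esub> \<in> M m" using W M_antimono[of m "max 1 m"] by (auto simp: U1_def)
      then have "A \<otimes>\<^bsub>K\<^esub> (W \<ominus>\<^bsub>K\<^esub> \<one>\<^bsub>K\<^esub>) \<in> M n" by (rule m)
      moreover have "A \<otimes>\<^bsub>K\<^esub> (W \<ominus>\<^bsub>K\<^esub> \<one>\<^bsub>K\<^esub>) = A \<otimes>\<^bsub>K\<^esub> W \<ominus>\<^bsub>K\<^esub> A" using Au Wu by (simp add: K.minus_distr)
      ultimately have "A \<otimes>\<^bsub>K\<^esub> W \<in> T" using n[of "A \<otimes>\<^bsub>K\<^esub> W"] Au Wu by simp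
      then show ?thesis using U Au Wu by simp
    qed
    then show ?thesis by (intro exI[of _ "max 1 m"]) auto
  qed
  then show "U \<subseteq> Units K \<and> (\<forall>A\<in>U. \<exists>n\<ge>1. \<forall>W\<in>U1 n. A \<otimes>\<^bsub>K\<^esub> W \<in> U)" using U by blast
next
  assume U: "U \<subseteq> Units K \<and> (\<forall>A\<in>U. \<exists>n\<ge>1. \<forall>W\<in>U1 n. A \<otimes>\<^bsub>K\<^esub> W \<in> U)"
  have "openin (local_topology P) U" unfolding openin_local_topology
  proof (intro conjI ballI)
    show "U \<subseteq> carrier K" using U K.Units_closed by blast
    fix A assume A: "A \<in> U"
    then have Au: "A \<in> Units K" "A \<in> carrier K" "inv\<^bsub>K\<^esub> A \<in> carrier K" using U by auto
    obtain n where n: "n \<ge> 1" "\<And>W. W \<in> U1 n \<Longrightarrow> A \<otimes>\<^bsub>K\<^esub> W \<in> U" using U A by blast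
    obtain m where m: "\<And>B. B \<in> M m \<Longrightarrow> inv\<^bsub>K\<^esub> A \<otimes>\<^bsub>K\<^esub> B \<in> M n" using mult_in_M[OF Au(3)] by blast
    have "B \<in> U" if B: "B \<in> carrier K" "B \<ominus>\<^bsub>K\<^esub> A \<in> M m" for B
    proof -
      have "inv\<^bsub>K\<^esub> A \<otimes>\<^bsub>K\<^esub> (B \<ominus>\<^bsub>K\<^esub> A) = inv\<^bsub>K\<^esub> A \<otimes>\<^bsub>K\<^esub> B \<ominus>\<^bsub>K\<^esub> \<one>\<^bsub>K\<^esub>"
        using Au B(1) by (simp add: a_minus_def K.r_distr K.r_minus)
      then have "inv\<^bsub>K\<^esub> A \<otimes>\<^bsub>K\<^esub> B \<in> U1 n" using m[OF B(2)] Au B(1) by (simp add: U1_def)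
      moreover have "A \<otimes>\<^bsub>K\<^esub> (inv\<^bsub>K\<^esub> A \<otimes>\<^bsub>K\<^esub> B) = B" using Au B(1) by (simp flip: K.m_assoc)
      ultimately show ?thesis using n(2) by metis
    qed
    then show "\<exists>n. \<forall>B\<in>carrier K. B \<ominus>\<^bsub>K\<^esub> A \<in> M n \<longrightarrow> B \<in> U" by blast
  qed
  then show "openin (local_units_topology P) U"
    unfolding local_units_topology_def openin_subtopology using U by blast
qed

lemma openin_local_integers_topology:
  "openin (local_integers_topology P) U \<longleftrightarrow>
    U \<subseteq> M 0 \<and> (\<forall>A\<in>U. \<exists>n. \<forall>B\<in>M 0. B \<ominus>\<^bsub>K\<^esub> A \<in> M n \<longrightarrow> B \<in> U)"
proof
  assume "openin (local_integers_topology P) U"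
  then obtain T where "openin (local_topology P) T" "U = T \<inter> M 0"
    unfolding local_integers_topology_def openin_subtopology carrier_local_integers by blast
  then show "U \<subseteq> M 0 \<and> (\<forall>A\<in>U. \<exists>n. \<forall>B\<in>M 0. B \<ominus>\<^bsub>K\<^esub> A \<in> M n \<longrightarrow> B \<in> U)"
    unfolding openin_local_topology using M_carrier by blast
next
  assume U: "U \<subseteq> M 0 \<and> (\<forall>A\<in>U. \<exists>n. \<forall>B\<in>M 0. B \<ominus>\<^bsub>K\<^esub> A \<in> M n \<longrightarrow> B \<in> U)"
  have "openin (local_topology P) U" unfolding openin_local_topology
  proof (intro conjI ballI)
    show "U \<subseteq> carrier K" using U M_carrier by blast
    fix A assume A: "A \<in> U"
    then have A0: "A \<in> M 0" "A \<in> carrier K" using U M_carrier by blast+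
    obtain n where n: "\<And>B. B \<in> M 0 \<Longrightarrow> B \<ominus>\<^bsub>K\<^esub> A \<in> M n \<Longrightarrow> B \<in> U" using U A by blast
    have "B \<in> U" if B: "B \<in> carrier K" "B \<ominus>\<^bsub>K\<^esub> A \<in> M n" for B
    proof -
      have "(B \<ominus>\<^bsub>K\<^esub> A) \<oplus>\<^bsub>K\<^esub> A \<in> M 0" using M_add[OF M_antimono[OF _ B(2)] A0(1)] by simp
      moreover have "(B \<ominus>\<^bsub>K\<^esub> A) \<oplus>\<^bsub>K\<^esub> A = B" using A0 B(1) by (simp add: K.minus_add_cancel)
      ultimately show ?thesis using n B(2) by simp
    qed
    then show "\<exists>n. \<forall>B\<in>carrier K. B \<ominus>\<^bsub>K\<^esub> A \<in> M n \<longrightarrow> B \<in> U" by blast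
  qed
  then show "openin (local_integers_topology P) U"
    unfolding local_integers_topology_def openin_subtopology carrier_local_integers using U by blast
qed

lemma to_local_Units_integers:
  "x \<noteq> 0 \<Longrightarrow> to_local_field P x \<in> Units (local_integers P) \<longleftrightarrow> x \<in> R \<and> inverse x \<in> R"
  by (simp add: Units_local_integers to_local_Units to_local_inverse to_local_M L_zero)

text \<open>Approximating \<open>A\<close> by an element of K up to a principal unit reduces the
  claim to K, and the principal unit is absorbed into \<open>W\<close>. The disjunction stands for
  an integer exponent written with a natural number.\<close>

lemma Units_factor:
  assumes "A \<in> Units K"
  shows "\<exists>n W. W \<in> Units (local_integers P) \<and>
    (A = to_local_field P (\<pi> ^ n) \<otimes>\<^bsub>K\<^esub> W \<or> A = inv\<^bsub>K\<^esub> (to_local_field P (\<pi> ^ n)) \<otimes>\<^bsub>K\<^esub> W)"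
proof -
  obtain x V where x: "x \<noteq> 0" "V \<in> U1 1" "A = to_local_field P x \<otimes>\<^bsub>K\<^esub> V"
    using unit_eq_constant_times_U1[OF assms] by blast
  obtain n u where u: "u \<in> R" "inverse u \<in> R" "x = \<pi> ^ n * u \<or> x = inverse (\<pi> ^ n) * u"
    using factor[OF x(1)] by blast
  then have "u \<noteq> 0" using x(1) by auto
  then have U: "to_local_field P u \<in> Units (local_integers P)" using u to_local_Units_integers by simp
  have V: "V \<in> Units (local_integers P)" using U1_units[OF _ x(2)] Units_local_integers by simp
  interpret O: cring "local_integers P" by (rule cring_local_integers)
  have W: "to_local_field P u \<otimes>\<^bsub>K\<^esub> V \<in> Units (local_integers P)"
    using O.Units_m_closed[OF U V] by simp
  have Vc: "V \<in> carrier K" using x(2) by (simp add: U1_def)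
  have "A = to_local_field P (\<pi> ^ n) \<otimes>\<^bsub>K\<^esub> (to_local_field P u \<otimes>\<^bsub>K\<^esub> V) \<or>
     A = inv\<^bsub>K\<^esub> (to_local_field P (\<pi> ^ n)) \<otimes>\<^bsub>K\<^esub> (to_local_field P u \<otimes>\<^bsub>K\<^esub> V)"
    using u(3) x(3) Vc pi_nz to_local_inverse[of "\<pi> ^ n"] to_local_field_hom(1)
    by (auto simp: K.m_assoc simp del: to_local_eq_iff)
  then show ?thesis using W by blast
qed

end

section \<open>The finite ideles\<close>

text \<open>The places where a product leaves the subgroups lie in the union of those of its
  factors, and an inverse has no new ones; so the finiteness condition cuts out a subgroup of the
  full product.\<close>

lemma restricted_product_comm_group:
  assumes G: "\<And>i. i \<in> I \<Longrightarrow> comm_group (G i)" and H: "\<And>i. i \<in> I \<Longrightarrow> subgroup (H i) (G i)"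
  shows "comm_group (restricted_product I G H)"
    and "x \<in> carrier (restricted_product I G H) \<Longrightarrow>
      inv\<^bsub>restricted_product I G H\<^esub> x = (\<lambda>i\<in>I. inv\<^bsub>G i\<^esub> x i)"
proof -
  have grp: "group (G i)" if "i \<in> I" for i using G[OF that] by (simp add: comm_group_def)
  interpret PG: group "product_group I G" by (rule product_group) (rule grp)
  define C where "C = {x \<in> carrier (product_group I G). finite {i \<in> I. x i \<notin> H i}}"
  have RP: "restricted_product I G H = (product_group I G)\<lparr>carrier := C\<rparr>"
    by (simp add: restricted_product_def C_def)
  have inv: "inv\<^bsub>product_group I G\<^esub> x = (\<lambda>i\<in>I. inv\<^bsub>G i\<^esub> x i)" if "x \<in> C" for x
    using that grp by (intro inv_product_group) (auto simp: C_def)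
  have sub: "subgroup C (product_group I G)"
  proof (rule PG.subgroupI)
    have "\<one>\<^bsub>product_group I G\<^esub> i \<in> H i" if "i \<in> I" for i
      using subgroup.one_closed[OF H[OF that]] that by simp
    then have "{i \<in> I. \<one>\<^bsub>product_group I G\<^esub> i \<notin> H i} = {}" by blast
    then have "\<one>\<^bsub>product_group I G\<^esub> \<in> C" unfolding C_def using PG.one_closed by (simp only: mem_Collect_eq finite.emptyI simp_thms)
    then show "C \<noteq> {}" by blast
    show "C \<subseteq> carrier (product_group I G)" by (auto simp: C_def)
    fix x assume x: "x \<in> C"
    have "{i \<in> I. (inv\<^bsub>product_group I G\<^esub> x) i \<notin> H i} \<subseteq> {i \<in> I. x i \<notin> H i}"
    proof (intro subsetI CollectI conjI notI; elim CollectE conjE)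
      fix i assume i: "i \<in> I" "(inv\<^bsub>product_group I G\<^esub> x) i \<notin> H i" "x i \<in> H i"
      then show False using subgroup.m_inv_closed[OF H[OF i(1)] i(3)] by (simp add: inv[OF x])
    qed
    then show "inv\<^bsub>product_group I G\<^esub> x \<in> C" using x PG.inv_closed[of x]
      unfolding C_def by (blast intro: finite_subset)
    fix y assume y: "y \<in> C"
    have "{i \<in> I. (x \<otimes>\<^bsub>product_group I G\<^esub> y) i \<notin> H i} \<subseteq> {i \<in> I. x i \<notin> H i} \<union> {i \<in> I. y i \<notin> H i}"
    proof (rule subsetI, rule ccontr)
      fix i assume "i \<in> {i \<in> I. (x \<otimes>\<^bsub>product_group I G\<^esub> y) i \<notin> H i}"
        "i \<notin> {i \<in> I. x i \<notin> H i} \<union> {i \<in> I. y i \<notin> H i}"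
      then have i: "i \<in> I" "x i \<in> H i" "y i \<in> H i" "x i \<otimes>\<^bsub>G i\<^esub> y i \<notin> H i" by auto
      then show False using subgroup.m_closed[OF H[OF i(1)] i(2,3)] by blast
    qed
    then show "x \<otimes>\<^bsub>product_group I G\<^esub> y \<in> C" using x y PG.m_closed[of x y]
      unfolding C_def by (blast intro: finite_subset[OF _ finite_UnI])
  qed
  have "group (restricted_product I G H)"
    unfolding RP by (rule subgroup.subgroup_is_group[OF sub PG.group_axioms])
  then show "comm_group (restricted_product I G H)"
  proof (rule group.group_comm_groupI)
    fix x y assume "x \<in> carrier (restricted_product I G H)" "y \<in> carrier (restricted_product I G H)"
    then have "x i \<otimes>\<^bsub>G i\<^esub> y i = y i \<otimes>\<^bsub>G i\<^esub> x i" if "i \<in> I" for i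
      using that comm_monoid.m_comm[OF comm_group.axioms(1)[OF G[OF that]]] unfolding RP C_def
      by (auto simp: PiE_iff)
    then show "x \<otimes>\<^bsub>restricted_product I G H\<^esub> y = y \<otimes>\<^bsub>restricted_product I G H\<^esub> x"
      by (auto simp: RP)
  qed
  assume "x \<in> carrier (restricted_product I G H)"
  then have "x \<in> C" by (simp add: RP)
  then show "inv\<^bsub>restricted_product I G H\<^esub> x = (\<lambda>i\<in>I. inv\<^bsub>G i\<^esub> x i)"
    unfolding RP using PG.m_inv_consistent[OF sub] inv by simp
qed

lemma (in group) inv_mult_cancel:
  assumes "x \<in> carrier G" "a \<in> carrier G" "b \<in> carrier G"
  shows "inv (inv x \<otimes> a) \<otimes> (inv x \<otimes> b) = inv a \<otimes> b"
proof -
  have "x \<otimes> (inv x \<otimes> b) = b" using assms by (simp add: m_assoc[symmetric])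
  then show ?thesis using assms by (simp add: inv_mult_group m_assoc)
qed

section \<open>Finite ideles and integral adeles as algebraic structures\<close>

context imaginary_quadratic begin

abbreviation primes :: "'k set set" where "primes \<equiv> maximal_ideals"
abbreviation lf :: "'k set \<Rightarrow> (nat \<Rightarrow> 'k) set ring" where "lf \<equiv> local_field"
abbreviation li :: "'k set \<Rightarrow> (nat \<Rightarrow> 'k) set ring" where "li \<equiv> local_integers"
abbreviation FI :: "('k set \<Rightarrow> (nat \<Rightarrow> 'k) set) monoid" where "FI \<equiv> finite_ideles"
abbreviation IA :: "('k set \<Rightarrow> (nat \<Rightarrow> 'k) set) ring" where "IA \<equiv> integral_adeles"
abbreviation V :: "('k set \<Rightarrow> (nat \<Rightarrow> 'k) set) set" where "V \<equiv> Units integral_adeles"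
abbreviation MM :: "'k set \<Rightarrow> nat \<Rightarrow> (nat \<Rightarrow> 'k) set set" where "MM \<equiv> local_dvr.M"
abbreviation UU :: "'k set \<Rightarrow> nat \<Rightarrow> (nat \<Rightarrow> 'k) set set" where "UU \<equiv> local_dvr.U1"

definition unif :: "'k set \<Rightarrow> 'k" where
  "unif P = (SOME \<pi>. \<pi> \<in> P \<and> local_dvr P (localization P) \<pi>)"

lemma unif: assumes "P \<in> primes" shows "unif P \<in> P" and dvr: "local_dvr P (localization P) (unif P)"
proof -
  have "\<exists>\<pi>. \<pi> \<in> P \<and> local_dvr P (localization P) \<pi>"
    using local_dvr_localization[OF assms] by blast
  then have "unif P \<in> P \<and> local_dvr P (localization P) (unif P)" unfolding unif_def by (rule someI_ex)
  then show "unif P \<in> P" "local_dvr P (localization P) (unif P)" by blast+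
qed

text \<open>The ideal generated by 2 is proper because 1/2 is not integral. At least one place must
  exist for the diagonal embedding to be injective.\<close>

lemma primes_nonempty: "primes \<noteq> {}"
proof -
  define I where "I = {2 * r | r :: 'k. algebraic_int r}"
  have II: "2 * r \<in> I" if "algebraic_int r" for r :: 'k using that by (auto simp: I_def)
  have "ideal I ring_of_integers"
  proof (rule ideal_integersI)
    have "algebraic_int (2::'k)" using algebraic_int_closed(5)[of 2] by simp
    then show "I \<subseteq> ints" using algebraic_int_closed by (auto simp: I_def)
    show "0 \<in> I" using II[of 0] by simp
    fix x assume "x \<in> I"
    then obtain r where r: "x = 2 * r" "algebraic_int r" by (auto simp: I_def)
    show "s * x \<in> I" if "algebraic_int s" for s
      using II[of "s * r"] r that algebraic_int_closed by (simp add: mult.left_commute)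
    fix y assume "y \<in> I"
    then obtain s where "y = 2 * s" "algebraic_int s" by (auto simp: I_def)
    then show "x + y \<in> I" using II[of "r + s"] r algebraic_int_closed by (simp add: distrib_left)
  qed
  moreover have "2 \<in> I" using II[of 1] by simp
  moreover have "1 \<notin> I"
  proof
    assume "1 \<in> I"
    then obtain r :: 'k where r: "1 = 2 * r" "algebraic_int r" by (auto simp: I_def)
    then have "r = of_rat (1 / 2)" by (simp add: of_rat_divide field_simps)
    then have "(1/2::rat) \<in> \<int>" using r algebraic_int_of_rat by metis
    then obtain n where "(1/2::rat) = of_int n" by (elim Ints_cases)
    then have "of_int 1 = (of_int (2 * n) :: rat)" by simp
    then have "1 = 2 * n" by (metis of_int_eq_iff)
    then show False by presburger
  qed
  ultimately show ?thesis using ideal_in_maximal_ideal[of I 2] by auto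
qed

lemma local_unit_groups:
  assumes "P \<in> primes"
  shows comm_group_local_units: "comm_group (units_of (lf P))"
    and subgroup_integral_units: "subgroup (Units (li P)) (units_of (lf P))"
    and inv_local_units: "x \<in> Units (lf P) \<Longrightarrow> inv\<^bsub>units_of (lf P)\<^esub> x = inv\<^bsub>lf P\<^esub> x"
proof -
  interpret D: local_dvr P "localization P" "unif P" by (rule dvr[OF assms])
  show "comm_group (units_of (lf P))" by (rule D.K.units_comm_group)
  then interpret G: comm_group "units_of (lf P)" .
  show inv: "inv\<^bsub>units_of (lf P)\<^esub> x = inv\<^bsub>lf P\<^esub> x" if "x \<in> Units (lf P)" for x
    using that by (rule D.K.units_of_inv)
  interpret O: cring "li P" by (rule D.cring_local_integers)
  show "subgroup (Units (li P)) (units_of (lf P))"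
  proof (rule G.subgroupI)
    show "Units (li P) \<subseteq> carrier (units_of (lf P))"
      by (auto simp: D.Units_local_integers units_of_carrier)
    show "Units (li P) \<noteq> {}" using O.Units_one_closed by blast
    fix x assume x: "x \<in> Units (li P)"
    then have "x \<in> Units (lf P)" by (simp add: D.Units_local_integers)
    then show "inv\<^bsub>units_of (lf P)\<^esub> x \<in> Units (li P)"
      using x inv by (simp add: D.Units_local_integers)
    fix y assume "y \<in> Units (li P)"
    then show "x \<otimes>\<^bsub>units_of (lf P)\<^esub> y \<in> Units (li P)"
      using O.Units_m_closed[OF x] by (simp add: units_of_mult)
  qed
qed

lemma X_eq: "FI = restricted_product primes (\<lambda>P. units_of (lf P)) (\<lambda>P. Units (li P))"
  by (simp add: finite_ideles_def)

sublocale FI: comm_group FI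
  unfolding X_eq by (rule restricted_product_comm_group(1)) (use local_unit_groups in auto)

lemma X_carrier: "x \<in> carrier FI \<longleftrightarrow>
    x \<in> (\<Pi>\<^sub>E P\<in>primes. Units (lf P)) \<and> finite {P \<in> primes. x P \<notin> Units (li P)}"
  by (simp add: X_eq restricted_product_def units_of_carrier)

lemma X_mult [simp]: "x \<otimes>\<^bsub>FI\<^esub> y = (\<lambda>P\<in>primes. x P \<otimes>\<^bsub>lf P\<^esub> y P)"
  by (simp add: X_eq restricted_product_def units_of_mult)

lemma X_one [simp]: "\<one>\<^bsub>FI\<^esub> = (\<lambda>P\<in>primes. \<one>\<^bsub>lf P\<^esub>)"
  by (simp add: X_eq restricted_product_def units_of_one)

lemma X_inv: "x \<in> carrier FI \<Longrightarrow> inv\<^bsub>FI\<^esub> x = (\<lambda>P\<in>primes. inv\<^bsub>lf P\<^esub> x P)"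
proof -
  assume x: "x \<in> carrier FI"
  then have "inv\<^bsub>FI\<^esub> x = (\<lambda>P\<in>primes. inv\<^bsub>units_of (lf P)\<^esub> x P)"
    unfolding X_eq by (intro restricted_product_comm_group(2)) (use local_unit_groups in auto)
  also have "\<dots> = (\<lambda>P\<in>primes. inv\<^bsub>lf P\<^esub> x P)"
    using x inv_local_units by (intro restrict_ext) (auto simp: X_carrier)
  finally show ?thesis .
qed

lemma X_Units: "x \<in> carrier FI \<Longrightarrow> P \<in> primes \<Longrightarrow> x P \<in> Units (lf P)"
  by (auto simp: X_carrier)

lemma IA_simps:
  "carrier IA = (\<Pi>\<^sub>E P\<in>primes. carrier (li P))"
  "x \<otimes>\<^bsub>IA\<^esub> y = (\<lambda>P\<in>primes. x P \<otimes>\<^bsub>li P\<^esub> y P)" "x \<oplus>\<^bsub>IA\<^esub> y = (\<lambda>P\<in>primes. x P \<oplus>\<^bsub>li P\<^esub> y P)"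
  "\<one>\<^bsub>IA\<^esub> = (\<lambda>P\<in>primes. \<one>\<^bsub>li P\<^esub>)" "\<zero>\<^bsub>IA\<^esub> = (\<lambda>P\<in>primes. \<zero>\<^bsub>li P\<^esub>)"
  by (simp_all add: integral_adeles_def)

lemma li_mult [simp]: "x \<otimes>\<^bsub>li P\<^esub> y = x \<otimes>\<^bsub>lf P\<^esub> y" "\<one>\<^bsub>li P\<^esub> = \<one>\<^bsub>lf P\<^esub>"
    "x \<oplus>\<^bsub>li P\<^esub> y = x \<oplus>\<^bsub>lf P\<^esub> y" "\<zero>\<^bsub>li P\<^esub> = \<zero>\<^bsub>lf P\<^esub>"
  by (simp_all add: local_integers_def)

lemma cring_li: "P \<in> primes \<Longrightarrow> cring (li P)"
  using local_dvr.cring_local_integers[OF dvr] .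

lemma cring_IA: "cring IA"
proof (rule cringI)
  note [simp del] = li_mult
  have ring: "ring (li P)" and cm: "comm_monoid (li P)" if "P \<in> primes" for P
    using cring_li[OF that] by (simp_all add: cring_def)
  show "abelian_group IA"
  proof (rule abelian_groupI)
    fix x assume x: "x \<in> carrier IA"
    show "\<exists>y\<in>carrier IA. y \<oplus>\<^bsub>IA\<^esub> x = \<zero>\<^bsub>IA\<^esub>"
      by (rule bexI[of _ "\<lambda>P\<in>primes. \<ominus>\<^bsub>li P\<^esub> x P"])
        (use x ring in \<open>auto simp: IA_simps PiE_iff abelian_group.l_neg ring.is_abelian_group
            abelian_group.a_inv_closed intro!: restrict_ext\<close>)
  next
    fix x y z assume "x \<in> carrier IA" "y \<in> carrier IA" "z \<in> carrier IA"
    then show "x \<oplus>\<^bsub>IA\<^esub> y \<oplus>\<^bsub>IA\<^esub> z = x \<oplus>\<^bsub>IA\<^esub> (y \<oplus>\<^bsub>IA\<^esub> z)" "x \<oplus>\<^bsub>IA\<^esub> y = y \<oplus>\<^bsub>IA\<^esub> x"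
      using ring by (auto simp: IA_simps PiE_iff abelian_monoid.a_assoc abelian_monoid.a_comm
        abelian_group.axioms(1) ring.is_abelian_group intro!: restrict_ext)
  next
    fix x y assume "x \<in> carrier IA" "y \<in> carrier IA"
    then show "x \<oplus>\<^bsub>IA\<^esub> y \<in> carrier IA"
      using ring by (auto simp: IA_simps PiE_iff abelian_monoid.a_closed
        abelian_group.axioms(1) ring.is_abelian_group)
  next
    fix x assume x: "x \<in> carrier IA"
    then show "\<zero>\<^bsub>IA\<^esub> \<oplus>\<^bsub>IA\<^esub> x = x"
      using ring by (auto simp: IA_simps PiE_iff abelian_monoid.l_zero extensional_restrict
        abelian_group.axioms(1) ring.is_abelian_group fun_eq_iff extensional_def)
  next
    show "\<zero>\<^bsub>IA\<^esub> \<in> carrier IA"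
      using ring by (auto simp: IA_simps PiE_iff abelian_monoid.zero_closed
        abelian_group.axioms(1) ring.is_abelian_group)
  qed
  have m: "monoid (li P)" if "P \<in> primes" for P using cm[OF that] by (simp add: comm_monoid_def)
  show "comm_monoid IA"
  proof (rule comm_monoidI)
    fix x y z assume "x \<in> carrier IA" "y \<in> carrier IA" "z \<in> carrier IA"
    then show "x \<otimes>\<^bsub>IA\<^esub> y \<otimes>\<^bsub>IA\<^esub> z = x \<otimes>\<^bsub>IA\<^esub> (y \<otimes>\<^bsub>IA\<^esub> z)" "x \<otimes>\<^bsub>IA\<^esub> y = y \<otimes>\<^bsub>IA\<^esub> x"
      using cm m by (auto simp: IA_simps PiE_iff monoid.m_assoc comm_monoid.m_comm intro!: restrict_ext)
  next
    fix x y assume "x \<in> carrier IA" "y \<in> carrier IA"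
    then show "x \<otimes>\<^bsub>IA\<^esub> y \<in> carrier IA" using m by (auto simp: IA_simps PiE_iff monoid.m_closed)
  next
    fix x assume "x \<in> carrier IA"
    then show "\<one>\<^bsub>IA\<^esub> \<otimes>\<^bsub>IA\<^esub> x = x" using m
      by (auto simp: IA_simps PiE_iff monoid.l_one fun_eq_iff extensional_def)
  next
    show "\<one>\<^bsub>IA\<^esub> \<in> carrier IA" using m by (auto simp: IA_simps PiE_iff monoid.one_closed)
  qed
  fix x y z assume "x \<in> carrier IA" "y \<in> carrier IA" "z \<in> carrier IA"
  then show "(x \<oplus>\<^bsub>IA\<^esub> y) \<otimes>\<^bsub>IA\<^esub> z = x \<otimes>\<^bsub>IA\<^esub> z \<oplus>\<^bsub>IA\<^esub> y \<otimes>\<^bsub>IA\<^esub> z"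
    unfolding IA_simps
  proof (intro restrict_ext)
    fix P assume P: "P \<in> primes" and *: "x \<in> (\<Pi>\<^sub>E P\<in>primes. carrier (li P))"
      "y \<in> (\<Pi>\<^sub>E P\<in>primes. carrier (li P))" "z \<in> (\<Pi>\<^sub>E P\<in>primes. carrier (li P))"
    interpret R: cring "li P" by (rule cring_li[OF P])
    show "(\<lambda>P\<in>primes. x P \<oplus>\<^bsub>li P\<^esub> y P) P \<otimes>\<^bsub>li P\<^esub> z P =
        (\<lambda>P\<in>primes. x P \<otimes>\<^bsub>li P\<^esub> z P) P \<oplus>\<^bsub>li P\<^esub> (\<lambda>P\<in>primes. y P \<otimes>\<^bsub>li P\<^esub> z P) P"
      using R.l_distr[of "x P" "y P" "z P"] * P by (simp add: PiE_iff)
  qed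
qed

sublocale IA: cring IA by (rule cring_IA)

lemma V_eq: "V = (\<Pi>\<^sub>E P\<in>primes. Units (li P))"
proof
  show "V \<subseteq> (\<Pi>\<^sub>E P\<in>primes. Units (li P))"
  proof
    fix u assume u: "u \<in> V"
    then obtain v where v: "v \<in> carrier IA" "v \<otimes>\<^bsub>IA\<^esub> u = \<one>\<^bsub>IA\<^esub>" "u \<otimes>\<^bsub>IA\<^esub> v = \<one>\<^bsub>IA\<^esub>"
      by (auto simp: Units_def)
    have uc: "u \<in> carrier IA" using u by (rule IA.Units_closed)
    have "u P \<in> Units (li P)" if P: "P \<in> primes" for P
    proof -
      have "u P \<in> carrier (li P)" "v P \<in> carrier (li P)" using uc v(1) P by (auto simp: IA_simps)
      moreover have "v P \<otimes>\<^bsub>li P\<^esub> u P = \<one>\<^bsub>li P\<^esub>" "u P \<otimes>\<^bsub>li P\<^esub> v P = \<one>\<^bsub>li P\<^esub>"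
        using fun_cong[OF v(2), of P] fun_cong[OF v(3), of P] P by (simp_all add: IA_simps)
      ultimately show ?thesis unfolding Units_def by blast
    qed
    then show "u \<in> (\<Pi>\<^sub>E P\<in>primes. Units (li P))" using uc by (auto simp: IA_simps PiE_iff)
  qed
  show "(\<Pi>\<^sub>E P\<in>primes. Units (li P)) \<subseteq> V"
  proof
    fix u assume u: "u \<in> (\<Pi>\<^sub>E P\<in>primes. Units (li P))"
    have m: "monoid (li P)" if "P \<in> primes" for P
      using cring_li[OF that] by (simp add: cring_def comm_monoid_def)
    define v where "v = (\<lambda>P\<in>primes. inv\<^bsub>li P\<^esub> u P)"
    have uc: "u \<in> carrier IA" using u m monoid.Units_closed by (fastforce simp: IA_simps PiE_iff)
    have vc: "v \<in> carrier IA" using u m monoid.Units_inv_closed by (fastforce simp: IA_simps PiE_iff v_def)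
    have "v \<otimes>\<^bsub>IA\<^esub> u = \<one>\<^bsub>IA\<^esub>"
      unfolding IA_simps v_def using u m monoid.Units_l_inv by (fastforce intro!: restrict_ext simp del: li_mult)
    moreover have "u \<otimes>\<^bsub>IA\<^esub> v = \<one>\<^bsub>IA\<^esub>" using calculation IA.m_comm[OF uc vc] by metis
    ultimately show "u \<in> V" using uc vc unfolding Units_def by blast
  qed
qed

lemma V_X: "V \<subseteq> carrier FI"
proof
  fix u assume u: "u \<in> V"
  then have U: "u P \<in> Units (li P)" if "P \<in> primes" for P using that by (auto simp: V_eq)
  then have "{P \<in> primes. u P \<notin> Units (li P)} = {}" by blast
  moreover have "u P \<in> Units (lf P)" if P: "P \<in> primes" for P
    using U[OF P] subgroup.subset[OF subgroup_integral_units[OF P]] by (auto simp: units_of_carrier)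
  moreover have "finite {P \<in> primes. u P \<notin> Units (li P)}"
    unfolding calculation(1) by (rule finite.emptyI)
  ultimately show "u \<in> carrier FI" using u by (simp add: X_carrier V_eq PiE_iff)
qed

lemma V_mult: "x \<otimes>\<^bsub>IA\<^esub> y = x \<otimes>\<^bsub>FI\<^esub> y" by (simp add: IA_simps)
lemma V_one: "\<one>\<^bsub>IA\<^esub> = \<one>\<^bsub>FI\<^esub>" by (simp add: IA_simps)

lemma V_inv: "u \<in> V \<Longrightarrow> inv\<^bsub>IA\<^esub> u = inv\<^bsub>FI\<^esub> u"
proof -
  assume u: "u \<in> V"
  then have "inv\<^bsub>IA\<^esub> u \<in> V" "inv\<^bsub>IA\<^esub> u \<otimes>\<^bsub>IA\<^esub> u = \<one>\<^bsub>IA\<^esub>" by simp_all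
  moreover from this have "u \<in> carrier FI" "inv\<^bsub>IA\<^esub> u \<in> carrier FI" using u V_X by blast+
  ultimately show ?thesis using FI.inv_equality[of "inv\<^bsub>IA\<^esub> u" u] unfolding V_mult V_one by simp
qed

lemma V_subgroup: "subgroup V FI"
proof (rule FI.subgroupI)
  show "V \<subseteq> carrier FI" by (rule V_X)
  show "V \<noteq> {}" using IA.Units_one_closed by blast
  show "inv\<^bsub>FI\<^esub> u \<in> V" if "u \<in> V" for u using IA.Units_inv_Units[OF that] unfolding V_inv[OF that] .
  show "u \<otimes>\<^bsub>FI\<^esub> v \<in> V" if "u \<in> V" "v \<in> V" for u v
    using IA.Units_m_closed[OF that] unfolding V_mult .
qed

text \<open>The congruence subgroups of the integral units: congruent to 1 modulo P^n at the places
  P in \<open>F\<close>. With \<open>level F n\<close> they form the basis of neighbourhoods of 1 in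
  which every continuity argument below is phrased.\<close>

definition W :: "'k set set \<Rightarrow> nat \<Rightarrow> ('k set \<Rightarrow> (nat \<Rightarrow> 'k) set) set" where
  "W F n = {w \<in> V. \<forall>P\<in>F. w P \<in> UU P n}"

definition level :: "'k set set \<Rightarrow> nat \<Rightarrow> bool" where
  "level F n \<longleftrightarrow> finite F \<and> F \<subseteq> primes \<and> n \<ge> 1"

lemma W_V: "W F n \<subseteq> V" by (auto simp: W_def)

lemma W_X: "w \<in> W F n \<Longrightarrow> w \<in> carrier FI" using W_V V_X by blast

lemma W_antimono: assumes "F \<subseteq> primes" "F' \<subseteq> F" "n' \<le> n" shows "W F n \<subseteq> W F' n'"
proof
  fix w assume w: "w \<in> W F n"
  have "w P \<in> UU P n'" if P: "P \<in> F'" for P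
  proof -
    have "P \<in> F" "P \<in> primes" using P assms by auto
    then show ?thesis using w local_dvr.U1_antimono[OF dvr assms(3), of P] by (auto simp: W_def)
  qed
  then show "w \<in> W F' n'" using w by (simp add: W_def)
qed

lemma level_Un: "level F n \<Longrightarrow> level F' n' \<Longrightarrow> level (F \<union> F') (max n n')"
  by (auto simp: level_def)

lemma W_subgroup: assumes "level F n" shows "subgroup (W F n) FI"
proof (rule FI.subgroupI)
  have F: "F \<subseteq> primes" "n \<ge> 1" using assms by (auto simp: level_def)
  show "W F n \<subseteq> carrier FI" using W_X by blast
  have "\<one>\<^bsub>FI\<^esub> P \<in> UU P n" if "P \<in> F" for P
  proof -
    have P: "P \<in> primes" using that F(1) by blast
    then show ?thesis using local_dvr.U1_one[OF dvr[OF P]] by simp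
  qed
  then have "\<one>\<^bsub>FI\<^esub> \<in> W F n" unfolding W_def
    using subgroup.one_closed[OF V_subgroup] by blast
  then show "W F n \<noteq> {}" by blast
  show "inv\<^bsub>FI\<^esub> u \<in> W F n" if "u \<in> W F n" for u
    unfolding W_def
  proof (intro CollectI conjI ballI)
    show "inv\<^bsub>FI\<^esub> u \<in> V" using that subgroup.m_inv_closed[OF V_subgroup] W_V by blast
    fix P assume P: "P \<in> F"
    then have "(inv\<^bsub>FI\<^esub> u) P = inv\<^bsub>lf P\<^esub> (u P)" using X_inv[OF W_X[OF that]] F by auto
    then show "(inv\<^bsub>FI\<^esub> u) P \<in> UU P n" using local_dvr.U1_units(4)[OF dvr F(2)] P F that by (auto simp: W_def)
  qed
  show "u \<otimes>\<^bsub>FI\<^esub> v \<in> W F n" if "u \<in> W F n" "v \<in> W F n" for u v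
    unfolding W_def
  proof (intro CollectI conjI ballI)
    show "u \<otimes>\<^bsub>FI\<^esub> v \<in> V" using that subgroup.m_closed[OF V_subgroup] W_V by blast
    fix P assume P: "P \<in> F"
    then have "(u \<otimes>\<^bsub>FI\<^esub> v) P = u P \<otimes>\<^bsub>lf P\<^esub> v P" using F by auto
    then show "(u \<otimes>\<^bsub>FI\<^esub> v) P \<in> UU P n" using local_dvr.U1_mult[OF dvr] P F that by (auto simp: W_def)
  qed
qed

lemma V_W: "V = W {} 1" "level {} 1" by (auto simp: W_def level_def)

section \<open>The topology of the finite ideles\<close>

lemma openin_local_units:
  "P \<in> primes \<Longrightarrow> openin (local_units_topology P) U \<longleftrightarrow>
    U \<subseteq> Units (lf P) \<and> (\<forall>A\<in>U. \<exists>n\<ge>1. \<forall>W\<in>UU P n. A \<otimes>\<^bsub>lf P\<^esub> W \<in> U)"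
  using local_dvr.openin_local_units_topology[OF dvr] .

text \<open>Both choices of \<open>A\<close> are closed under multiplication and contain all
  principal units of some level, so every point of the coset has a neighbourhood inside it.\<close>

lemma openin_coset:
  assumes P: "P \<in> primes" and x: "x \<in> Units (lf P)" and n: "n \<ge> 1" and A: "A = UU P n \<or> A = Units (li P)"
  shows "openin (local_units_topology P) ((\<otimes>\<^bsub>lf P\<^esub>) x ` A)"
proof -
  interpret D: local_dvr P "localization P" "unif P" by (rule dvr[OF P])
  interpret O: cring "li P" by (rule D.cring_local_integers)
  have AU: "A \<subseteq> Units (lf P)" using A D.U1_units(1)[OF n] D.Units_local_integers by auto
  have "\<exists>n\<ge>1. \<forall>W\<in>UU P n. B \<otimes>\<^bsub>lf P\<^esub> W \<in> A" if B: "B \<in> A" for B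
  proof (cases "A = UU P n")
    case True
    then show ?thesis using D.U1_mult B n by blast
  next
    case False
    then have "A = Units (li P)" using A by blast
    moreover have "UU P 1 \<subseteq> Units (li P)" using D.U1_units[of 1] D.Units_local_integers by blast
    ultimately show ?thesis using B O.Units_m_closed[of B] by (metis li_mult(1) order_refl subsetD)
  qed note step = this
  show ?thesis unfolding openin_local_units[OF P]
  proof (intro conjI ballI)
    show "(\<otimes>\<^bsub>lf P\<^esub>) x ` A \<subseteq> Units (lf P)" using x AU D.K.Units_m_closed by blast
    fix C assume "C \<in> (\<otimes>\<^bsub>lf P\<^esub>) x ` A"
    then obtain B where B: "B \<in> A" "C = x \<otimes>\<^bsub>lf P\<^esub> B" by blast
    obtain m where m: "m \<ge> 1" "\<And>W. W \<in> UU P m \<Longrightarrow> B \<otimes>\<^bsub>lf P\<^esub> W \<in> A" using step[OF B(1)] by blast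
    have "C \<otimes>\<^bsub>lf P\<^esub> W \<in> (\<otimes>\<^bsub>lf P\<^esub>) x ` A" if W: "W \<in> UU P m" for W
    proof -
      have "C \<otimes>\<^bsub>lf P\<^esub> W = x \<otimes>\<^bsub>lf P\<^esub> (B \<otimes>\<^bsub>lf P\<^esub> W)"
        unfolding B(2) using x AU B(1) D.U1_units(1)[OF m(1) W] D.K.Units_closed D.K.m_assoc by blast
      then show ?thesis using m(2)[OF W] by blast
    qed
    then show "\<exists>n\<ge>1. \<forall>W\<in>UU P n. C \<otimes>\<^bsub>lf P\<^esub> W \<in> (\<otimes>\<^bsub>lf P\<^esub>) x ` A" using m(1) by blast
  qed
qed

text \<open>The topology is defined by generating boxes; this describes it as a group topology. One
  direction: the described sets form a topology containing all boxes, and the generated topology is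
  the coarsest such. The other: a coset of \<open>W F n\<close> is itself a box.\<close>

lemma openin_finite_ideles:
  "openin finite_ideles_topology U \<longleftrightarrow>
    U \<subseteq> carrier FI \<and> (\<forall>x\<in>U. \<exists>F n. level F n \<and> (\<forall>w\<in>W F n. x \<otimes>\<^bsub>FI\<^esub> w \<in> U))"
proof -
  define Q where "Q = (\<lambda>U. U \<subseteq> carrier FI \<and> (\<forall>x\<in>U. \<exists>F n. level F n \<and> (\<forall>w\<in>W F n. x \<otimes>\<^bsub>FI\<^esub> w \<in> U)))"
  define \<B> where "\<B> = {(\<Pi>\<^sub>E i\<in>primes. U i) | U.
    (\<forall>i\<in>primes. openin (local_units_topology i) (U i)) \<and> finite {i \<in> primes. U i \<noteq> Units (li i)}}"
  have top: "finite_ideles_topology = topology_generated_by \<B>"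
    by (simp add: finite_ideles_topology_def restricted_product_topology_def \<B>_def)
  have "istopology Q" unfolding istopology_def
  proof (intro conjI allI impI)
    fix S T assume S: "Q S" and T: "Q T"
    have "\<exists>F n. level F n \<and> (\<forall>w\<in>W F n. x \<otimes>\<^bsub>FI\<^esub> w \<in> S \<inter> T)" if x: "x \<in> S \<inter> T" for x
    proof -
      obtain F n F' n' where F: "level F n" "\<And>w. w \<in> W F n \<Longrightarrow> x \<otimes>\<^bsub>FI\<^esub> w \<in> S"
        and F': "level F' n'" "\<And>w. w \<in> W F' n' \<Longrightarrow> x \<otimes>\<^bsub>FI\<^esub> w \<in> T"
        using S T x unfolding Q_def by blast
      have "W (F \<union> F') (max n n') \<subseteq> W F n" "W (F \<union> F') (max n n') \<subseteq> W F' n'"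
        using F(1) F'(1) by (simp_all add: level_def W_antimono)
      then show ?thesis using level_Un[OF F(1) F'(1)] F(2) F'(2) by (meson IntI subsetD)
    qed
    then show "Q (S \<inter> T)" using S T unfolding Q_def by blast
  next
    fix \<K> assume "\<forall>S\<in>\<K>. Q S"
    then show "Q (\<Union>\<K>)" unfolding Q_def by (meson Sup_le_iff UnionE UnionI)
  qed
  moreover have "Q B" if "B \<in> \<B>" for B
  proof -
    obtain Ui where B: "B = (\<Pi>\<^sub>E i\<in>primes. Ui i)" and o: "\<And>i. i \<in> primes \<Longrightarrow> openin (local_units_topology i) (Ui i)"
      and fin: "finite {i \<in> primes. Ui i \<noteq> Units (li i)}" using \<open>B \<in> \<B>\<close> unfolding \<B>_def by blast
    define E where "E = {i \<in> primes. Ui i \<noteq> Units (li i)}"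
    have E: "finite E" "E \<subseteq> primes" using fin by (auto simp: E_def)
    have Bc: "B \<subseteq> carrier FI"
    proof
      fix x assume x: "x \<in> B"
      have "{P \<in> primes. x P \<notin> Units (li P)} \<subseteq> E" using x B by (auto simp: E_def PiE_iff)
      moreover have "x P \<in> Units (lf P)" if P: "P \<in> primes" for P
        using x B o[OF P] P unfolding openin_local_units[OF P] by (auto simp: PiE_iff)
      ultimately show "x \<in> carrier FI" using E(1) x finite_subset by (auto simp: X_carrier B PiE_iff)
    qed
    have "\<exists>F n. level F n \<and> (\<forall>w\<in>W F n. x \<otimes>\<^bsub>FI\<^esub> w \<in> B)" if x: "x \<in> B" for x
    proof -
      have "\<forall>P\<in>E. \<exists>n\<ge>1. \<forall>w\<in>UU P n. x P \<otimes>\<^bsub>lf P\<^esub> w \<in> Ui P"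
        using x o E(2) openin_local_units unfolding B by (meson PiE_mem subsetD)
      then obtain nn where nn: "\<And>P. P \<in> E \<Longrightarrow> nn P \<ge> (1::nat) \<and> (\<forall>w\<in>UU P (nn P). x P \<otimes>\<^bsub>lf P\<^esub> w \<in> Ui P)"
        by metis
      \<comment> \<open>One exponent for all places where the box is not the group of local units.
        Inserting 1 covers an empty set of such places and guarantees the lower bound demanded by
        \<open>level\<close>.\<close>
      define n where "n = Max (insert 1 (nn ` E))"
      have n1: "n \<ge> 1" "\<And>P. P \<in> E \<Longrightarrow> nn P \<le> n" unfolding n_def using E(1) by (auto intro: Max_ge)
      have "x \<otimes>\<^bsub>FI\<^esub> w \<in> B" if w: "w \<in> W E n" for w
        unfolding B
      proof (rule PiE_I)
        fix P assume P: "P \<in> primes"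
        show "(x \<otimes>\<^bsub>FI\<^esub> w) P \<in> Ui P"
        proof (cases "P \<in> E")
          case True
          then have "w P \<in> UU P (nn P)" using w n1(2)[OF True] local_dvr.U1_antimono[OF dvr[OF P]] by (auto simp: W_def)
          then show ?thesis using nn[OF True] P by simp
        next
          case False
          then have Ui: "Ui P = Units (li P)" using P by (auto simp: E_def)
          have "x P \<in> Units (li P)" "w P \<in> Units (li P)" using x w P Ui unfolding B W_def V_eq by (auto simp: PiE_iff)
          then have "x P \<otimes>\<^bsub>units_of (lf P)\<^esub> w P \<in> Units (li P)"
            using subgroup.m_closed[OF subgroup_integral_units[OF P]] by blast
          then show ?thesis using P Ui by (simp add: units_of_mult)
        qed
      qed simp
      moreover have "level E n" using E n1 by (simp add: level_def)
      ultimately show ?thesis by blast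
    qed
    then show "Q B" using Bc unfolding Q_def by blast
  qed
  ultimately have 1: "Q U" if "openin finite_ideles_topology U" for U
    using generate_topology_on_coarsest[of Q \<B> U] that unfolding top openin_topology_generated_by_iff by blast
  have 2: "openin finite_ideles_topology U" if U: "Q U" for U
  proof (subst openin_subopen, intro ballI)
    fix x assume x: "x \<in> U"
    then have xc: "x \<in> carrier FI" using U by (auto simp: Q_def)
    obtain F n where F: "level F n" "\<And>w. w \<in> W F n \<Longrightarrow> x \<otimes>\<^bsub>FI\<^esub> w \<in> U" using U x unfolding Q_def by blast
    then have F': "finite F" "F \<subseteq> primes" "n \<ge> 1" by (auto simp: level_def)
    define A where "A = (\<lambda>P. if P \<in> F then UU P n else Units (li P))"
    \<comment> \<open>The coset of \<open>W F n\<close> through \<open>x\<close>, written as a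
      product over the places. Its factors differ from the local unit groups only at
      \<open>F\<close> and at the finitely many places where \<open>x\<close> is not a unit.\<close>
    define T where "T = (\<Pi>\<^sub>E P\<in>primes. (\<otimes>\<^bsub>lf P\<^esub>) (x P) ` A P)"
    have "T \<in> \<B>" unfolding \<B>_def T_def
    proof (intro CollectI exI[of _ "\<lambda>P. (\<otimes>\<^bsub>lf P\<^esub>) (x P) ` A P"] conjI refl ballI)
      fix P assume P: "P \<in> primes"
      show "openin (local_units_topology P) ((\<otimes>\<^bsub>lf P\<^esub>) (x P) ` A P)"
        by (rule openin_coset[OF P X_Units[OF xc P] F'(3)]) (simp add: A_def)
    next
      have "(\<otimes>\<^bsub>lf P\<^esub>) (x P) ` A P = Units (li P)" if P: "P \<in> primes" "P \<notin> F" "x P \<in> Units (li P)" for P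
      proof -
        interpret O: cring "li P" by (rule cring_li[OF P(1)])
        have "(\<otimes>\<^bsub>li P\<^esub>) (x P) ` Units (li P) = Units (li P)"
        proof
          show "(\<otimes>\<^bsub>li P\<^esub>) (x P) ` Units (li P) \<subseteq> Units (li P)" using P(3) O.Units_m_closed by blast
          show "Units (li P) \<subseteq> (\<otimes>\<^bsub>li P\<^esub>) (x P) ` Units (li P)"
          proof
            fix u assume u: "u \<in> Units (li P)"
            have "u = x P \<otimes>\<^bsub>li P\<^esub> (inv\<^bsub>li P\<^esub> (x P) \<otimes>\<^bsub>li P\<^esub> u)"
              using u P(3) O.Units_closed O.Units_inv_closed O.Units_r_inv by (simp add: O.m_assoc[symmetric] del: li_mult)
            then show "u \<in> (\<otimes>\<^bsub>li P\<^esub>) (x P) ` Units (li P)" using u P(3) O.Units_m_closed O.Units_inv_Units by blast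
          qed
        qed
        then show ?thesis using P by (simp add: A_def)
      qed
      then have "{P \<in> primes. (\<otimes>\<^bsub>lf P\<^esub>) (x P) ` A P \<noteq> Units (li P)} \<subseteq> F \<union> {P \<in> primes. x P \<notin> Units (li P)}" by blast
      then show "finite {P \<in> primes. (\<otimes>\<^bsub>lf P\<^esub>) (x P) ` A P \<noteq> Units (li P)}"
        by (rule finite_subset) (use F'(1) xc in \<open>simp add: X_carrier\<close>)
    qed
    then have "openin finite_ideles_topology T" unfolding top by (rule topology_generated_by_Basis)
    moreover have "x \<in> T"
    proof -
      have "x P \<in> (\<otimes>\<^bsub>lf P\<^esub>) (x P) ` A P" if P: "P \<in> primes" for P
      proof (rule image_eqI[of _ _ "\<one>\<^bsub>lf P\<^esub>"])
        interpret D: local_dvr P "localization P" "unif P" by (rule dvr[OF P])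
        interpret O: cring "li P" by (rule cring_li[OF P])
        show "x P = x P \<otimes>\<^bsub>lf P\<^esub> \<one>\<^bsub>lf P\<^esub>" using X_Units[OF xc P] D.K.Units_closed by simp
        show "\<one>\<^bsub>lf P\<^esub> \<in> A P" using D.U1_one O.Units_one_closed by (simp add: A_def)
      qed
      then show ?thesis using xc by (auto simp: T_def X_carrier PiE_iff)
    qed
    moreover have "T \<subseteq> U"
    proof
      fix y assume y: "y \<in> T"
      then have "\<forall>P\<in>primes. \<exists>w. w \<in> A P \<and> y P = x P \<otimes>\<^bsub>lf P\<^esub> w" by (auto simp: T_def PiE_iff)
      then obtain w where w: "\<And>P. P \<in> primes \<Longrightarrow> w P \<in> A P \<and> y P = x P \<otimes>\<^bsub>lf P\<^esub> w P" by metis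
      have "restrict w primes \<in> W F n"
        unfolding W_def V_eq
      proof (intro CollectI conjI ballI restrict_PiE_iff[THEN iffD2])
        fix P assume P: "P \<in> primes"
        show "w P \<in> Units (li P)"
        proof (cases "P \<in> F")
          case True
          interpret D: local_dvr P "localization P" "unif P" by (rule dvr[OF P])
          show ?thesis using w[OF P] True D.U1_units[OF F'(3)] by (simp add: A_def D.Units_local_integers)
        qed (use w[OF P] in \<open>simp add: A_def\<close>)
      next
        fix P assume "P \<in> F"
        then show "restrict w primes P \<in> UU P n" using w[of P] F'(2) by (auto simp: A_def)
      qed
      moreover have "y = x \<otimes>\<^bsub>FI\<^esub> restrict w primes"
        using y w by (auto simp: T_def fun_eq_iff PiE_iff extensional_def)
      ultimately show "y \<in> U" using F(2) by metis
    qed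
    ultimately show "\<exists>T. openin finite_ideles_topology T \<and> x \<in> T \<and> T \<subseteq> U" by blast
  qed
  show ?thesis using 1 2 unfolding Q_def by blast
qed

lemma topspace_finite_ideles [simp]: "topspace finite_ideles_topology = carrier FI"
proof
  show "topspace finite_ideles_topology \<subseteq> carrier FI"
    using openin_finite_ideles[of "topspace finite_ideles_topology"] by simp
  have "openin finite_ideles_topology (carrier FI)"
    unfolding openin_finite_ideles using V_W W_X FI.m_closed by blast
  then show "carrier FI \<subseteq> topspace finite_ideles_topology" by (rule openin_subset)
qed

section \<open>The diagonal image of K and its closedness\<close>

abbreviation diag :: "'k \<Rightarrow> 'k set \<Rightarrow> (nat \<Rightarrow> 'k) set" where "diag \<equiv> diagonal"

definition DK :: "('k set \<Rightarrow> (nat \<Rightarrow> 'k) set) set" where "DK = diag ` (UNIV - {0})"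

lemma diag_apply: "P \<in> primes \<Longrightarrow> diag x P = to_local_field P x"
  by (simp add: diagonal_def)

text \<open>A component fails to be a local unit only where \<open>x\<close> or its inverse is not
  locally integral, which happens at finitely many places.\<close>

lemma diag_carrier: assumes "x \<noteq> 0" shows "diag x \<in> carrier FI"
proof -
  have "{P \<in> primes. diag x P \<notin> Units (li P)} \<subseteq>
      {P \<in> primes. x \<notin> localization P} \<union> {P \<in> primes. inverse x \<notin> localization P}"
    using local_dvr.to_local_Units_integers[OF dvr assms] by (auto simp: diag_apply)
  then have "finite {P \<in> primes. diag x P \<notin> Units (li P)}"
    using localization_almost_all[of x] localization_almost_all[of "inverse x"] assms
    by (auto intro: finite_subset)
  moreover have "diag x P \<in> Units (lf P)" if "P \<in> primes" for P
    using local_dvr.to_local_Units[OF dvr[OF that] assms] that by (simp add: diag_apply)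
  moreover have "diag x \<in> extensional primes" by (simp add: diagonal_def)
  ultimately show ?thesis by (auto simp: X_carrier PiE_iff)
qed

lemma diag_mult: "diag (x * y) = diag x \<otimes>\<^bsub>FI\<^esub> diag y"
  unfolding X_mult diagonal_def
  by (intro restrict_ext) (simp add: local_dvr.to_local_field_hom(2)[OF dvr])

lemma diag_one: "diag 1 = \<one>\<^bsub>FI\<^esub>"
  unfolding X_one diagonal_def
  by (intro restrict_ext) (simp add: local_dvr.to_local_field_hom(5)[OF dvr])

lemma diag_inv: "x \<noteq> 0 \<Longrightarrow> inv\<^bsub>FI\<^esub> (diag x) = diag (inverse x)"
proof -
  assume x: "x \<noteq> 0"
  have "diag (inverse x) \<otimes>\<^bsub>FI\<^esub> diag x = \<one>\<^bsub>FI\<^esub>" using x diag_mult[of "inverse x" x] diag_one by simp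
  then show ?thesis using x diag_carrier[of x] diag_carrier[of "inverse x"] FI.inv_equality by simp
qed

lemma diag_inj: "diag x = diag y \<longleftrightarrow> x = y"
proof
  assume eq: "diag x = diag y"
  obtain P where P: "P \<in> primes" using primes_nonempty by blast
  have "to_local_field P x = to_local_field P y" using fun_cong[OF eq, of P] P by (simp add: diag_apply)
  then show "x = y" using local_dvr.to_local_eq_iff[OF dvr[OF P]] by simp
qed simp

lemma DK_subgroup: "subgroup DK FI"
proof (rule FI.subgroupI)
  show "DK \<subseteq> carrier FI" using diag_carrier by (auto simp: DK_def)
  have "diag 1 \<in> DK" unfolding DK_def by (rule imageI) simp
  then show "DK \<noteq> {}" by blast
  show "inv\<^bsub>FI\<^esub> a \<in> DK" if "a \<in> DK" for a using that diag_inv by (auto simp: DK_def)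
  show "a \<otimes>\<^bsub>FI\<^esub> b \<in> DK" if ab: "a \<in> DK" "b \<in> DK" for a b
  proof -
    obtain x y where "x \<noteq> 0" "y \<noteq> 0" "a = diag x" "b = diag y" using ab by (auto simp: DK_def)
    then have "a \<otimes>\<^bsub>FI\<^esub> b = diag (x * y)" "x * y \<noteq> 0" by (simp_all only: diag_mult mult_eq_0_iff simp_thms)
    then show ?thesis unfolding DK_def by blast
  qed
qed

text \<open>This is where \<open>K\<close> has to be imaginary: the ring of integers has finitely many units.\<close>
lemma finite_diag_V: "finite {k. k \<noteq> 0 \<and> diag k \<in> V}"
proof (rule finite_subset[OF _ finite_units], clarify)
  fix k :: 'k assume k: "k \<noteq> 0" "diag k \<in> V"
  have "k \<in> localization P" "inverse k \<in> localization P" if P: "P \<in> primes" for P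
    using local_dvr.to_local_Units_integers[OF dvr[OF P] k(1)] k(2) P by (auto simp: V_eq PiE_iff diag_apply)
  then show "algebraic_int k \<and> algebraic_int (inverse k)" using integral_if_locally_integral by blast
qed

text \<open>Only the elements of K^* in the coset of \<open>V\<close> through \<open>x\<close> can
  come close to \<open>x\<close>. They are finitely many, each differs from \<open>x\<close> at some
  place modulo some level, and the union of these places with the largest level excludes all of
  them.\<close>

lemma DK_closed:
  assumes x: "x \<in> carrier FI" "x \<notin> DK"
  shows "\<exists>F n. level F n \<and> (\<forall>w\<in>W F n. x \<otimes>\<^bsub>FI\<^esub> w \<notin> DK)"
proof -
  \<comment> \<open>The elements of K^* in the coset of \<open>V\<close> through \<open>x\<close>.
    Two of them differ by a factor whose diagonal image lies in \<open>V\<close>, so one element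
    \<open>k0\<close> bounds the set by the finite set of \<open>finite_diag_V\<close>.\<close>
  define S where "S = {k. k \<noteq> 0 \<and> inv\<^bsub>FI\<^esub> x \<otimes>\<^bsub>FI\<^esub> diag k \<in> V}"
  have "finite S"
  proof (cases "S = {}")
    case False
    then obtain k0 where k0: "k0 \<noteq> 0" "inv\<^bsub>FI\<^esub> x \<otimes>\<^bsub>FI\<^esub> diag k0 \<in> V" by (auto simp: S_def)
    have "S \<subseteq> (\<lambda>e. k0 * e) ` {k. k \<noteq> 0 \<and> diag k \<in> V}"
    proof
      fix k assume k: "k \<in> S"
      let ?a = "inv\<^bsub>FI\<^esub> x \<otimes>\<^bsub>FI\<^esub> diag k0" and ?b = "inv\<^bsub>FI\<^esub> x \<otimes>\<^bsub>FI\<^esub> diag k"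
      have k': "k \<noteq> 0" "?b \<in> V" using k by (auto simp: S_def simp del: X_mult)
      have c: "diag k0 \<in> carrier FI" "diag k \<in> carrier FI" "inv\<^bsub>FI\<^esub> x \<in> carrier FI"
        using diag_carrier k0 k' x by auto
      have "inv\<^bsub>FI\<^esub> ?a \<otimes>\<^bsub>FI\<^esub> ?b \<in> V"
        using subgroup.m_closed[OF V_subgroup subgroup.m_inv_closed[OF V_subgroup k0(2)] k'(2)] .
      moreover have "inv\<^bsub>FI\<^esub> ?a \<otimes>\<^bsub>FI\<^esub> ?b = inv\<^bsub>FI\<^esub> (diag k0) \<otimes>\<^bsub>FI\<^esub> diag k"
        by (rule FI.inv_mult_cancel[OF x(1) c(1,2)])
      moreover have "\<dots> = diag (inverse k0 * k)" using diag_inv[OF k0(1)] diag_mult by simp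
      ultimately have "inverse k0 * k \<in> {k. k \<noteq> 0 \<and> diag k \<in> V}" using k0 k' by simp
      then show "k \<in> (\<lambda>e. k0 * e) ` {k. k \<noteq> 0 \<and> diag k \<in> V}"
        by (rule image_eqI[rotated]) (use k0 in simp)
    qed
    then show ?thesis using finite_diag_V finite_surj by blast
  qed simp
  have "\<forall>k\<in>S. \<exists>P n. P \<in> primes \<and> n \<ge> 1 \<and> inv\<^bsub>lf P\<^esub> (x P) \<otimes>\<^bsub>lf P\<^esub> diag k P \<notin> UU P n"
  proof
    fix k assume "k \<in> S"
    then have k: "k \<noteq> 0" by (simp add: S_def)
    then have "x \<noteq> diag k" using x(2) by (auto simp: DK_def)
    moreover have "x \<in> extensional primes" "diag k \<in> extensional primes"
      using x(1) diag_carrier[OF k] by (auto simp: X_carrier PiE_iff)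
    ultimately obtain P where P: "P \<in> primes" "x P \<noteq> diag k P" by (meson extensionalityI)
    interpret D: local_dvr P "localization P" "unif P" by (rule dvr[OF P(1)])
    let ?y = "inv\<^bsub>lf P\<^esub> (x P) \<otimes>\<^bsub>lf P\<^esub> diag k P"
    have u: "x P \<in> Units (lf P)" "diag k P \<in> Units (lf P)"
      using X_Units[OF x(1) P(1)] X_Units[OF diag_carrier[OF k] P(1)] by auto
    have uc: "x P \<in> carrier (lf P)" "diag k P \<in> carrier (lf P)" using u D.K.Units_closed by auto
    then have yc: "?y \<in> carrier (lf P)" using u by simp
    have "?y \<noteq> \<one>\<^bsub>lf P\<^esub>"
    proof
      assume "?y = \<one>\<^bsub>lf P\<^esub>"
      then have "x P \<otimes>\<^bsub>lf P\<^esub> ?y = x P" using uc by simp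
      moreover have "x P \<otimes>\<^bsub>lf P\<^esub> ?y = diag k P"
        using u uc by (simp add: D.K.m_assoc[symmetric])
      ultimately show False using P(2) by simp
    qed
    then have "?y \<ominus>\<^bsub>lf P\<^esub> \<one>\<^bsub>lf P\<^esub> \<noteq> \<zero>\<^bsub>lf P\<^esub>" using yc by simp
    then obtain n where "?y \<ominus>\<^bsub>lf P\<^esub> \<one>\<^bsub>lf P\<^esub> \<notin> MM P n" using D.M_Inter yc by blast
    then have "?y \<notin> UU P n" by (simp add: D.U1_def)
    then have "?y \<notin> UU P (max 1 n)" using D.U1_antimono[of n "max 1 n"] by auto
    then show "\<exists>P n. P \<in> primes \<and> n \<ge> 1 \<and> inv\<^bsub>lf P\<^esub> (x P) \<otimes>\<^bsub>lf P\<^esub> diag k P \<notin> UU P n"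
      using P(1) by (intro exI[of _ P] exI[of _ "max 1 n"]) auto
  qed
  then obtain p n where pn: "\<And>k. k \<in> S \<Longrightarrow> p k \<in> primes \<and> n k \<ge> (1::nat) \<and>
      inv\<^bsub>lf (p k)\<^esub> (x (p k)) \<otimes>\<^bsub>lf (p k)\<^esub> diag k (p k) \<notin> UU (p k) (n k)" by metis
  define m where "m = Max (insert 1 (n ` S))"
  have m: "m \<ge> 1" "\<And>k. k \<in> S \<Longrightarrow> n k \<le> m" unfolding m_def using \<open>finite S\<close> by (auto intro: Max_ge)
  have lev: "level (p ` S) m" using \<open>finite S\<close> m pn by (auto simp: level_def)
  have "x \<otimes>\<^bsub>FI\<^esub> w \<notin> DK" if w: "w \<in> W (p ` S) m" for w
  proof
    assume "x \<otimes>\<^bsub>FI\<^esub> w \<in> DK"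
    then obtain k where k: "k \<noteq> 0" "x \<otimes>\<^bsub>FI\<^esub> w = diag k" by (auto simp: DK_def)
    have wx: "w = inv\<^bsub>FI\<^esub> x \<otimes>\<^bsub>FI\<^esub> diag k"
      unfolding k(2)[symmetric] using x(1) W_X[OF w] by (simp add: FI.m_assoc[symmetric] del: X_mult X_one)
    then have kS: "k \<in> S" using w W_V k(1) unfolding S_def by blast
    then have pk: "p k \<in> primes" using pn by blast
    have "w (p k) = inv\<^bsub>lf (p k)\<^esub> (x (p k)) \<otimes>\<^bsub>lf (p k)\<^esub> diag k (p k)"
      using wx X_inv[OF x(1)] pk by simp
    moreover have "w (p k) \<in> UU (p k) m" using w kS by (simp add: W_def)
    ultimately show False using pn[OF kS] local_dvr.U1_antimono[OF dvr[OF pk] m(2)[OF kS]] by auto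
  qed
  then show ?thesis using lev by blast
qed

lemma closedin_DK: "closedin finite_ideles_topology DK"
  unfolding closedin_def topspace_finite_ideles openin_finite_ideles
proof (intro conjI ballI)
  show "DK \<subseteq> carrier FI" by (rule subgroup.subset[OF DK_subgroup])
  show "carrier FI - DK \<subseteq> carrier FI" by blast
  fix x assume "x \<in> carrier FI - DK"
  then obtain F n where "level F n" "\<forall>w\<in>W F n. x \<otimes>\<^bsub>FI\<^esub> w \<notin> DK" "x \<in> carrier FI" using DK_closed[of x] by blast
  then show "\<exists>F n. level F n \<and> (\<forall>w\<in>W F n. x \<otimes>\<^bsub>FI\<^esub> w \<in> carrier FI - DK)"
    using W_X FI.m_closed by blast
qed

section \<open>Ideles of finite support\<close>

definition finite_support :: "('k set \<Rightarrow> (nat \<Rightarrow> 'k) set) set" where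
  "finite_support = {x \<in> carrier FI. finite {P \<in> primes. x P \<noteq> \<one>\<^bsub>lf P\<^esub>}}"

text \<open>Outside a finite set \<open>E\<close>, which contains \<open>F\<close>, the idele is a
  unit and may be multiplied by its inverse; inside \<open>E\<close> it is left alone. The
  multiplier is 1 on \<open>F\<close>, so it lies in \<open>W F n\<close>.\<close>

lemma finite_support_dense:
  "x \<in> carrier FI \<Longrightarrow> x \<in> finite_ideles_topology closure_of finite_support"
  unfolding in_closure_of topspace_finite_ideles
proof (intro conjI allI impI)
  fix U assume x: "x \<in> carrier FI" and U: "x \<in> U \<and> openin finite_ideles_topology U"
  then obtain F n where F: "level F n" "\<And>w. w \<in> W F n \<Longrightarrow> x \<otimes>\<^bsub>FI\<^esub> w \<in> U"
    unfolding openin_finite_ideles by blast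
  define E where "E = F \<union> {P \<in> primes. x P \<notin> Units (li P)}"
  have E: "finite E" using F(1) x by (auto simp: E_def level_def X_carrier)
  define w where "w = (\<lambda>P\<in>primes. if P \<in> E then \<one>\<^bsub>lf P\<^esub> else inv\<^bsub>lf P\<^esub> (x P))"
  have "w P \<in> Units (li P)" if P: "P \<in> primes" for P
  proof -
    interpret D: local_dvr P "localization P" "unif P" by (rule dvr[OF P])
    interpret O: cring "li P" by (rule cring_li[OF P])
    show ?thesis
    proof (cases "P \<in> E")
      case True then show ?thesis using O.Units_one_closed P by (simp add: w_def)
    next
      case False
      then have "x P \<in> Units (li P)" using P by (auto simp: E_def)
      then show ?thesis using False P by (simp add: w_def D.Units_local_integers)
    qed
  qed
  moreover have "w P \<in> UU P n" if "P \<in> F" for P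
    using that F(1) local_dvr.U1_one[OF dvr] by (auto simp: w_def E_def level_def)
  ultimately have w: "w \<in> W F n" by (auto simp: W_def V_eq w_def)
  have "(x \<otimes>\<^bsub>FI\<^esub> w) P = \<one>\<^bsub>lf P\<^esub>" if P: "P \<in> primes" "P \<notin> E" for P
  proof -
    interpret D: local_dvr P "localization P" "unif P" by (rule dvr[OF P(1)])
    show ?thesis using X_Units[OF x P(1)] P by (simp add: w_def)
  qed
  then have "{P \<in> primes. (x \<otimes>\<^bsub>FI\<^esub> w) P \<noteq> \<one>\<^bsub>lf P\<^esub>} \<subseteq> E" by blast
  then have "x \<otimes>\<^bsub>FI\<^esub> w \<in> finite_support"
    using x W_X[OF w] E FI.m_closed finite_subset unfolding finite_support_def by blast
  then show "\<exists>y. y \<in> finite_support \<and> y \<in> U" using F(2)[OF w] by blast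
qed

lemma single_component_X:
  assumes P: "P \<in> primes" and a: "a \<in> Units (lf P)"
  shows "single_component P a \<in> carrier FI"
proof -
  have "single_component P a Q \<in> Units (lf Q)" if Q: "Q \<in> primes" for Q
  proof -
    interpret D: local_dvr Q "localization Q" "unif Q" by (rule dvr[OF Q])
    show ?thesis using a Q D.K.Units_one_closed by (auto simp: single_component_def)
  qed
  moreover have "{Q \<in> primes. single_component P a Q \<notin> Units (li Q)} \<subseteq> {P}"
  proof clarify
    fix Q assume Q: "Q \<in> primes" "single_component P a Q \<notin> Units (li Q)"
    interpret O: cring "li Q" by (rule cring_li[OF Q(1)])
    show "Q = P" using Q O.Units_one_closed by (auto simp: single_component_def split: if_splits)
  qed
  moreover have "finite {Q \<in> primes. single_component P a Q \<notin> Units (li Q)}"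
    using calculation(2) by (rule finite_subset) simp
  moreover have "single_component P a \<in> extensional primes" by (simp add: single_component_def)
  ultimately show ?thesis unfolding X_carrier PiE_iff by blast
qed

lemma single_component_mult:
  assumes P: "P \<in> primes"
  shows "single_component P (a \<otimes>\<^bsub>lf P\<^esub> b) = single_component P a \<otimes>\<^bsub>FI\<^esub> single_component P b"
proof -
  have "\<one>\<^bsub>lf Q\<^esub> \<otimes>\<^bsub>lf Q\<^esub> \<one>\<^bsub>lf Q\<^esub> = \<one>\<^bsub>lf Q\<^esub>" if Q: "Q \<in> primes" for Q
  proof -
    interpret D: local_dvr Q "localization Q" "unif Q" by (rule dvr[OF Q])
    show ?thesis by simp
  qed
  then show ?thesis unfolding X_mult single_component_def by (intro restrict_ext) simp
qed

text \<open>Induction on a finite set containing the support: multiplying by an idele concentrated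
  at one place turns that component into 1 and shrinks the set.\<close>

lemma hom_eq_on_finite_support:
  assumes G: "group G" and f: "f \<in> hom FI G" and g: "g \<in> hom FI G"
    and eq: "\<And>P a. P \<in> primes \<Longrightarrow> a \<in> Units (lf P) \<Longrightarrow> f (single_component P a) = g (single_component P a)"
    and x: "x \<in> finite_support"
  shows "f x = g x"
proof -
  have "x \<in> carrier FI \<Longrightarrow> {P \<in> primes. x P \<noteq> \<one>\<^bsub>lf P\<^esub>} \<subseteq> E \<Longrightarrow> f x = g x" if "finite E" for E x
    using that
  proof (induction E arbitrary: x rule: finite_induct)
    case empty
    then have "x = \<one>\<^bsub>FI\<^esub>" by (auto simp: fun_eq_iff X_carrier PiE_iff extensional_def)
    then show ?case using hom_one[OF f FI.group_axioms G] hom_one[OF g FI.group_axioms G] by metis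
  next
    case (insert P E)
    show ?case
    proof (cases "P \<in> primes")
      case False
      then have "{P \<in> primes. x P \<noteq> \<one>\<^bsub>lf P\<^esub>} \<subseteq> E" using insert.prems by auto
      then show ?thesis using insert by blast
    next
      case P: True
      define y where "y = single_component P (inv\<^bsub>lf P\<^esub> (x P)) \<otimes>\<^bsub>FI\<^esub> x"
      interpret D: local_dvr P "localization P" "unif P" by (rule dvr[OF P])
      have xP: "x P \<in> Units (lf P)" by (rule X_Units[OF insert.prems(1) P])
      have s1: "single_component P (inv\<^bsub>lf P\<^esub> (x P)) \<in> carrier FI" and s2: "single_component P (x P) \<in> carrier FI"
        using xP single_component_X[OF P] by auto
      have yc: "y \<in> carrier FI" unfolding y_def by (rule FI.m_closed[OF s1 insert.prems(1)])
      have "{Q \<in> primes. y Q \<noteq> \<one>\<^bsub>lf Q\<^esub>} \<subseteq> E"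
      proof clarify
        fix Q assume Q: "Q \<in> primes" "y Q \<noteq> \<one>\<^bsub>lf Q\<^esub>"
        interpret Q: local_dvr Q "localization Q" "unif Q" by (rule dvr[OF Q(1)])
        have xQ: "x Q \<in> carrier (lf Q)" using X_Units[OF insert.prems(1) Q(1)] by (rule Q.K.Units_closed)
        have "Q \<noteq> P" using Q xP by (auto simp: y_def single_component_def)
        moreover have "x Q \<noteq> \<one>\<^bsub>lf Q\<^esub>" using Q \<open>Q \<noteq> P\<close> xQ by (auto simp: y_def single_component_def)
        ultimately show "Q \<in> E" using insert.prems(2) Q(1) by blast
      qed
      then have fy: "f y = g y" using insert.IH yc by blast
      have "single_component P (x P) \<otimes>\<^bsub>FI\<^esub> y = (single_component P (x P) \<otimes>\<^bsub>FI\<^esub> single_component P (inv\<^bsub>lf P\<^esub> (x P))) \<otimes>\<^bsub>FI\<^esub> x"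
        unfolding y_def by (rule FI.m_assoc[OF s2 s1 insert.prems(1), symmetric])
      also have "single_component P (x P) \<otimes>\<^bsub>FI\<^esub> single_component P (inv\<^bsub>lf P\<^esub> (x P)) = \<one>\<^bsub>FI\<^esub>"
        unfolding single_component_mult[OF P, symmetric] using xP
        by (simp add: single_component_def) (rule restrict_ext, simp)
      finally have "x = single_component P (x P) \<otimes>\<^bsub>FI\<^esub> y" using FI.l_one[OF insert.prems(1)] by metis
      then show ?thesis using fy eq[OF P xP] hom_mult[OF f s2 yc] hom_mult[OF g s2 yc] by metis
    qed
  qed
  then show ?thesis using x unfolding finite_support_def by blast
qed

declare X_mult [simp del] X_one [simp del]

end

section \<open>The idele class group\<close>

context imaginary_quadratic begin

abbreviation AR :: "(('k \<Rightarrow> complex) \<Rightarrow> complex) ring" where "AR \<equiv> archimedean_ring"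
abbreviation embs :: "('k \<Rightarrow> complex) set" where "embs \<equiv> embeddings"
abbreviation ID :: "'k idele monoid" where "ID \<equiv> ideles"
abbreviation AK :: "'k idele set" where "AK \<equiv> artin_kernel"
abbreviation GA :: "'k idele set monoid" where "GA \<equiv> galois_ab"
abbreviation art :: "('k set \<Rightarrow> (nat \<Rightarrow> 'k) set) \<Rightarrow> 'k idele set" where "art \<equiv> reciprocity"

lemma cnj_embedding: "\<tau> \<in> embs \<Longrightarrow> cnj \<circ> \<tau> \<in> embs"
  using embeddings_eq by (metis insertE insertI1 insertI2 singletonD)

lemma embedding_hom:
  assumes "\<tau> \<in> embs"
  shows "\<tau> (x * y) = \<tau> x * \<tau> y" "\<tau> 1 = 1" "x \<noteq> 0 \<Longrightarrow> \<tau> x \<noteq> 0"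
proof -
  show m: "\<tau> (x * y) = \<tau> x * \<tau> y" for x y
    using ring_hom_mult[of \<tau> field_ring field_ring x y] assms by (simp add: embeddings_def ring_of_type_algebra_def)
  show 1: "\<tau> 1 = 1"
    using ring_hom_one[of \<tau> field_ring field_ring] assms by (simp add: embeddings_def ring_of_type_algebra_def)
  show "x \<noteq> 0 \<Longrightarrow> \<tau> x \<noteq> 0" using m[of x "inverse x"] 1 by auto
qed

lemma AR_simps:
  "carrier AR = {z \<in> extensional embs. \<forall>\<sigma>\<in>embs. z (cnj \<circ> \<sigma>) = cnj (z \<sigma>)}"
  "z \<otimes>\<^bsub>AR\<^esub> w = (\<lambda>\<sigma>\<in>embs. z \<sigma> * w \<sigma>)" "\<one>\<^bsub>AR\<^esub> = (\<lambda>\<sigma>\<in>embs. 1)"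
  by (simp_all add: archimedean_ring_def)

lemma AR_ext: "z \<in> extensional embs \<Longrightarrow> w \<in> extensional embs \<Longrightarrow> (\<And>\<sigma>. \<sigma> \<in> embs \<Longrightarrow> z \<sigma> = w \<sigma>) \<Longrightarrow> z = w"
  by (rule extensionalityI)

sublocale AR: comm_monoid AR
proof (rule comm_monoidI)
  fix x y z assume x: "x \<in> carrier AR" and y: "y \<in> carrier AR"
  show "x \<otimes>\<^bsub>AR\<^esub> y \<in> carrier AR"
    using x y cnj_embedding by (simp add: AR_simps)
  show "x \<otimes>\<^bsub>AR\<^esub> y = y \<otimes>\<^bsub>AR\<^esub> x" by (simp add: AR_simps mult.commute)
  assume "z \<in> carrier AR"
  show "x \<otimes>\<^bsub>AR\<^esub> y \<otimes>\<^bsub>AR\<^esub> z = x \<otimes>\<^bsub>AR\<^esub> (y \<otimes>\<^bsub>AR\<^esub> z)"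
    by (auto simp: AR_simps mult.assoc intro!: restrict_ext)
next
  show "\<one>\<^bsub>AR\<^esub> \<in> carrier AR" using cnj_embedding by (simp add: AR_simps)
  fix x assume "x \<in> carrier AR"
  then show "\<one>\<^bsub>AR\<^esub> \<otimes>\<^bsub>AR\<^esub> x = x"
    by (intro AR_ext) (auto simp: AR_simps)
qed

lemma Units_AR: "z \<in> Units AR \<longleftrightarrow> z \<in> carrier AR \<and> (\<forall>\<sigma>\<in>embs. z \<sigma> \<noteq> 0)"
proof
  assume z: "z \<in> Units AR"
  have "z \<sigma> \<noteq> 0" if \<sigma>: "\<sigma> \<in> embs" for \<sigma>
    using fun_cong[OF AR.Units_r_inv[OF z], of \<sigma>] \<sigma> by (auto simp: AR_simps)
  then show "z \<in> carrier AR \<and> (\<forall>\<sigma>\<in>embs. z \<sigma> \<noteq> 0)" using z by blast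
next
  assume z: "z \<in> carrier AR \<and> (\<forall>\<sigma>\<in>embs. z \<sigma> \<noteq> 0)"
  define w where "w = (\<lambda>\<sigma>\<in>embs. inverse (z \<sigma>))"
  have "w \<in> carrier AR" using z cnj_embedding by (simp add: w_def AR_simps)
  moreover have "w \<otimes>\<^bsub>AR\<^esub> z = \<one>\<^bsub>AR\<^esub>" using z by (auto simp: w_def AR_simps intro!: restrict_ext)
  ultimately show "z \<in> Units AR" using z AR.m_comm unfolding Units_def by auto
qed

sublocale UA: comm_group "units_of AR" by (rule AR.units_comm_group)

lemma archimedean_topspace: "topspace archimedean_units_topology = Units AR"
  by (auto simp: archimedean_units_topology_def Units_AR AR_simps PiE_def)

text \<open>Evaluation at one embedding identifies the archimedean units with the punctured complex
  plane, which is connected.\<close>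

lemma archimedean_identity_component: "archimedean_identity_component = Units AR"
proof -
  let ?T = "archimedean_units_topology :: (('k \<Rightarrow> complex) \<Rightarrow> complex) topology"
  obtain \<sigma> where \<sigma>: "\<sigma> \<in> embs" "embs = {\<sigma>, cnj \<circ> \<sigma>}" "\<sigma> \<noteq> cnj \<circ> \<sigma>" "cnj \<circ> (cnj \<circ> \<sigma>) = \<sigma>"
    by (rule embeddings_eq)
  \<comment> \<open>The inverse of evaluation at \<sigma>. The two embeddings are distinct, so the
    value at the second one can be set to the conjugate with no constraint on \<open>z\<close>; a
    real embedding would force \<open>z\<close> to be real.\<close>
  define g where "g = (\<lambda>z. \<lambda>\<tau>\<in>embs. if \<tau> = \<sigma> then z else cnj z)"
  have g\<sigma>: "g z \<sigma> = z" "g z (cnj \<circ> \<sigma>) = cnj z" for z using \<sigma> by (auto simp: g_def)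
  have gU: "g z \<in> Units AR" if "z \<noteq> 0" for z
    using that \<sigma> g\<sigma> by (auto simp: Units_AR AR_simps g_def)
  have "continuous_map (top_of_set (- {0})) ?T g"
    unfolding archimedean_units_topology_def continuous_map_in_subtopology continuous_map_componentwise
  proof (intro conjI ballI)
    show "g ` topspace (top_of_set (- {0})) \<subseteq> extensional embs" by (auto simp: g_def)
    show "g \<in> topspace (top_of_set (- {0})) \<rightarrow> Units AR" using gU by auto
    fix \<tau> assume \<tau>: "\<tau> \<in> embs"
    have "continuous_on (- {0}) (\<lambda>z. if \<tau> = \<sigma> then z else cnj z)"
      by (cases "\<tau> = \<sigma>") (auto intro!: continuous_intros)
    then show "continuous_map (top_of_set (- {0})) euclidean (\<lambda>z. g z \<tau>)"
      using \<tau> by (simp add: g_def)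
  qed
  moreover have "connected (- {0::complex})" by (rule connected_punctured_universe) simp
  then have "connectedin (top_of_set (- {0::complex})) (- {0})" by (simp add: connectedin_subtopology)
  ultimately have "connectedin ?T (g ` (- {0}))" by (rule connectedin_continuous_map_image)
  moreover have "g ` (- {0}) = Units AR"
  proof
    show "g ` (- {0}) \<subseteq> Units AR" using gU by auto
    show "Units AR \<subseteq> g ` (- {0})"
    proof
      fix z assume z: "z \<in> Units AR"
      then have "z = g (z \<sigma>)"
        using \<sigma> g\<sigma> by (intro AR_ext) (auto simp: Units_AR AR_simps g_def)
      moreover have "z \<sigma> \<noteq> 0" using z \<sigma>(1) by (simp add: Units_AR)
      ultimately show "z \<in> g ` (- {0})" by blast
    qed
  qed
  ultimately have "connectedin ?T (Units AR)" by simp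
  then have "Units AR \<subseteq> archimedean_identity_component"
    unfolding archimedean_identity_component_def connected_component_of_set
    using AR.Units_one_closed by blast
  moreover have "archimedean_identity_component \<subseteq> Units AR"
    unfolding archimedean_identity_component_def
    using connected_component_of_subset_topspace archimedean_topspace by metis
  ultimately show ?thesis by blast
qed

section \<open>The ideles, the Artin kernel and the reciprocity map\<close>

lemma ID_simps:
  "carrier ID = carrier FI \<times> Units AR" "(x, z) \<otimes>\<^bsub>ID\<^esub> (y, w) = (x \<otimes>\<^bsub>FI\<^esub> y, z \<otimes>\<^bsub>AR\<^esub> w)"
  "\<one>\<^bsub>ID\<^esub> = (\<one>\<^bsub>FI\<^esub>, \<one>\<^bsub>AR\<^esub>)"
  by (simp_all add: ideles_def DirProd_def units_of_def)

sublocale ID: comm_group ID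
proof (rule group.group_comm_groupI)
  show "group ID" unfolding ideles_def by (rule DirProd_group[OF FI.group_axioms UA.group_axioms])
  fix a b assume "a \<in> carrier ID" "b \<in> carrier ID"
  then show "a \<otimes>\<^bsub>ID\<^esub> b = b \<otimes>\<^bsub>ID\<^esub> a"
    using FI.m_comm AR.m_comm AR.Units_closed by (cases a; cases b) (auto simp: ID_simps simp del: X_mult)
qed

text \<open>Since the identity component is the full archimedean unit group, multiplying by it frees
  the archimedean coordinate of a principal idele. What remains is a product set, whose closure is
  the product of the closures, and \<open>DK\<close> is closed.\<close>

lemma artin_kernel_eq: "AK = DK \<times> Units AR"
proof -
  have pr: "(\<lambda>\<sigma>\<in>embs. \<sigma> x) \<in> Units AR" if "x \<noteq> 0" for x
    using that cnj_embedding embedding_hom(3) by (auto simp: Units_AR AR_simps)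
  have "principal_idele ` (UNIV - {0}) <#>\<^bsub>ID\<^esub> ({\<one>\<^bsub>FI\<^esub>} \<times> archimedean_identity_component) = DK \<times> Units AR"
    (is "?A = ?B")
  proof
    show "?A \<subseteq> ?B"
    proof
      fix a assume "a \<in> ?A"
      then obtain x z where "x \<noteq> 0" "z \<in> Units AR" "a = principal_idele x \<otimes>\<^bsub>ID\<^esub> (\<one>\<^bsub>FI\<^esub>, z)"
        unfolding archimedean_identity_component by (auto simp: set_mult_def)
      then have "a = (diag x, (\<lambda>\<sigma>\<in>embs. \<sigma> x) \<otimes>\<^bsub>AR\<^esub> z)" "x \<noteq> 0" "(\<lambda>\<sigma>\<in>embs. \<sigma> x) \<otimes>\<^bsub>AR\<^esub> z \<in> Units AR"
        using diag_carrier[of x] FI.r_one[of "diag x"] pr[of x] AR.Units_m_closed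
        by (simp_all add: principal_idele_def ID_simps del: X_mult X_one)
      then show "a \<in> ?B" by (auto simp: DK_def)
    qed
    show "?B \<subseteq> ?A"
    proof
      fix a assume "a \<in> ?B"
      then obtain x z where x: "x \<noteq> 0" "z \<in> Units AR" "a = (diag x, z)" by (auto simp: DK_def)
      let ?p = "\<lambda>\<sigma>\<in>embs. \<sigma> x"
      have w: "inv\<^bsub>AR\<^esub> ?p \<otimes>\<^bsub>AR\<^esub> z \<in> Units AR" using pr[OF x(1)] x(2) by simp
      have "?p \<otimes>\<^bsub>AR\<^esub> (inv\<^bsub>AR\<^esub> ?p \<otimes>\<^bsub>AR\<^esub> z) = z"
        using pr[OF x(1)] x(2) AR.m_assoc[of ?p "inv\<^bsub>AR\<^esub> ?p" z] AR.Units_closed by simp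
      then have "a = principal_idele x \<otimes>\<^bsub>ID\<^esub> (\<one>\<^bsub>FI\<^esub>, inv\<^bsub>AR\<^esub> ?p \<otimes>\<^bsub>AR\<^esub> z)"
        using diag_carrier[OF x(1)] FI.r_one[of "diag x"] x(3)
        by (simp add: principal_idele_def ID_simps del: X_mult X_one)
      then show "a \<in> ?A" using w x(1) unfolding set_mult_def archimedean_identity_component by blast
    qed
  qed
  then have "AK = ideles_topology closure_of (DK \<times> Units AR)" by (simp add: artin_kernel_def)
  also have "\<dots> = DK \<times> Units AR"
    unfolding ideles_topology_def closure_of_Times
  proof -
    have "finite_ideles_topology closure_of DK = DK" using closedin_DK by (rule closure_of_closedin)
    moreover have "archimedean_units_topology closure_of Units AR = Units AR"
      using closure_of_topspace[of "archimedean_units_topology :: (('k \<Rightarrow> complex) \<Rightarrow> complex) topology"]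
      unfolding archimedean_topspace .
    ultimately show "(finite_ideles_topology closure_of DK) \<times> (archimedean_units_topology closure_of Units AR) =
        DK \<times> Units AR" by (simp only:)
  qed
  finally show ?thesis .
qed

lemma AK_subgroup: "subgroup AK ID"
proof -
  have "subgroup (Units AR) (units_of AR)" using UA.subgroup_self by (simp add: units_of_carrier)
  then show ?thesis unfolding artin_kernel_eq ideles_def
    by (rule DirProd_subgroups[OF FI.group_axioms DK_subgroup UA.group_axioms])
qed

sublocale GA: comm_group GA
  unfolding galois_ab_def by (rule ID.abelian_FactGroup[OF AK_subgroup])

lemma AK_normal: "AK \<lhd> ID" using AK_subgroup ID.normal_iff_subgroup by blast

lemma art_eq: "art x = AK #>\<^bsub>ID\<^esub> (x, \<one>\<^bsub>AR\<^esub>)"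
  by (simp add: reciprocity_def)

text \<open>The archimedean units lie in the kernel, so a class depends on the finite part alone.
  Thus \<open>galois_ab\<close> becomes the quotient of the finite ideles by the diagonal image of
  K^*.\<close>

lemma coset_eq_art:
  assumes "x \<in> carrier FI" "z \<in> Units AR" shows "AK #>\<^bsub>ID\<^esub> (x, z) = art x"
proof -
  have "(\<one>\<^bsub>FI\<^esub>, z) \<in> AK" using assms subgroup.one_closed[OF DK_subgroup] by (simp add: artin_kernel_eq del: X_one)
  moreover have "(\<one>\<^bsub>FI\<^esub>, z) \<otimes>\<^bsub>ID\<^esub> (x, \<one>\<^bsub>AR\<^esub>) = (x, z)"
    using assms FI.l_one AR.Units_closed AR.r_one by (simp add: ID_simps del: X_mult X_one)
  ultimately have "(x, z) \<in> AK #>\<^bsub>ID\<^esub> (x, \<one>\<^bsub>AR\<^esub>)" unfolding r_coset_def by force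
  then show ?thesis unfolding art_eq
    using ID.repr_independence[OF _ _ AK_subgroup] assms(1) by (metis AR.Units_one_closed ID_simps(1) SigmaI)
qed

lemma art_pair: "x \<in> carrier FI \<Longrightarrow> (x, \<one>\<^bsub>AR\<^esub>) \<in> carrier ID" by (simp add: ID_simps)

lemma art_hom: "art \<in> hom FI GA"
proof (rule homI)
  fix x y assume x: "x \<in> carrier FI" and y: "y \<in> carrier FI"
  have h: "(\<lambda>a. AK #>\<^bsub>ID\<^esub> a) \<in> hom ID GA"
    unfolding galois_ab_def by (rule normal.r_coset_hom_Mod[OF AK_normal])
  show "art x \<in> carrier GA" unfolding art_eq by (rule hom_in_carrier[OF h art_pair[OF x]])
  have "(x, \<one>\<^bsub>AR\<^esub>) \<otimes>\<^bsub>ID\<^esub> (y, \<one>\<^bsub>AR\<^esub>) = (x \<otimes>\<^bsub>FI\<^esub> y, \<one>\<^bsub>AR\<^esub>)" by (simp add: ID_simps)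
  then show "art (x \<otimes>\<^bsub>FI\<^esub> y) = art x \<otimes>\<^bsub>GA\<^esub> art y"
    unfolding art_eq using hom_mult[OF h art_pair[OF x] art_pair[OF y]] by metis
qed

lemma art_carrier [simp]: "x \<in> carrier FI \<Longrightarrow> art x \<in> carrier GA"
  by (rule hom_in_carrier[OF art_hom])
lemma art_mult: "x \<in> carrier FI \<Longrightarrow> y \<in> carrier FI \<Longrightarrow> art (x \<otimes>\<^bsub>FI\<^esub> y) = art x \<otimes>\<^bsub>GA\<^esub> art y"
  by (rule hom_mult[OF art_hom])
lemma art_one: "art \<one>\<^bsub>FI\<^esub> = \<one>\<^bsub>GA\<^esub>"
  by (rule hom_one[OF art_hom FI.group_axioms GA.group_axioms])

lemma art_inv: "x \<in> carrier FI \<Longrightarrow> art (inv\<^bsub>FI\<^esub> x) = inv\<^bsub>GA\<^esub> (art x)"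
proof -
  assume x: "x \<in> carrier FI"
  have "art (inv\<^bsub>FI\<^esub> x) \<otimes>\<^bsub>GA\<^esub> art x = \<one>\<^bsub>GA\<^esub>"
    using x art_mult[of "inv\<^bsub>FI\<^esub> x" x] art_one by (simp del: X_mult X_one)
  then show ?thesis using GA.inv_equality x by simp
qed

lemma carrier_GA: "carrier GA = art ` carrier FI"
proof
  show "carrier GA \<subseteq> art ` carrier FI"
  proof
    fix s assume "s \<in> carrier GA"
    then obtain a where a: "a \<in> carrier ID" "s = AK #>\<^bsub>ID\<^esub> a"
      unfolding galois_ab_def carrier_FactGroup by blast
    then obtain x z where xz: "a = (x, z)" "x \<in> carrier FI" "z \<in> Units AR"
      by (cases a) (auto simp: ID_simps)
    then show "s \<in> art ` carrier FI" using a(2) coset_eq_art by blast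
  qed
qed auto

lemma art_eq_one_iff: "x \<in> carrier FI \<Longrightarrow> art x = \<one>\<^bsub>GA\<^esub> \<longleftrightarrow> x \<in> DK"
proof -
  assume x: "x \<in> carrier FI"
  have "art x = \<one>\<^bsub>GA\<^esub> \<longleftrightarrow> AK #>\<^bsub>ID\<^esub> (x, \<one>\<^bsub>AR\<^esub>) = AK" by (simp add: art_eq galois_ab_def)
  also have "\<dots> \<longleftrightarrow> (x, \<one>\<^bsub>AR\<^esub>) \<in> AK"
    using ID.coset_join1[OF _ art_pair[OF x] AK_subgroup] ID.coset_join2[OF art_pair[OF x] AK_subgroup]
      subgroup.subset[OF AK_subgroup] by blast
  finally show ?thesis by (simp add: artin_kernel_eq)
qed

lemma art_eq_iff:
  assumes "x \<in> carrier FI" "y \<in> carrier FI"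
  shows "art x = art y \<longleftrightarrow> inv\<^bsub>FI\<^esub> x \<otimes>\<^bsub>FI\<^esub> y \<in> DK"
proof -
  have "inv\<^bsub>FI\<^esub> x \<otimes>\<^bsub>FI\<^esub> y \<in> DK \<longleftrightarrow> inv\<^bsub>GA\<^esub> (art x) \<otimes>\<^bsub>GA\<^esub> art y = \<one>\<^bsub>GA\<^esub>"
    using assms art_eq_one_iff[of "inv\<^bsub>FI\<^esub> x \<otimes>\<^bsub>FI\<^esub> y"] by (simp add: art_mult art_inv del: X_mult)
  also have "\<dots> \<longleftrightarrow> art x = art y"
    using assms GA.inv_solve_left' [of "\<one>\<^bsub>GA\<^esub>" "art x" "art y"] by auto
  finally show ?thesis by blast
qed

lemma topspace_ideles: "topspace ideles_topology = carrier ID"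
  by (simp add: ideles_topology_def ID_simps archimedean_topspace)

lemma topspace_GA: "topspace galois_ab_topology = carrier GA"
  unfolding galois_ab_topology_def topspace_quotient_topology topspace_ideles
  by (simp add: galois_ab_def carrier_FactGroup)

text \<open>A union of classes pulls back to a product of a set of finite ideles with all
  archimedean units, and such a product is open exactly when its first factor is. So the quotient
  topology can be tested along \<open>art\<close>.\<close>

lemma openin_GA: "openin galois_ab_topology U \<longleftrightarrow>
    U \<subseteq> carrier GA \<and> openin finite_ideles_topology {x \<in> carrier FI. art x \<in> U}"
proof -
  have "{a \<in> topspace ideles_topology. AK #>\<^bsub>ID\<^esub> a \<in> U} = {x \<in> carrier FI. art x \<in> U} \<times> Units AR"
    using coset_eq_art by (auto simp: topspace_ideles ID_simps)
  moreover have "Units AR \<noteq> {}" using AR.Units_one_closed by blast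
  moreover have "openin archimedean_units_topology (Units AR)"
    using openin_topspace[of "archimedean_units_topology :: (('k \<Rightarrow> complex) \<Rightarrow> complex) topology"]
    by (simp add: archimedean_topspace)
  ultimately have "openin ideles_topology {a \<in> topspace ideles_topology. AK #>\<^bsub>ID\<^esub> a \<in> U} \<longleftrightarrow>
      {x \<in> carrier FI. art x \<in> U} = {} \<or> openin finite_ideles_topology {x \<in> carrier FI. art x \<in> U}"
    by (simp only: ideles_topology_def openin_prod_Times_iff simp_thms)
  then have "openin ideles_topology {a \<in> topspace ideles_topology. AK #>\<^bsub>ID\<^esub> a \<in> U} \<longleftrightarrow>
      openin finite_ideles_topology {x \<in> carrier FI. art x \<in> U}"
    by (cases "{x \<in> carrier FI. art x \<in> U} = {}") (simp_all only: openin_empty simp_thms)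
  moreover have "(\<lambda>x. AK #>\<^bsub>ID\<^esub> x) ` topspace ideles_topology = carrier GA"
    by (simp add: topspace_ideles galois_ab_def carrier_FactGroup)
  ultimately show ?thesis
    unfolding galois_ab_topology_def openin_quotient_topology by simp
qed

end

section \<open>The Deligne-Ribet monoid\<close>

context imaginary_quadratic begin

abbreviation DR :: "'k dr_pair set monoid" where "DR \<equiv> deligne_ribet"
abbreviation dc :: "('k set \<Rightarrow> (nat \<Rightarrow> 'k) set) \<Rightarrow> 'k idele set \<Rightarrow> 'k dr_pair set" where "dc \<equiv> dr_class"
abbreviation dr :: "('k dr_pair \<times> 'k dr_pair) set" where "dr \<equiv> dr_relation"

lemma V_FI: "u \<in> V \<Longrightarrow> u \<in> carrier FI" using V_X by blast

lemma art_V: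
  "u \<in> V \<Longrightarrow> art u \<in> carrier GA"
  "u \<in> V \<Longrightarrow> v \<in> V \<Longrightarrow> art (u \<otimes>\<^bsub>IA\<^esub> v) = art u \<otimes>\<^bsub>GA\<^esub> art v"
  "art \<one>\<^bsub>IA\<^esub> = \<one>\<^bsub>GA\<^esub>" "u \<in> V \<Longrightarrow> art (inv\<^bsub>IA\<^esub> u) = inv\<^bsub>GA\<^esub> (art u)"
  unfolding V_mult V_one using V_FI art_mult art_one art_inv V_inv by simp_all

lemma dr_iff: "((\<rho>, s), (\<rho>', s')) \<in> dr \<longleftrightarrow> \<rho> \<in> carrier IA \<and> s \<in> carrier GA \<and>
    (\<exists>u\<in>V. \<rho>' = \<rho> \<otimes>\<^bsub>IA\<^esub> u \<and> s' = inv\<^bsub>GA\<^esub> (art u) \<otimes>\<^bsub>GA\<^esub> s)"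
  unfolding dr_relation_def by blast

lemma drI: "\<rho> \<in> carrier IA \<Longrightarrow> s \<in> carrier GA \<Longrightarrow> u \<in> V \<Longrightarrow>
    ((\<rho>, s), (\<rho> \<otimes>\<^bsub>IA\<^esub> u, inv\<^bsub>GA\<^esub> (art u) \<otimes>\<^bsub>GA\<^esub> s)) \<in> dr"
  unfolding dr_iff by blast

text \<open>This is the orbit relation of an action of the group \<open>V\<close>: inverses in
  \<open>V\<close> give symmetry and products give transitivity, because \<open>art\<close> is a
  homomorphism there.\<close>

lemma dr_equiv: "equiv (carrier IA \<times> carrier GA) dr"
proof (rule equivI)
  show "dr \<subseteq> (carrier IA \<times> carrier GA) \<times> (carrier IA \<times> carrier GA)"
    using art_V(1) IA.Units_closed by (auto simp: dr_iff)
  show "refl_on (carrier IA \<times> carrier GA) dr"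
  proof (rule refl_onI, clarify)
    fix \<rho> s assume "\<rho> \<in> carrier IA" "s \<in> carrier GA"
    then show "((\<rho>, s), (\<rho>, s)) \<in> dr" using drI[of \<rho> s "\<one>\<^bsub>IA\<^esub>"] by (simp add: art_V(3))
  qed
  show "sym dr"
  proof (rule symI, clarify)
    fix \<rho> s \<rho>' s' assume "((\<rho>, s), (\<rho>', s')) \<in> dr"
    then obtain u where u: "\<rho> \<in> carrier IA" "s \<in> carrier GA" "u \<in> V"
      "\<rho>' = \<rho> \<otimes>\<^bsub>IA\<^esub> u" "s' = inv\<^bsub>GA\<^esub> (art u) \<otimes>\<^bsub>GA\<^esub> s" by (auto simp: dr_iff)
    have c: "u \<in> carrier IA" "art u \<in> carrier GA" using u(3) art_V(1) by auto
    have "\<rho>' \<otimes>\<^bsub>IA\<^esub> inv\<^bsub>IA\<^esub> u = \<rho>" using u c by (simp add: IA.m_assoc)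
    moreover have "inv\<^bsub>GA\<^esub> (art (inv\<^bsub>IA\<^esub> u)) \<otimes>\<^bsub>GA\<^esub> s' = s"
      using u c by (simp add: art_V(4) GA.m_assoc[symmetric])
    moreover have "\<rho>' \<in> carrier IA" "s' \<in> carrier GA" using u c by simp_all
    ultimately show "((\<rho>', s'), (\<rho>, s)) \<in> dr" using drI[of \<rho>' s' "inv\<^bsub>IA\<^esub> u"] u(3) by simp
  qed
  show "trans dr"
  proof (rule transI, clarify)
    fix \<rho> s \<rho>' s' \<rho>'' s'' assume "((\<rho>, s), (\<rho>', s')) \<in> dr" "((\<rho>', s'), (\<rho>'', s'')) \<in> dr"
    then obtain u v where u: "\<rho> \<in> carrier IA" "s \<in> carrier GA" "u \<in> V" "v \<in> V"
      "\<rho>'' = (\<rho> \<otimes>\<^bsub>IA\<^esub> u) \<otimes>\<^bsub>IA\<^esub> v" "s'' = inv\<^bsub>GA\<^esub> (art v) \<otimes>\<^bsub>GA\<^esub> (inv\<^bsub>GA\<^esub> (art u) \<otimes>\<^bsub>GA\<^esub> s)"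
      by (auto simp: dr_iff)
    have c: "u \<in> carrier IA" "v \<in> carrier IA" "art u \<in> carrier GA" "art v \<in> carrier GA"
      using u(3,4) art_V(1) by auto
    have "\<rho>'' = \<rho> \<otimes>\<^bsub>IA\<^esub> (u \<otimes>\<^bsub>IA\<^esub> v)" using u c by (simp add: IA.m_assoc)
    moreover have "s'' = inv\<^bsub>GA\<^esub> (art (u \<otimes>\<^bsub>IA\<^esub> v)) \<otimes>\<^bsub>GA\<^esub> s"
      using u c by (simp add: art_V(2) GA.inv_mult_group GA.m_assoc)
    ultimately show "((\<rho>, s), (\<rho>'', s'')) \<in> dr" using drI[of \<rho> s "u \<otimes>\<^bsub>IA\<^esub> v"] u by simp
  qed
qed

lemma dc_eq_iff:
  assumes "\<rho> \<in> carrier IA" "s \<in> carrier GA" "\<rho>' \<in> carrier IA" "s' \<in> carrier GA"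
  shows "dc \<rho> s = dc \<rho>' s' \<longleftrightarrow> (\<exists>u\<in>V. \<rho>' = \<rho> \<otimes>\<^bsub>IA\<^esub> u \<and> s' = inv\<^bsub>GA\<^esub> (art u) \<otimes>\<^bsub>GA\<^esub> s)"
  unfolding dr_class_def using eq_equiv_class_iff[OF dr_equiv, of "(\<rho>, s)" "(\<rho>', s')"] assms
  by (simp add: dr_iff)

lemma carrier_DR: "carrier DR = {dc \<rho> s | \<rho> s. \<rho> \<in> carrier IA \<and> s \<in> carrier GA}"
  unfolding deligne_ribet_def quotient_def dr_class_def by (auto simp: DirProd_def)

lemma dc_carrier: "\<rho> \<in> carrier IA \<Longrightarrow> s \<in> carrier GA \<Longrightarrow> dc \<rho> s \<in> carrier DR"
  by (auto simp: carrier_DR)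

lemma DR_one: "\<one>\<^bsub>DR\<^esub> = dc \<one>\<^bsub>IA\<^esub> \<one>\<^bsub>GA\<^esub>"
  by (simp add: deligne_ribet_def)

text \<open>Changing the representatives by \<open>u\<close> and \<open>v\<close> changes the
  product by \<open>u\<close> times \<open>v\<close>, by commutativity of both factors. All members
  of the union in the definition therefore coincide.\<close>

lemma DR_mult:
  assumes "\<rho> \<in> carrier IA" "s \<in> carrier GA" "\<rho>' \<in> carrier IA" "s' \<in> carrier GA"
  shows "dc \<rho> s \<otimes>\<^bsub>DR\<^esub> dc \<rho>' s' = dc (\<rho> \<otimes>\<^bsub>IA\<^esub> \<rho>') (s \<otimes>\<^bsub>GA\<^esub> s')"
proof -
  have "(\<Union>a\<in>dr `` {(\<rho>, s)}. \<Union>b\<in>dr `` {(\<rho>', s')}. dr `` {a \<otimes>\<^bsub>IA \<times>\<times> GA\<^esub> b}) =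
      dr `` {(\<rho>, s) \<otimes>\<^bsub>IA \<times>\<times> GA\<^esub> (\<rho>', s')}"
  proof (rule UN_equiv_class2[OF dr_equiv dr_equiv])
    show "congruent2 dr dr (\<lambda>a b. dr `` {a \<otimes>\<^bsub>IA \<times>\<times> GA\<^esub> b})"
    proof (rule congruent2I', clarify)
      fix a s a' s' b t b' t'
      assume "((a, s), (a', s')) \<in> dr" "((b, t), (b', t')) \<in> dr"
      then obtain u v where u: "a \<in> carrier IA" "s \<in> carrier GA" "u \<in> V" "a' = a \<otimes>\<^bsub>IA\<^esub> u"
          "s' = inv\<^bsub>GA\<^esub> (art u) \<otimes>\<^bsub>GA\<^esub> s"
        and v: "b \<in> carrier IA" "t \<in> carrier GA" "v \<in> V" "b' = b \<otimes>\<^bsub>IA\<^esub> v"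
          "t' = inv\<^bsub>GA\<^esub> (art v) \<otimes>\<^bsub>GA\<^esub> t" by (auto simp: dr_iff)
      have c: "u \<in> carrier IA" "v \<in> carrier IA" "art u \<in> carrier GA" "art v \<in> carrier GA"
        using u(3) v(3) art_V(1) by auto
      have "a' \<otimes>\<^bsub>IA\<^esub> b' = (a \<otimes>\<^bsub>IA\<^esub> b) \<otimes>\<^bsub>IA\<^esub> (u \<otimes>\<^bsub>IA\<^esub> v)" using u(1,4) v(1,4) c by (simp add: IA.m_ac)
      moreover have "s' \<otimes>\<^bsub>GA\<^esub> t' = inv\<^bsub>GA\<^esub> (art (u \<otimes>\<^bsub>IA\<^esub> v)) \<otimes>\<^bsub>GA\<^esub> (s \<otimes>\<^bsub>GA\<^esub> t)"
        using u(2,3,5) v(2,3,5) c by (simp add: art_V(2) GA.inv_mult GA.m_ac)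
      ultimately have "((a \<otimes>\<^bsub>IA\<^esub> b, s \<otimes>\<^bsub>GA\<^esub> t), (a' \<otimes>\<^bsub>IA\<^esub> b', s' \<otimes>\<^bsub>GA\<^esub> t')) \<in> dr"
        using drI[of "a \<otimes>\<^bsub>IA\<^esub> b" "s \<otimes>\<^bsub>GA\<^esub> t" "u \<otimes>\<^bsub>IA\<^esub> v"] u(1-3) v(1-3) by simp
      then show "dr `` {(a, s) \<otimes>\<^bsub>IA \<times>\<times> GA\<^esub> (b, t)} = dr `` {(a', s') \<otimes>\<^bsub>IA \<times>\<times> GA\<^esub> (b', t')}"
        using equiv_class_eq[OF dr_equiv] by simp
    qed
  qed (use assms in auto)
  then show ?thesis by (simp add: deligne_ribet_def dr_class_def)
qed

lemma DR_cases:
  assumes "A \<in> carrier DR" obtains \<rho> s where "\<rho> \<in> carrier IA" "s \<in> carrier GA" "A = dc \<rho> s"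
  using assms by (auto simp: carrier_DR)

sublocale DR: comm_monoid DR
proof (rule comm_monoidI)
  show "\<one>\<^bsub>DR\<^esub> \<in> carrier DR" by (simp add: DR_one dc_carrier)
  fix A B assume "A \<in> carrier DR" "B \<in> carrier DR"
  then obtain \<rho> s \<rho>' s' where A: "\<rho> \<in> carrier IA" "s \<in> carrier GA" "A = dc \<rho> s"
    and B: "\<rho>' \<in> carrier IA" "s' \<in> carrier GA" "B = dc \<rho>' s'" by (metis DR_cases)
  show "A \<otimes>\<^bsub>DR\<^esub> B \<in> carrier DR" using A B by (simp add: DR_mult dc_carrier)
  show "A \<otimes>\<^bsub>DR\<^esub> B = B \<otimes>\<^bsub>DR\<^esub> A" using A B by (simp add: DR_mult IA.m_comm GA.m_comm)
  show "\<one>\<^bsub>DR\<^esub> \<otimes>\<^bsub>DR\<^esub> A = A" using A by (simp add: DR_mult DR_one)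
  fix C assume "C \<in> carrier DR"
  then obtain \<rho>'' s'' where "\<rho>'' \<in> carrier IA" "s'' \<in> carrier GA" "C = dc \<rho>'' s''" by (metis DR_cases)
  then show "A \<otimes>\<^bsub>DR\<^esub> B \<otimes>\<^bsub>DR\<^esub> C = A \<otimes>\<^bsub>DR\<^esub> (B \<otimes>\<^bsub>DR\<^esub> C)"
    using A B by (simp add: DR_mult IA.m_assoc GA.m_assoc)
qed

section \<open>The unit group of the monoid\<close>

definition unit_class :: "'k idele set \<Rightarrow> 'k dr_pair set" where "unit_class s = dc \<one>\<^bsub>IA\<^esub> s"

lemma unit_class_mult: "s \<in> carrier GA \<Longrightarrow> t \<in> carrier GA \<Longrightarrow> unit_class s \<otimes>\<^bsub>DR\<^esub> unit_class t = unit_class (s \<otimes>\<^bsub>GA\<^esub> t)"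
  by (simp add: unit_class_def DR_mult)

lemma unit_class_one: "unit_class \<one>\<^bsub>GA\<^esub> = \<one>\<^bsub>DR\<^esub>" by (simp add: unit_class_def DR_one)

lemma unit_class_carrier: "s \<in> carrier GA \<Longrightarrow> unit_class s \<in> carrier DR" by (simp add: unit_class_def dc_carrier)

lemma unit_class_Units: "s \<in> carrier GA \<Longrightarrow> unit_class s \<in> Units DR"
  unfolding Units_def using unit_class_mult[of s "inv\<^bsub>GA\<^esub> s"] unit_class_mult[of "inv\<^bsub>GA\<^esub> s" s] unit_class_carrier
  by (auto simp: unit_class_one intro!: bexI[of _ "unit_class (inv\<^bsub>GA\<^esub> s)"])

lemma unit_class_inj: "s \<in> carrier GA \<Longrightarrow> t \<in> carrier GA \<Longrightarrow> unit_class s = unit_class t \<longleftrightarrow> s = t"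
proof
  assume s: "s \<in> carrier GA" "t \<in> carrier GA" "unit_class s = unit_class t"
  then obtain u where u: "u \<in> V" "\<one>\<^bsub>IA\<^esub> = \<one>\<^bsub>IA\<^esub> \<otimes>\<^bsub>IA\<^esub> u" "t = inv\<^bsub>GA\<^esub> (art u) \<otimes>\<^bsub>GA\<^esub> s"
    unfolding unit_class_def by (auto simp: dc_eq_iff)
  then have "u = \<one>\<^bsub>IA\<^esub>" using IA.Units_closed by simp
  then show "s = t" using u(3) s by (simp add: art_V(3))
qed simp

lemma dc_unit: "u \<in> V \<Longrightarrow> s \<in> carrier GA \<Longrightarrow> dc u s = unit_class (art u \<otimes>\<^bsub>GA\<^esub> s)"
proof -
  assume u: "u \<in> V" "s \<in> carrier GA"
  have c: "u \<in> carrier IA" "art u \<in> carrier GA" using u(1) art_V(1) by auto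
  have "unit_class (art u \<otimes>\<^bsub>GA\<^esub> s) = dc u s"
    unfolding unit_class_def using u c by (subst dc_eq_iff) (auto intro!: bexI[of _ u] simp: GA.m_assoc[symmetric])
  then show ?thesis by simp
qed

text \<open>If a class has an inverse, its first component divides an element of \<open>V\<close>
  and is itself in \<open>V\<close>; the action of \<open>V\<close> then moves it into the second
  component.\<close>

lemma Units_DR: "Units DR = unit_class ` carrier GA"
proof
  show "unit_class ` carrier GA \<subseteq> Units DR" using unit_class_Units by blast
  show "Units DR \<subseteq> unit_class ` carrier GA"
  proof
    fix A assume A: "A \<in> Units DR"
    then obtain B where B: "B \<in> carrier DR" "A \<otimes>\<^bsub>DR\<^esub> B = \<one>\<^bsub>DR\<^esub>" "A \<in> carrier DR"
      unfolding Units_def by blast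
    obtain \<rho> s where \<rho>: "\<rho> \<in> carrier IA" "s \<in> carrier GA" "A = dc \<rho> s" using B(3) by (rule DR_cases)
    obtain \<sigma> t where \<sigma>: "\<sigma> \<in> carrier IA" "t \<in> carrier GA" "B = dc \<sigma> t" using B(1) by (rule DR_cases)
    have "dc \<one>\<^bsub>IA\<^esub> \<one>\<^bsub>GA\<^esub> = dc (\<rho> \<otimes>\<^bsub>IA\<^esub> \<sigma>) (s \<otimes>\<^bsub>GA\<^esub> t)" using B(2) \<rho> \<sigma> by (simp add: DR_mult DR_one)
    then obtain u where u: "u \<in> V" "\<rho> \<otimes>\<^bsub>IA\<^esub> \<sigma> = \<one>\<^bsub>IA\<^esub> \<otimes>\<^bsub>IA\<^esub> u" using \<rho> \<sigma> by (auto simp: dc_eq_iff)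
    have uc: "u \<in> carrier IA" "inv\<^bsub>IA\<^esub> u \<in> carrier IA" using u(1) by auto
    have "\<rho> \<otimes>\<^bsub>IA\<^esub> (\<sigma> \<otimes>\<^bsub>IA\<^esub> inv\<^bsub>IA\<^esub> u) = (\<rho> \<otimes>\<^bsub>IA\<^esub> \<sigma>) \<otimes>\<^bsub>IA\<^esub> inv\<^bsub>IA\<^esub> u"
      using \<rho> \<sigma> uc by (simp add: IA.m_assoc)
    also have "\<dots> = \<one>\<^bsub>IA\<^esub>" using u uc by simp
    finally have "\<rho> \<otimes>\<^bsub>IA\<^esub> (\<sigma> \<otimes>\<^bsub>IA\<^esub> inv\<^bsub>IA\<^esub> u) = \<one>\<^bsub>IA\<^esub>" .
    moreover have c: "\<sigma> \<otimes>\<^bsub>IA\<^esub> inv\<^bsub>IA\<^esub> u \<in> carrier IA" using \<sigma> uc by simp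
    moreover have "(\<sigma> \<otimes>\<^bsub>IA\<^esub> inv\<^bsub>IA\<^esub> u) \<otimes>\<^bsub>IA\<^esub> \<rho> = \<one>\<^bsub>IA\<^esub>" using calculation(1) IA.m_comm[OF c \<rho>(1)] by simp
    ultimately have "\<rho> \<in> V" using \<rho>(1) unfolding Units_def by blast
    then have "A = unit_class (art \<rho> \<otimes>\<^bsub>GA\<^esub> s)" using dc_unit \<rho> by simp
    then show "A \<in> unit_class ` carrier GA" using art_V(1)[OF \<open>\<rho> \<in> V\<close>] \<rho>(2) by blast
  qed
qed

sublocale UD: comm_group "units_of DR" by (rule DR.units_comm_group)

subsection \<open>The topology of the unit group\<close>

lemma MM_facts:
  assumes "P \<in> primes"
  shows carrier_li: "carrier (li P) = MM P 0"
    and topspace_li: "topspace (local_integers_topology P) = MM P 0"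
proof -
  interpret D: local_dvr P "localization P" "unif P" by (rule dvr[OF assms])
  show "carrier (li P) = MM P 0" by (rule D.carrier_local_integers)
  have "MM P 0 \<subseteq> topspace (local_topology P)"
  proof -
    have "openin (local_topology P) (carrier (lf P))" unfolding D.openin_local_topology by blast
    then show ?thesis using D.M_carrier openin_subset by blast
  qed
  then show "topspace (local_integers_topology P) = MM P 0"
    unfolding local_integers_topology_def by (simp add: D.carrier_local_integers inf_absorb2)
qed

lemma topspace_IA: "topspace integral_adeles_topology = carrier IA"
  unfolding integral_adeles_topology_def topspace_product_topology IA_simps
  by (rule PiE_cong) (simp add: topspace_li carrier_li)

text \<open>Additive congruence modulo P^n at the places in \<open>F\<close>, meaningful for all
  integral adeles. On \<open>V\<close> and relative to 1 it agrees with membership in the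
  multiplicative group \<open>W F n\<close>.\<close>

definition cong :: "'k set set \<Rightarrow> nat \<Rightarrow> ('k set \<Rightarrow> (nat \<Rightarrow> 'k) set) \<Rightarrow> ('k set \<Rightarrow> (nat \<Rightarrow> 'k) set) \<Rightarrow> bool" where
  "cong F n \<rho> \<rho>' \<longleftrightarrow> (\<forall>P\<in>F. \<rho>' P \<ominus>\<^bsub>lf P\<^esub> \<rho> P \<in> MM P n)"

lemma IA_lf: "\<rho> \<in> carrier IA \<Longrightarrow> P \<in> primes \<Longrightarrow> \<rho> P \<in> MM P 0 \<and> \<rho> P \<in> carrier (lf P)"
proof -
  assume \<rho>: "\<rho> \<in> carrier IA" and P: "P \<in> primes"
  have "\<rho> P \<in> MM P 0" using PiE_mem[OF \<rho>[unfolded IA_simps(1)] P] carrier_li[OF P] by simp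
  then show ?thesis using local_dvr.M_carrier[OF dvr[OF P]] by blast
qed

lemma cong_trans:
  assumes F: "F \<subseteq> primes" and c: "\<rho> \<in> carrier IA" "\<sigma> \<in> carrier IA" "\<tau> \<in> carrier IA"
    and 1: "cong F n \<rho> \<sigma>" and 2: "cong F n \<sigma> \<tau>"
  shows "cong F n \<rho> \<tau>"
  unfolding cong_def
proof
  fix P assume P: "P \<in> F"
  then have Pp: "P \<in> primes" using F by blast
  interpret D: local_dvr P "localization P" "unif P" by (rule dvr[OF Pp])
  have "(\<tau> P \<ominus>\<^bsub>lf P\<^esub> \<sigma> P) \<oplus>\<^bsub>lf P\<^esub> (\<sigma> P \<ominus>\<^bsub>lf P\<^esub> \<rho> P) \<in> MM P n"
    using 1 2 P D.M_add by (simp add: cong_def)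
  then show "\<tau> P \<ominus>\<^bsub>lf P\<^esub> \<rho> P \<in> MM P n"
    using D.K.minus_telescope[of "\<tau> P" "\<sigma> P" "\<rho> P"] IA_lf[OF _ Pp] c by simp
qed

lemma cong_sym:
  assumes F: "F \<subseteq> primes" and c: "\<rho> \<in> carrier IA" "\<sigma> \<in> carrier IA" and 1: "cong F n \<rho> \<sigma>"
  shows "cong F n \<sigma> \<rho>"
  unfolding cong_def
proof
  fix P assume P: "P \<in> F"
  then have Pp: "P \<in> primes" using F by blast
  interpret D: local_dvr P "localization P" "unif P" by (rule dvr[OF Pp])
  have "\<ominus>\<^bsub>lf P\<^esub> (\<sigma> P \<ominus>\<^bsub>lf P\<^esub> \<rho> P) \<in> MM P n" using 1 P D.M_minus by (simp add: cong_def)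
  moreover have "\<ominus>\<^bsub>lf P\<^esub> (\<sigma> P \<ominus>\<^bsub>lf P\<^esub> \<rho> P) = \<rho> P \<ominus>\<^bsub>lf P\<^esub> \<sigma> P"
    using IA_lf[OF _ Pp] c by (simp add: a_minus_def D.K.minus_add D.K.a_comm)
  ultimately show "\<rho> P \<ominus>\<^bsub>lf P\<^esub> \<sigma> P \<in> MM P n" by simp
qed

lemma cong_mult:
  assumes F: "F \<subseteq> primes" and c: "\<rho> \<in> carrier IA" "\<sigma> \<in> carrier IA" "\<tau> \<in> carrier IA" and 1: "cong F n \<rho> \<sigma>"
  shows "cong F n (\<rho> \<otimes>\<^bsub>IA\<^esub> \<tau>) (\<sigma> \<otimes>\<^bsub>IA\<^esub> \<tau>)"
  unfolding cong_def
proof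
  fix P assume P: "P \<in> F"
  then have Pp: "P \<in> primes" using F by blast
  interpret D: local_dvr P "localization P" "unif P" by (rule dvr[OF Pp])
  have "(\<sigma> P \<ominus>\<^bsub>lf P\<^esub> \<rho> P) \<otimes>\<^bsub>lf P\<^esub> \<tau> P \<in> MM P n"
    using 1 P D.M_mult_0(1) IA_lf[OF c(3) Pp] by (simp add: cong_def)
  then show "(\<sigma> \<otimes>\<^bsub>IA\<^esub> \<tau>) P \<ominus>\<^bsub>lf P\<^esub> (\<rho> \<otimes>\<^bsub>IA\<^esub> \<tau>) P \<in> MM P n"
    using D.K.minus_distr(2)[of "\<sigma> P" "\<rho> P" "\<tau> P"] IA_lf[OF _ Pp] c Pp by (simp add: IA_simps(2))
qed

lemma W_cong: assumes F: "F \<subseteq> primes" shows "w \<in> W F n \<longleftrightarrow> w \<in> V \<and> cong F n \<one>\<^bsub>IA\<^esub> w"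
proof -
  have "w P \<in> UU P n \<longleftrightarrow> w P \<ominus>\<^bsub>lf P\<^esub> \<one>\<^bsub>IA\<^esub> P \<in> MM P n" if "w \<in> V" "P \<in> F" for P
  proof -
    have Pp: "P \<in> primes" using that F by blast
    interpret D: local_dvr P "localization P" "unif P" by (rule dvr[OF Pp])
    show ?thesis using IA_lf[OF IA.Units_closed[OF that(1)] Pp] Pp by (simp add: D.U1_def IA_simps(4))
  qed
  then show ?thesis unfolding W_def cong_def by blast
qed

lemma cong_W:
  assumes F: "F \<subseteq> primes" and \<rho>: "\<rho> \<in> carrier IA" and w: "w \<in> W F n"
  shows "cong F n \<rho> (\<rho> \<otimes>\<^bsub>IA\<^esub> w)"
proof -
  have wV: "w \<in> V" "w \<in> carrier IA" using w W_V by auto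
  have "cong F n \<one>\<^bsub>IA\<^esub> w" using w W_cong[OF F] by blast
  then have "cong F n (\<one>\<^bsub>IA\<^esub> \<otimes>\<^bsub>IA\<^esub> \<rho>) (w \<otimes>\<^bsub>IA\<^esub> \<rho>)"
    by (rule cong_mult[OF F IA.one_closed wV(2) \<rho>])
  then show ?thesis unfolding IA.l_one[OF \<rho>] IA.m_comm[OF wV(2) \<rho>] .
qed

text \<open>The congruences constrain finitely many components, and each local condition is open
  because the filtration is additive.\<close>

lemma openin_IA_box:
  assumes F: "level F n" and \<rho>: "\<rho> \<in> carrier IA"
  shows "openin integral_adeles_topology {\<rho>' \<in> carrier IA. cong F n \<rho> \<rho>'}"
proof -
  have F': "finite F" "F \<subseteq> primes" using F by (auto simp: level_def)
  define B where "B = (\<lambda>P. if P \<in> F then {A \<in> MM P 0. A \<ominus>\<^bsub>lf P\<^esub> \<rho> P \<in> MM P n} else MM P 0)"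
  have eq: "{\<rho>' \<in> carrier IA. cong F n \<rho> \<rho>'} = (\<Pi>\<^sub>E P\<in>primes. B P)"
  proof (intro Set.set_eqI iffI)
    fix \<rho>' assume \<rho>': "\<rho>' \<in> {\<rho>' \<in> carrier IA. cong F n \<rho> \<rho>'}"
    then have "\<rho>' P \<in> B P" if "P \<in> primes" for P
      using IA_lf[of \<rho>' P] that by (auto simp: B_def cong_def)
    then show "\<rho>' \<in> (\<Pi>\<^sub>E P\<in>primes. B P)" using \<rho>' by (auto simp: IA_simps(1) PiE_iff)
  next
    fix \<rho>' assume \<rho>': "\<rho>' \<in> (\<Pi>\<^sub>E P\<in>primes. B P)"
    have "\<rho>' P \<in> carrier (li P)" if P: "P \<in> primes" for P
      using PiE_mem[OF \<rho>' P] carrier_li[OF P] by (auto simp: B_def split: if_splits)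
    moreover have "\<rho>' P \<ominus>\<^bsub>lf P\<^esub> \<rho> P \<in> MM P n" if P: "P \<in> F" for P
      using PiE_mem[OF \<rho>', of P] P F'(2) by (auto simp: B_def)
    ultimately show "\<rho>' \<in> {\<rho>' \<in> carrier IA. cong F n \<rho> \<rho>'}"
      using \<rho>' by (auto simp: IA_simps(1) cong_def PiE_iff)
  qed
  have open_B: "openin (local_integers_topology P) (B P)" if P: "P \<in> primes" for P
  proof (cases "P \<in> F")
    case False
    then show ?thesis using openin_topspace[of "local_integers_topology P"] topspace_li[OF P] by (simp add: B_def)
  next
    case True
    interpret D: local_dvr P "localization P" "unif P" by (rule dvr[OF P])
    show ?thesis unfolding D.openin_local_integers_topology
    proof (intro conjI ballI)
      show "B P \<subseteq> D.M 0" by (auto simp: B_def)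
      fix A assume "A \<in> B P"
      then have A: "A \<in> D.M 0" "A \<ominus>\<^bsub>lf P\<^esub> \<rho> P \<in> D.M n" using True by (auto simp: B_def)
      have "C \<in> B P" if C: "C \<in> D.M 0" "C \<ominus>\<^bsub>lf P\<^esub> A \<in> D.M n" for C
        using D.M_add[OF C(2) A(2)] D.K.minus_telescope[of C A "\<rho> P"] True C(1)
          D.M_carrier[OF A(1)] D.M_carrier[OF C(1)] IA_lf[OF \<rho> P] by (simp add: B_def)
      then show "\<exists>n. \<forall>C\<in>D.M 0. C \<ominus>\<^bsub>lf P\<^esub> A \<in> D.M n \<longrightarrow> C \<in> B P" by blast
    qed
  qed
  have "{P \<in> primes. B P \<noteq> topspace (local_integers_topology P)} \<subseteq> F"
    by (auto simp: B_def topspace_li)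
  then have "finite {P \<in> primes. B P \<noteq> topspace (local_integers_topology P)}" using F'(1) finite_subset by blast
  then show ?thesis unfolding eq integral_adeles_topology_def openin_PiE_gen using open_B by blast
qed

text \<open>The preimage under \<open>art\<close> is stable under multiplication by the open
  subgroup \<open>W F n\<close>, hence open.\<close>

lemma openin_GA_coset:
  assumes F: "level F n" and s: "s \<in> carrier GA"
  shows "openin galois_ab_topology {art w \<otimes>\<^bsub>GA\<^esub> s | w. w \<in> W F n}" (is "openin _ ?N")
  unfolding openin_GA openin_finite_ideles
proof (intro conjI ballI)
  show "?N \<subseteq> carrier GA" using s W_X by auto
  show "{x \<in> carrier FI. art x \<in> ?N} \<subseteq> carrier FI" by blast
  fix x assume "x \<in> {x \<in> carrier FI. art x \<in> ?N}"
  then obtain w where x: "x \<in> carrier FI" "w \<in> W F n" "art x = art w \<otimes>\<^bsub>GA\<^esub> s" by blast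
  have "x \<otimes>\<^bsub>FI\<^esub> w' \<in> {x \<in> carrier FI. art x \<in> ?N}" if w': "w' \<in> W F n" for w'
  proof -
    have c: "w \<in> carrier FI" "w' \<in> carrier FI" using x w' W_X by auto
    have "art (x \<otimes>\<^bsub>FI\<^esub> w') = art (w \<otimes>\<^bsub>FI\<^esub> w') \<otimes>\<^bsub>GA\<^esub> s"
      using x c s by (simp add: art_mult GA.m_ac)
    moreover have "w \<otimes>\<^bsub>FI\<^esub> w' \<in> W F n" using subgroup.m_closed[OF W_subgroup[OF F] x(2) w'] .
    ultimately show ?thesis using x(1) c by blast
  qed
  then show "\<exists>F n. level F n \<and> (\<forall>w\<in>W F n. x \<otimes>\<^bsub>FI\<^esub> w \<in> {x \<in> carrier FI. art x \<in> ?N})" using F by blast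
qed

text \<open>A set stable under the action of \<open>V\<close> is the full preimage of its image, so
  the image is open in the quotient as soon as the set is open in the product. The last assumption
  provides a uniform box around each of its points.\<close>

lemma openin_DR_image:
  assumes S: "S \<subseteq> carrier IA \<times> carrier GA"
    and sat: "\<And>\<rho> s u. (\<rho>, s) \<in> S \<Longrightarrow> u \<in> V \<Longrightarrow> (\<rho> \<otimes>\<^bsub>IA\<^esub> u, inv\<^bsub>GA\<^esub> (art u) \<otimes>\<^bsub>GA\<^esub> s) \<in> S"
    and F: "level F n"
    and op: "\<And>\<rho> s \<rho>' w. (\<rho>, s) \<in> S \<Longrightarrow> \<rho>' \<in> carrier IA \<Longrightarrow> cong F n \<rho> \<rho>' \<Longrightarrow> w \<in> W F n \<Longrightarrow>
      (\<rho>', art w \<otimes>\<^bsub>GA\<^esub> s) \<in> S"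
  shows "openin deligne_ribet_topology ((\<lambda>(\<rho>, s). dc \<rho> s) ` S)"
proof -
  let ?f = "\<lambda>(\<rho>, s). dc \<rho> s"
  let ?T = "prod_topology integral_adeles_topology galois_ab_topology :: 'k dr_pair topology"
  have top: "topspace ?T = carrier IA \<times> carrier GA" by (simp add: topspace_IA topspace_GA)
  have "{x \<in> topspace ?T. ?f x \<in> ?f ` S} = S"
  proof
    show "S \<subseteq> {x \<in> topspace ?T. ?f x \<in> ?f ` S}" using S top by auto
    show "{x \<in> topspace ?T. ?f x \<in> ?f ` S} \<subseteq> S"
    proof clarify
      fix \<rho> s \<rho>' s' assume a: "(\<rho>, s) \<in> topspace ?T" "dc \<rho> s = dc \<rho>' s'" "(\<rho>', s') \<in> S"
      have c: "\<rho> \<in> carrier IA" "s \<in> carrier GA" "\<rho>' \<in> carrier IA" "s' \<in> carrier GA"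
        using a(1)[unfolded top] S a(3) by blast+
      obtain u where "u \<in> V" "\<rho> = \<rho>' \<otimes>\<^bsub>IA\<^esub> u" "s = inv\<^bsub>GA\<^esub> (art u) \<otimes>\<^bsub>GA\<^esub> s'"
        using dc_eq_iff[OF c(3,4,1,2)] a(2) by blast
      then show "(\<rho>, s) \<in> S" using sat[OF a(3)] by simp
    qed
  qed
  moreover have "openin ?T S"
  proof (subst openin_subopen, intro ballI)
    fix x assume x: "x \<in> S"
    obtain \<rho> s where xs: "x = (\<rho>, s)" by (cases x)
    then have c: "\<rho> \<in> carrier IA" "s \<in> carrier GA" using x S by auto
    let ?A = "{\<rho>' \<in> carrier IA. cong F n \<rho> \<rho>'}" and ?B = "{art w \<otimes>\<^bsub>GA\<^esub> s | w. w \<in> W F n}"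
    have "openin ?T (?A \<times> ?B)"
      using openin_IA_box[OF F c(1)] openin_GA_coset[OF F c(2)] by (simp add: openin_prod_Times_iff)
    moreover have "x \<in> ?A \<times> ?B"
    proof -
      have 1: "\<one>\<^bsub>FI\<^esub> \<in> W F n" by (rule subgroup.one_closed[OF W_subgroup[OF F]])
      have F': "F \<subseteq> primes" using F by (simp add: level_def)
      have "cong F n \<rho> \<rho>" using cong_W[OF F' c(1) 1] c(1) by (simp flip: V_one)
      moreover have "s = art \<one>\<^bsub>FI\<^esub> \<otimes>\<^bsub>GA\<^esub> s" using c(2) by (simp add: art_one)
      ultimately show ?thesis using xs c 1 by blast
    qed
    moreover have "?A \<times> ?B \<subseteq> S" using op x xs by blast
    ultimately show "\<exists>U. openin ?T U \<and> x \<in> U \<and> U \<subseteq> S" by blast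
  qed
  moreover have "?f ` S \<subseteq> ?f ` topspace ?T" using S top by auto
  ultimately show ?thesis
    unfolding deligne_ribet_topology_def openin_quotient_topology by simp
qed

text \<open>
  Two classes \<open>[1, art x]\<close> and \<open>[1, art y]\<close> are separated by the condition that a class is
  represented by a pair \<open>(\<rho>, art (v y))\<close> with \<open>v\<close> in \<open>V\<close> and \<open>\<rho> v\<close> close to \<open>1\<close>: it is open and closed,
  and as \<open>K\<^sup>\<times>\<close> is closed, it fails for \<open>[1, art x]\<close> once \<open>\<rho> v\<close> has to be close enough to \<open>1\<close>.
\<close>
lemma Hausdorff_DR_units: "Hausdorff_space (deligne_ribet_units_topology :: 'k dr_pair set topology)"
proof -
  let ?f = "\<lambda>(\<rho>, s). dc \<rho> s"
  have sep: "\<exists>A B. openin deligne_ribet_topology A \<and> openin deligne_ribet_topology B \<and>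
      unit_class s \<in> A \<and> unit_class t \<in> B \<and> disjnt A B" if st: "s \<in> carrier GA" "t \<in> carrier GA" "s \<noteq> t" for s t
  proof -
    obtain x y where x: "x \<in> carrier FI" "s = art x" and y: "y \<in> carrier FI" "t = art y"
      using st(1,2)[unfolded carrier_GA] by (elim imageE)
    define z where "z = inv\<^bsub>FI\<^esub> x \<otimes>\<^bsub>FI\<^esub> y"
    have z: "z \<in> carrier FI" "z \<notin> DK" 
      using x y st(3) art_eq_iff[OF x(1) y(1)] by (simp_all add: z_def)
    obtain F n where F: "level F n" "\<And>w. w \<in> W F n \<Longrightarrow> z \<otimes>\<^bsub>FI\<^esub> w \<notin> DK" using DK_closed[OF z] by blast
    have F': "F \<subseteq> primes" using F(1) by (simp add: level_def)
    define S where "S = {(\<rho>, r). \<rho> \<in> carrier IA \<and> r \<in> carrier GA \<and>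
       (\<exists>v\<in>V. cong F n \<one>\<^bsub>IA\<^esub> (\<rho> \<otimes>\<^bsub>IA\<^esub> v) \<and> r = art v \<otimes>\<^bsub>GA\<^esub> t)}"
    define S' where "S' = carrier IA \<times> carrier GA - S"
    have SE: "\<exists>v. \<rho> \<in> carrier IA \<and> r \<in> carrier GA \<and> v \<in> V \<and> cong F n \<one>\<^bsub>IA\<^esub> (\<rho> \<otimes>\<^bsub>IA\<^esub> v) \<and>
        r = art v \<otimes>\<^bsub>GA\<^esub> t" if "(\<rho>, r) \<in> S" for \<rho> r
      using that unfolding S_def by blast
    have SI: "(\<rho>, r) \<in> S" if "\<rho> \<in> carrier IA" "v \<in> V" "cong F n \<one>\<^bsub>IA\<^esub> (\<rho> \<otimes>\<^bsub>IA\<^esub> v)"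
        "r = art v \<otimes>\<^bsub>GA\<^esub> t" for \<rho> r v
    proof -
      have "r \<in> carrier GA" unfolding that(4) by (rule GA.m_closed[OF art_V(1)[OF that(2)] st(2)])
      then show ?thesis unfolding S_def using that by blast
    qed
    have satS: "(\<rho> \<otimes>\<^bsub>IA\<^esub> u, inv\<^bsub>GA\<^esub> (art u) \<otimes>\<^bsub>GA\<^esub> r) \<in> S" if a: "(\<rho>, r) \<in> S" and u: "u \<in> V" for \<rho> r u
    proof -
      obtain v where v: "\<rho> \<in> carrier IA" "r \<in> carrier GA" "v \<in> V" "cong F n \<one>\<^bsub>IA\<^esub> (\<rho> \<otimes>\<^bsub>IA\<^esub> v)"
        "r = art v \<otimes>\<^bsub>GA\<^esub> t" using SE[OF a] by blast
      \<comment> \<open>Moving the representative by \<open>u\<close> is compensated by dividing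
        \<open>v\<close> by \<open>u\<close>: the product of the first component with
        \<open>v\<close> stays the same.\<close>
      let ?v = "inv\<^bsub>IA\<^esub> u \<otimes>\<^bsub>IA\<^esub> v"
      have vc: "v \<in> carrier IA" "u \<in> carrier IA" "?v \<in> V" "inv\<^bsub>IA\<^esub> u \<in> V" "inv\<^bsub>IA\<^esub> u \<in> carrier IA"
          "art u \<in> carrier GA" "art v \<in> carrier GA"
        using v(3) u art_V(1) by auto
      have "(\<rho> \<otimes>\<^bsub>IA\<^esub> u) \<otimes>\<^bsub>IA\<^esub> ?v = \<rho> \<otimes>\<^bsub>IA\<^esub> ((u \<otimes>\<^bsub>IA\<^esub> inv\<^bsub>IA\<^esub> u) \<otimes>\<^bsub>IA\<^esub> v)"
        using v(1) vc by (simp add: IA.m_assoc del: IA.Units_r_inv)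
      also have "\<dots> = \<rho> \<otimes>\<^bsub>IA\<^esub> v" using u vc by simp
      finally have 1: "(\<rho> \<otimes>\<^bsub>IA\<^esub> u) \<otimes>\<^bsub>IA\<^esub> ?v = \<rho> \<otimes>\<^bsub>IA\<^esub> v" .
      have 2: "inv\<^bsub>GA\<^esub> (art u) \<otimes>\<^bsub>GA\<^esub> r = art ?v \<otimes>\<^bsub>GA\<^esub> t"
        using u v(3) vc st(2) by (simp add: v(5) art_V(2,4) GA.m_assoc)
      show ?thesis
      proof (rule SI[OF _ vc(3) _ 2])
        show "\<rho> \<otimes>\<^bsub>IA\<^esub> u \<in> carrier IA" using v(1) vc by simp
        show "cong F n \<one>\<^bsub>IA\<^esub> ((\<rho> \<otimes>\<^bsub>IA\<^esub> u) \<otimes>\<^bsub>IA\<^esub> ?v)" unfolding 1 by (rule v(4))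
      qed
    qed
    \<comment> \<open>The new witness is \<open>v\<close> times \<open>w\<close>. It accounts for
      the factor \<open>art w\<close>, and multiplying by \<open>w\<close> preserves the congruence
      to 1.\<close>
    have opS: "(\<rho>', art w \<otimes>\<^bsub>GA\<^esub> r) \<in> S"
      if a: "(\<rho>, r) \<in> S" and \<rho>': "\<rho>' \<in> carrier IA" "cong F n \<rho> \<rho>'" and w: "w \<in> W F n" for \<rho> r \<rho>' w
    proof -
      obtain v where v: "\<rho> \<in> carrier IA" "r \<in> carrier GA" "v \<in> V" "cong F n \<one>\<^bsub>IA\<^esub> (\<rho> \<otimes>\<^bsub>IA\<^esub> v)"
        "r = art v \<otimes>\<^bsub>GA\<^esub> t" using SE[OF a] by blast
      have wV: "w \<in> V" using w W_V by blast
      have c: "v \<in> carrier IA" "w \<in> carrier IA" "art v \<in> carrier GA" "art w \<in> carrier GA"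
        using v(3) wV art_V(1) by auto
      have "cong F n (\<rho> \<otimes>\<^bsub>IA\<^esub> v) (\<rho>' \<otimes>\<^bsub>IA\<^esub> v)" by (rule cong_mult[OF F' v(1) \<rho>'(1) c(1) \<rho>'(2)])
      moreover have "cong F n (\<rho>' \<otimes>\<^bsub>IA\<^esub> v) ((\<rho>' \<otimes>\<^bsub>IA\<^esub> v) \<otimes>\<^bsub>IA\<^esub> w)"
        by (rule cong_W[OF F' _ w]) (use \<rho>'(1) c in simp)
      ultimately have "cong F n \<one>\<^bsub>IA\<^esub> ((\<rho>' \<otimes>\<^bsub>IA\<^esub> v) \<otimes>\<^bsub>IA\<^esub> w)"
        using cong_trans[OF F' _ _ _ v(4)] cong_trans[OF F'] v(1) \<rho>'(1) c
        by (meson IA.m_closed IA.one_closed)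
      then have "cong F n \<one>\<^bsub>IA\<^esub> (\<rho>' \<otimes>\<^bsub>IA\<^esub> (v \<otimes>\<^bsub>IA\<^esub> w))" using \<rho>'(1) c by (simp add: IA.m_assoc)
      moreover have "art w \<otimes>\<^bsub>GA\<^esub> r = art (v \<otimes>\<^bsub>IA\<^esub> w) \<otimes>\<^bsub>GA\<^esub> t"
        using v(3) wV c st(2) by (simp add: v(5) art_V(2) GA.m_ac)
      moreover have "v \<otimes>\<^bsub>IA\<^esub> w \<in> V" using v(3) wV by simp
      ultimately show ?thesis using SI \<rho>'(1) by blast
    qed
    have S: "S \<subseteq> carrier IA \<times> carrier GA" by (auto simp: S_def)
    have oS: "openin deligne_ribet_topology (?f ` S)"
      by (rule openin_DR_image[OF S satS F(1) opS])
    \<comment> \<open>The complement inherits both stability properties since every move is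
      reversible: \<open>u\<close> and \<open>w\<close> have inverses in their groups and
      \<open>cong\<close> is symmetric. A move from the complement into \<open>S\<close> would,
      undone, contradict the stability of \<open>S\<close>.\<close>
    have oS': "openin deligne_ribet_topology (?f ` S')"
    proof (rule openin_DR_image[OF _ _ F(1)])
      show "S' \<subseteq> carrier IA \<times> carrier GA" by (auto simp: S'_def)
    next
      fix \<rho> r u assume r: "(\<rho>, r) \<in> S'" and u: "u \<in> V"
      then have c: "\<rho> \<in> carrier IA" "r \<in> carrier GA" "u \<in> carrier IA" "inv\<^bsub>IA\<^esub> u \<in> V" "art u \<in> carrier GA"
        using art_V(1) by (auto simp: S'_def)
      show "(\<rho> \<otimes>\<^bsub>IA\<^esub> u, inv\<^bsub>GA\<^esub> (art u) \<otimes>\<^bsub>GA\<^esub> r) \<in> S'"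
      proof (rule ccontr)
        assume "\<not> ?thesis"
        then have "(\<rho> \<otimes>\<^bsub>IA\<^esub> u, inv\<^bsub>GA\<^esub> (art u) \<otimes>\<^bsub>GA\<^esub> r) \<in> S" using c by (simp add: S'_def)
        from satS[OF this c(4)] have "(\<rho>, r) \<in> S"
          using c u by (simp add: IA.m_assoc art_V(4) GA.m_assoc[symmetric])
        then show False using r by (simp add: S'_def)
      qed
    next
      fix \<rho> r \<rho>' w
      assume r: "(\<rho>, r) \<in> S'" and \<rho>': "\<rho>' \<in> carrier IA" "cong F n \<rho> \<rho>'" and w: "w \<in> W F n"
      have c: "\<rho> \<in> carrier IA" "r \<in> carrier GA" "art w \<in> carrier GA" "w \<in> carrier FI"
        using r w W_X by (auto simp: S'_def)
      show "(\<rho>', art w \<otimes>\<^bsub>GA\<^esub> r) \<in> S'"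
      proof (rule ccontr)
        assume "\<not> ?thesis"
        then have "(\<rho>', art w \<otimes>\<^bsub>GA\<^esub> r) \<in> S" using c \<rho>' by (simp add: S'_def)
        from opS[OF this c(1) cong_sym[OF F' c(1) \<rho>'] subgroup.m_inv_closed[OF W_subgroup[OF F(1)] w]]
        have "(\<rho>, r) \<in> S" using c by (simp add: art_inv GA.m_assoc[symmetric])
        then show False using r by (simp add: S'_def)
      qed
    qed
    have "disjnt (?f ` S) (?f ` S')"
    proof (unfold disjnt_iff, clarify)
      fix \<rho> r \<rho>' r' assume a: "(\<rho>, r) \<in> S" "(\<rho>', r') \<in> S'" "dc \<rho> r = dc \<rho>' r'"
      then obtain u where "u \<in> V" "\<rho>' = \<rho> \<otimes>\<^bsub>IA\<^esub> u" "r' = inv\<^bsub>GA\<^esub> (art u) \<otimes>\<^bsub>GA\<^esub> r"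
        using dc_eq_iff[of \<rho> r \<rho>' r'] by (auto simp: S'_def S_def)
      then show False using satS[OF a(1)] a(2) by (simp add: S'_def)
    qed
    moreover have "(\<one>\<^bsub>IA\<^esub>, t) \<in> S"
    proof -
      have "\<one>\<^bsub>IA\<^esub> \<in> W F n" using subgroup.one_closed[OF W_subgroup[OF F(1)]] by (simp add: V_one)
      then have "cong F n \<one>\<^bsub>IA\<^esub> \<one>\<^bsub>IA\<^esub>" using W_cong[OF F'] by blast
      then show ?thesis using SI[of "\<one>\<^bsub>IA\<^esub>" "\<one>\<^bsub>IA\<^esub>" t] st(2) by (simp add: art_V(3))
    qed
    \<comment> \<open>With first component 1 the witness \<open>v\<close> itself lies in
      \<open>W F n\<close>. Then \<open>art x = art (y v)\<close> puts z v into K^*, which the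
      choice of \<open>F\<close> and \<open>n\<close> excludes.\<close>
    moreover have "(\<one>\<^bsub>IA\<^esub>, s) \<in> S'"
    proof (rule ccontr)
      assume "\<not> ?thesis"
      then obtain v where v: "v \<in> V" "cong F n \<one>\<^bsub>IA\<^esub> (\<one>\<^bsub>IA\<^esub> \<otimes>\<^bsub>IA\<^esub> v)" "s = art v \<otimes>\<^bsub>GA\<^esub> t"
        using st(1) by (auto simp: S'_def S_def)
      then have vW: "v \<in> W F n" using W_cong[OF F'] IA.Units_closed by simp
      have vc: "v \<in> carrier FI" using v(1) V_FI by blast
      have "art x = art (y \<otimes>\<^bsub>FI\<^esub> v)" using v(3) x y vc by (simp add: art_mult GA.m_comm)
      then have "inv\<^bsub>FI\<^esub> x \<otimes>\<^bsub>FI\<^esub> (y \<otimes>\<^bsub>FI\<^esub> v) \<in> DK" using art_eq_iff x(1) y(1) vc by simp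
      then have "z \<otimes>\<^bsub>FI\<^esub> v \<in> DK" using x(1) y(1) vc by (simp add: z_def FI.m_assoc)
      then show False using F(2)[OF vW] by blast
    qed
    ultimately have "unit_class t \<in> ?f ` S" "unit_class s \<in> ?f ` S'" "disjnt (?f ` S') (?f ` S)"
      by (auto simp: unit_class_def image_iff disjnt_sym intro: bexI[of _ "(\<one>\<^bsub>IA\<^esub>, t)"] bexI[of _ "(\<one>\<^bsub>IA\<^esub>, s)"])
    then show ?thesis using oS oS' by (intro exI[of _ "?f ` S'"] exI[of _ "?f ` S"] conjI)
  qed
  show ?thesis
    unfolding Hausdorff_space_def
  proof (intro allI impI, elim conjE)
    fix a b :: "'k dr_pair set"
    assume ab: "a \<in> topspace deligne_ribet_units_topology" "b \<in> topspace deligne_ribet_units_topology" "a \<noteq> b"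
    then have U: "a \<in> Units DR" "b \<in> Units DR" by (auto simp: deligne_ribet_units_topology_def)
    then obtain s t where "s \<in> carrier GA" "a = unit_class s" "t \<in> carrier GA" "b = unit_class t" by (auto simp: Units_DR)
    then obtain A B where AB: "openin deligne_ribet_topology A" "openin deligne_ribet_topology B"
      "a \<in> A" "b \<in> B" "disjnt A B" using sep[of s t] ab(3) by blast
    have "openin deligne_ribet_units_topology (A \<inter> Units DR)" "openin deligne_ribet_units_topology (B \<inter> Units DR)"
      unfolding deligne_ribet_units_topology_def openin_subtopology using AB by blast+
    then show "\<exists>U V. openin deligne_ribet_units_topology U \<and> openin deligne_ribet_units_topology V \<and>
        a \<in> U \<and> b \<in> V \<and> disjnt U V"
      using AB U by (intro exI[of _ "A \<inter> Units DR"] exI[of _ "B \<inter> Units DR"]) (auto simp: disjnt_iff)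
  qed
qed

section \<open>The explicit homomorphism and its continuity\<close>

definition explicit_hom :: "('k set \<Rightarrow> (nat \<Rightarrow> 'k) set) \<Rightarrow> 'k dr_pair set" where
  "explicit_hom = (\<lambda>x\<in>carrier FI. unit_class (inv\<^bsub>GA\<^esub> (art x)))"

lemma explicit_hom_hom: "explicit_hom \<in> hom FI (units_of DR)"
proof (rule homI)
  fix x y assume x: "x \<in> carrier FI" and y: "y \<in> carrier FI"
  show "explicit_hom x \<in> carrier (units_of DR)" using x by (simp add: explicit_hom_def units_of_carrier unit_class_Units)
  show "explicit_hom (x \<otimes>\<^bsub>FI\<^esub> y) = explicit_hom x \<otimes>\<^bsub>units_of DR\<^esub> explicit_hom y"
    using x y by (simp add: explicit_hom_def units_of_mult unit_class_mult art_mult GA.inv_mult)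
qed

lemma continuous_inv_art: "continuous_map finite_ideles_topology galois_ab_topology (\<lambda>x. inv\<^bsub>GA\<^esub> (art x))"
  unfolding continuous_map
proof (intro conjI allI impI)
  show "(\<lambda>x. inv\<^bsub>GA\<^esub> (art x)) ` topspace finite_ideles_topology \<subseteq> topspace galois_ab_topology"
    by (auto simp: topspace_GA)
  fix U :: "'k idele set set" assume "openin galois_ab_topology U"
  then have U: "openin finite_ideles_topology {x \<in> carrier FI. art x \<in> U}" by (simp add: openin_GA)
  show "openin finite_ideles_topology {x \<in> topspace finite_ideles_topology. inv\<^bsub>GA\<^esub> (art x) \<in> U}"
    unfolding openin_finite_ideles
  proof (intro conjI ballI)
    show "{x \<in> topspace finite_ideles_topology. inv\<^bsub>GA\<^esub> (art x) \<in> U} \<subseteq> carrier FI" by auto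
    fix x assume "x \<in> {x \<in> topspace finite_ideles_topology. inv\<^bsub>GA\<^esub> (art x) \<in> U}"
    then have x: "x \<in> carrier FI" "art (inv\<^bsub>FI\<^esub> x) \<in> U" by (auto simp: art_inv)
    then obtain F n where F: "level F n" "\<And>w. w \<in> W F n \<Longrightarrow> inv\<^bsub>FI\<^esub> x \<otimes>\<^bsub>FI\<^esub> w \<in> {x \<in> carrier FI. art x \<in> U}"
      using U unfolding openin_finite_ideles by (metis (mono_tags, lifting) FI.inv_closed mem_Collect_eq)
    have "x \<otimes>\<^bsub>FI\<^esub> w \<in> {x \<in> topspace finite_ideles_topology. inv\<^bsub>GA\<^esub> (art x) \<in> U}" if w: "w \<in> W F n" for w
    proof -
      have wc: "w \<in> carrier FI" using W_X[OF w] .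
      have "art (inv\<^bsub>FI\<^esub> x \<otimes>\<^bsub>FI\<^esub> inv\<^bsub>FI\<^esub> w) \<in> U"
        using F(2)[OF subgroup.m_inv_closed[OF W_subgroup[OF F(1)] w]] by blast
      then show ?thesis using x wc by (simp add: art_mult art_inv GA.inv_mult)
    qed
    then show "\<exists>F n. level F n \<and> (\<forall>w\<in>W F n. x \<otimes>\<^bsub>FI\<^esub> w \<in>
        {x \<in> topspace finite_ideles_topology. inv\<^bsub>GA\<^esub> (art x) \<in> U})" using F(1) by blast
  qed
qed

lemma explicit_hom_continuous: "continuous_map finite_ideles_topology deligne_ribet_units_topology explicit_hom"
proof -
  let ?T = "prod_topology integral_adeles_topology galois_ab_topology :: 'k dr_pair topology"
  have "continuous_map finite_ideles_topology ?T (\<lambda>x. (\<one>\<^bsub>IA\<^esub>, inv\<^bsub>GA\<^esub> (art x)))"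
    unfolding continuous_map_paired using continuous_inv_art by (simp add: topspace_IA)
  moreover have "continuous_map ?T deligne_ribet_topology (\<lambda>(\<rho>, s). dc \<rho> s)"
    unfolding deligne_ribet_topology_def by (rule quotient_imp_continuous_map[OF quotient_map_quotient_topology])
  ultimately have "continuous_map finite_ideles_topology deligne_ribet_topology
      ((\<lambda>(\<rho>, s). dc \<rho> s) \<circ> (\<lambda>x. (\<one>\<^bsub>IA\<^esub>, inv\<^bsub>GA\<^esub> (art x))))" by (rule continuous_map_compose)
  then have "continuous_map finite_ideles_topology deligne_ribet_topology explicit_hom"
    by (rule continuous_map_eq) (simp add: explicit_hom_def unit_class_def)
  moreover have "explicit_hom \<in> topspace finite_ideles_topology \<rightarrow> Units DR"
    by (auto simp: explicit_hom_def unit_class_Units)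
  ultimately show ?thesis unfolding deligne_ribet_units_topology_def continuous_map_in_subtopology by blast
qed

end

section \<open>The homomorphism from the finite ideles\<close>

context imaginary_quadratic begin

lemma not_mem_prime_unit:
  assumes Q: "Q \<in> primes" and a: "algebraic_int a" "a \<notin> Q"
  shows "a \<noteq> 0" "inverse a \<in> localization Q"
proof -
  show "a \<noteq> 0" using a(2) ideal_integersD(2)[OF maximal_idealD(1)[OF Q]] by auto
  have "inverse a = 1 / a" by (simp add: inverse_eq_divide)
  then show "inverse a \<in> localization Q" unfolding localization_def using a algebraic_int_1 by blast
qed

lemma primes_incomparable:
  assumes P: "P \<in> primes" and Q: "Q \<in> primes" and ne: "Q \<noteq> P" shows "\<exists>p\<in>P. p \<notin> Q"
proof (rule ccontr)
  assume "\<not> ?thesis"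
  then have PQ: "P \<subseteq> Q" by blast
  note I = ideal_integersD[OF maximal_idealD(1)[OF Q]]
  obtain q where q: "q \<in> Q" "q \<notin> P" using PQ ne by blast
  then obtain t where t: "algebraic_int t" "1 - q * t \<in> P" using maximal_idealD(3)[OF P] I(1) by blast
  have "1 - q * t \<in> Q" "t * q \<in> Q" using t PQ I(4)[OF q(1)] by auto
  then have "(1 - q * t) + t * q \<in> Q" by (rule I(3))
  then show False using maximal_idealD(2)[OF Q] by simp
qed

lemma power_not_mem_prime:
  assumes Q: "Q \<in> primes" and a: "algebraic_int a" "a \<notin> Q" shows "a ^ n \<notin> Q"
proof (induction n)
  case 0 show ?case using maximal_idealD(2)[OF Q] by simp
next
  case (Suc n)
  then show ?case using maximal_idealD(4)[OF Q a(1) algebraic_int_power[OF a(1)] a(2)] by simp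
qed

lemma diag_IA: "algebraic_int a \<Longrightarrow> diag a \<in> carrier IA"
proof -
  assume a: "algebraic_int a"
  have "to_local_field P a \<in> carrier (li P)" if P: "P \<in> primes" for P
  proof -
    interpret D: local_dvr P "localization P" "unif P" by (rule dvr[OF P])
    show ?thesis using D.integers_R[OF a] by (simp add: D.carrier_local_integers D.to_local_M D.L_zero)
  qed
  then show ?thesis by (simp add: IA_simps(1) diagonal_def)
qed

text \<open>The power of the uniformizer generates P^n at P and is a unit at almost all other
  places. At each of the finitely many remaining Q, the \<open>n\<close>-th power of an element of P
  outside Q is adjoined, which is a unit there.\<close>

lemma local_generators:
  assumes P: "P \<in> primes"
  shows "\<exists>S. finite S \<and> S \<subseteq> ipow P n \<and>
    (\<forall>Q\<in>primes. \<exists>a\<in>S. if Q = P then a = unif P ^ n else a \<notin> Q)"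
proof -
  note ip = ipow(4)[OF maximal_idealD(1)[OF P]]
  interpret D: local_dvr P "localization P" "unif P" by (rule dvr[OF P])
  have pa: "algebraic_int (unif P)" using unif(1)[OF P] ideal_integersD(1)[OF maximal_idealD(1)[OF P]] by blast
  define B where "B = {Q \<in> primes. unif P \<in> Q}"
  have "finite B" unfolding B_def by (rule finite_maximal_ideals_containing[OF D.pi_nz pa])
  obtain p where p: "\<And>Q. Q \<in> primes \<Longrightarrow> Q \<noteq> P \<Longrightarrow> p Q \<in> P \<and> p Q \<notin> Q"
    using primes_incomparable[OF P] by metis
  define S where "S = insert (unif P ^ n) ((\<lambda>Q. p Q ^ n) ` (B - {P}))"
  have "\<exists>a\<in>S. if Q = P then a = unif P ^ n else a \<notin> Q" if Q: "Q \<in> primes" for Q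
  proof (cases "Q \<in> B - {P}")
    case True
    then have "p Q \<in> P" "p Q \<notin> Q" using p Q by auto
    then have "p Q ^ n \<notin> Q" using power_not_mem_prime[OF Q] ideal_integersD(1)[OF maximal_idealD(1)[OF P]] by blast
    moreover have "p Q ^ n \<in> S" using True unfolding S_def by blast
    ultimately show ?thesis using True by auto
  next
    case False
    have "unif P ^ n \<in> S" by (simp add: S_def)
    moreover have "unif P ^ n \<notin> Q" if "Q \<noteq> P"
      using power_not_mem_prime[OF Q pa] False that Q by (simp add: B_def)
    ultimately show ?thesis by auto
  qed
  moreover have "finite S" using \<open>finite B\<close> by (simp add: S_def)
  moreover have "S \<subseteq> ipow P n"
  proof
    fix a assume "a \<in> S"
    then consider "a = unif P ^ n" | Q where "Q \<in> primes" "Q \<noteq> P" "a = p Q ^ n"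
      unfolding S_def B_def by blast
    then show "a \<in> ipow P n"
    proof cases
      case 1 then show ?thesis using ip[OF unif(1)[OF P]] by blast
    next
      case 2 then show ?thesis using ip p by blast
    qed
  qed
  ultimately show ?thesis by blast
qed

text \<open>A negative exponent cannot occur: if \<rho> is \<pi>^(-n) times a unit, then the unit,
  being \<pi>^n times the integral \<rho>, lies in \<open>M n\<close>, hence so does 1, and n =
  0.\<close>

lemma integral_Units_factor:
  assumes P: "P \<in> primes" and \<rho>: "\<rho> \<in> carrier (li P)" "\<rho> \<noteq> \<zero>\<^bsub>lf P\<^esub>"
  shows "\<rho> \<in> Units (lf P)"
    and "\<exists>n U. U \<in> Units (li P) \<and> \<rho> = to_local_field P (unif P ^ n) \<otimes>\<^bsub>lf P\<^esub> U"
proof -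
  interpret D: local_dvr P "localization P" "unif P" by (rule dvr[OF P])
  have \<rho>0: "\<rho> \<in> D.M 0" "\<rho> \<in> carrier (lf P)" using \<rho>(1) D.carrier_local_integers D.M_carrier by auto
  then show u: "\<rho> \<in> Units (lf P)" using \<rho>(2) D.K.field_Units by simp
  obtain n U where U: "U \<in> Units (li P)" "\<rho> = to_local_field P (unif P ^ n) \<otimes>\<^bsub>lf P\<^esub> U \<or>
      \<rho> = inv\<^bsub>lf P\<^esub> (to_local_field P (unif P ^ n)) \<otimes>\<^bsub>lf P\<^esub> U" using D.Units_factor[OF u] by blast
  from U(2) show "\<exists>n U. U \<in> Units (li P) \<and> \<rho> = to_local_field P (unif P ^ n) \<otimes>\<^bsub>lf P\<^esub> U"
  proof
    assume eq: "\<rho> = inv\<^bsub>lf P\<^esub> (to_local_field P (unif P ^ n)) \<otimes>\<^bsub>lf P\<^esub> U"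
    let ?t = "to_local_field P (unif P ^ n)"
    have t: "?t \<in> Units (lf P)" "?t \<in> carrier (lf P)" using D.to_local_Units[of "unif P ^ n"] D.pi_nz by auto
    have U': "U \<in> Units (lf P)" "U \<in> D.M 0" "inv\<^bsub>lf P\<^esub> U \<in> D.M 0" "U \<in> carrier (lf P)"
      using U(1) D.Units_local_integers D.M_carrier by auto
    have "?t \<otimes>\<^bsub>lf P\<^esub> \<rho> = U" unfolding eq using t U' by (simp add: D.K.m_assoc[symmetric])
    moreover have "?t \<in> D.M n" using D.pi_power_L D.to_local_M by blast
    ultimately have "U \<in> D.M n" using D.M_mult_0(1)[OF _ \<rho>0(1)] by metis
    then have "U \<otimes>\<^bsub>lf P\<^esub> inv\<^bsub>lf P\<^esub> U \<in> D.M n" using D.M_mult_0(1) U'(3) by blast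
    then have "\<one>\<^bsub>lf P\<^esub> \<in> D.M n" using U'(1) by simp
    then have "n = 0" using D.M_antimono[of 1 n "\<one>\<^bsub>lf P\<^esub>"] D.one_notin_M1 by (cases n) auto
    then have "\<rho> = to_local_field P (unif P ^ 0) \<otimes>\<^bsub>lf P\<^esub> U" using eq by simp
    then show ?thesis using U(1) by blast
  qed (use U(1) in blast)
qed

lemma single_component_IA: "P \<in> primes \<Longrightarrow> a \<in> carrier (li P) \<Longrightarrow> single_component P a \<in> carrier IA"
proof -
  assume P: "P \<in> primes" and a: "a \<in> carrier (li P)"
  have "\<one>\<^bsub>lf Q\<^esub> \<in> carrier (li Q)" if Q: "Q \<in> primes" for Q
    using monoid.one_closed[of "li Q"] cring_li[OF Q] by (simp add: cring_def comm_monoid_def)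
  then show ?thesis using a by (auto simp: IA_simps(1) single_component_def)
qed

text \<open>With \<rho> equal to \<pi>^n times a local unit, the power P^n is the right ideal.
  Divisibility by the single component is checked place by place; the reverse inclusion needs a
  finite combination of diagonal elements and uses \<open>local_generators\<close>.\<close>

lemma single_component_ideal:
  assumes P: "P \<in> primes" and \<rho>: "\<rho> \<in> carrier (li P)" "\<rho> \<noteq> \<zero>\<^bsub>lf P\<^esub>"
  shows "\<exists>n. PIdl\<^bsub>IA\<^esub> (single_component P \<rho>) = Idl\<^bsub>IA\<^esub> (diag ` ipow P n)"
proof -
  interpret D: local_dvr P "localization P" "unif P" by (rule dvr[OF P])
  obtain n U where U: "U \<in> Units (li P)" "\<rho> = to_local_field P (unif P ^ n) \<otimes>\<^bsub>lf P\<^esub> U"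
    using integral_Units_factor(2)[OF P \<rho>] by blast
  have U': "U \<in> Units (lf P)" "U \<in> D.M 0" "inv\<^bsub>lf P\<^esub> U \<in> D.M 0" "U \<in> carrier (lf P)"
    using U(1) D.Units_local_integers D.M_carrier by auto
  let ?r = "single_component P \<rho>" and ?J = "Idl\<^bsub>IA\<^esub> (diag ` ipow P n)"
  have r: "?r \<in> carrier IA" by (rule single_component_IA[OF P \<rho>(1)])
  note I = ideal_integersD(1)[OF ipow(3)[OF maximal_idealD(1)[OF P]]]
  have dI: "diag ` ipow P n \<subseteq> carrier IA" using diag_IA I by blast
  interpret J: ideal ?J IA by (rule IA.genideal_ideal[OF dI])
  have "?J \<subseteq> PIdl\<^bsub>IA\<^esub> ?r"
  proof (rule IA.genideal_minimal[OF IA.cgenideal_ideal[OF r]], clarify)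
    fix a assume a: "a \<in> ipow P n"
    then have aa: "algebraic_int a" using I by blast
    define b where "b = inverse (unif P ^ n) * a"
    have "a \<in> D.L n"
      unfolding localized_power_eq using a maximal_idealD(2)[OF P] algebraic_int_1 by force
    then have "b \<in> localization P" unfolding b_def D.L_iff .
    then have b: "to_local_field P b \<in> D.M 0" unfolding D.to_local_M D.L_zero .
    \<comment> \<open>The quotient of \<open>diag a\<close> by the single component. Away from P the
      divisor is 1; at P both the local unit \<open>U\<close> and the power of the uniformizer are
      divided out.\<close>
    define x where "x = (\<lambda>Q\<in>primes. if Q = P then inv\<^bsub>lf P\<^esub> U \<otimes>\<^bsub>lf P\<^esub> to_local_field P b else to_local_field Q a)"
    have x: "x \<in> carrier IA"
    proof -
      have "inv\<^bsub>lf P\<^esub> U \<otimes>\<^bsub>lf P\<^esub> to_local_field P b \<in> carrier (li P)"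
        using D.M_mult_0(1)[OF U'(3) b] by (simp add: D.carrier_local_integers)
      moreover have "to_local_field Q a \<in> carrier (li Q)" if "Q \<in> primes" for Q
        using diag_IA[OF aa] that by (auto simp: IA_simps(1) diagonal_def)
      ultimately show ?thesis by (auto simp: IA_simps(1) x_def)
    qed
    have "diag a = x \<otimes>\<^bsub>IA\<^esub> ?r"
      unfolding IA_simps(2) diagonal_def
    proof (rule restrict_ext)
      fix Q assume Q: "Q \<in> primes"
      show "to_local_field Q a = x Q \<otimes>\<^bsub>li Q\<^esub> ?r Q"
      proof (cases "Q = P")
        case True
        have "b * unif P ^ n = a" using D.pi_nz by (simp add: b_def)
        then have "to_local_field P a = to_local_field P b \<otimes>\<^bsub>lf P\<^esub> to_local_field P (unif P ^ n)"
          unfolding D.to_local_field_hom(2)[symmetric] by simp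
        moreover have "(inv\<^bsub>lf P\<^esub> U \<otimes>\<^bsub>lf P\<^esub> to_local_field P b) \<otimes>\<^bsub>lf P\<^esub> (to_local_field P (unif P ^ n) \<otimes>\<^bsub>lf P\<^esub> U) =
            (inv\<^bsub>lf P\<^esub> U \<otimes>\<^bsub>lf P\<^esub> U) \<otimes>\<^bsub>lf P\<^esub> (to_local_field P b \<otimes>\<^bsub>lf P\<^esub> to_local_field P (unif P ^ n))"
          using U' by (simp add: D.K.m_ac del: D.K.Units_l_inv D.K.Units_r_inv)
        ultimately show ?thesis using True P U' by (simp add: x_def single_component_def U(2))
      next
        case False
        interpret E: local_dvr Q "localization Q" "unif Q" by (rule dvr[OF Q])
        show ?thesis using False Q by (simp add: x_def single_component_def)
      qed
    qed
    then show "diag a \<in> PIdl\<^bsub>IA\<^esub> ?r" unfolding cgenideal_def using x by blast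
  qed
  moreover have "PIdl\<^bsub>IA\<^esub> ?r \<subseteq> ?J"
  proof (rule IA.cgenideal_minimal[OF J.is_ideal])
    obtain S where S: "finite S \<and> S \<subseteq> ipow P n \<and>
        (\<forall>Q\<in>primes. \<exists>a\<in>S. if Q = P then a = unif P ^ n else a \<notin> Q)"
      using local_generators[OF P, of n] by (elim exE)
    note S = S[THEN conjunct1] S[THEN conjunct2, THEN conjunct1] S[THEN conjunct2, THEN conjunct2, THEN bspec]
    have "\<exists>a\<in>S. \<exists>y\<in>carrier (li Q). ?r Q = y \<otimes>\<^bsub>lf Q\<^esub> to_local_field Q a" if Q: "Q \<in> primes" for Q
    proof (cases "Q = P")
      case True
      then have "unif P ^ n \<in> S" using S(3)[OF Q] by auto
      moreover have "?r P = U \<otimes>\<^bsub>lf P\<^esub> to_local_field P (unif P ^ n)"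
        using P U' by (simp add: single_component_def U(2) D.K.m_comm)
      moreover have "U \<in> carrier (li P)" using U' by (simp add: D.carrier_local_integers)
      ultimately show ?thesis unfolding True by blast
    next
      case False
      then obtain a where a: "a \<in> S" "a \<notin> Q" using S(3)[OF Q] by auto
      interpret E: local_dvr Q "localization Q" "unif Q" by (rule dvr[OF Q])
      have aa: "algebraic_int a" using a(1) S(2) I by blast
      note u = not_mem_prime_unit[OF Q aa a(2)]
      have "?r Q = to_local_field Q (inverse a) \<otimes>\<^bsub>lf Q\<^esub> to_local_field Q a"
        unfolding E.to_local_field_hom(2)[symmetric] using u(1) False Q by (simp add: single_component_def)
      moreover have "to_local_field Q (inverse a) \<in> carrier (li Q)"
        using u(2) by (simp add: E.carrier_local_integers E.to_local_M E.L_zero)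
      ultimately show ?thesis using a(1) by blast
    qed
    then obtain c y where cy: "\<And>Q. Q \<in> primes \<Longrightarrow> c Q \<in> S \<and> y Q \<in> carrier (li Q) \<and>
        ?r Q = y Q \<otimes>\<^bsub>lf Q\<^esub> to_local_field Q (c Q)" by metis
    have zero: "\<zero>\<^bsub>lf Q\<^esub> \<in> carrier (li Q)" if Q: "Q \<in> primes" for Q
      using local_dvr.M_zero[OF dvr[OF Q]] carrier_li[OF Q] by simp
    \<comment> \<open>The places are grouped by the element \<open>c Q\<close> of the finite set
      \<open>S\<close> that generates there. Each group contributes one multiple of a diagonal
      element, so although there are infinitely many places the sum has one term for each element of
      \<open>S\<close>.\<close>
    have "(\<lambda>Q\<in>primes. if c Q \<in> T then ?r Q else \<zero>\<^bsub>lf Q\<^esub>) \<in> ?J" if "T \<subseteq> S" for T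
      using finite_subset[OF that S(1)] that
    proof (induction T rule: finite_induct)
      case empty
      have "(\<lambda>Q\<in>primes. if c Q \<in> {} then ?r Q else \<zero>\<^bsub>lf Q\<^esub>) = \<zero>\<^bsub>IA\<^esub>"
        unfolding IA_simps(5) by (intro restrict_ext) simp
      then show ?case using additive_subgroup.zero_closed[OF J.additive_subgroup_axioms] by simp
    next
      case (insert a T)
      define x where "x = (\<lambda>Q\<in>primes. if c Q = a then y Q else \<zero>\<^bsub>lf Q\<^esub>)"
      have x: "x \<in> carrier IA" using cy zero by (auto simp: IA_simps(1) x_def)
      have da: "diag a \<in> ?J" using IA.genideal_self[OF dI] insert.prems S(2) by blast
      have aa: "algebraic_int a" using insert.prems S(2) I by blast
      let ?p = "\<lambda>Q\<in>primes. if c Q \<in> T then ?r Q else \<zero>\<^bsub>lf Q\<^esub>"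
      have "?p \<oplus>\<^bsub>IA\<^esub> x \<otimes>\<^bsub>IA\<^esub> diag a = (\<lambda>Q\<in>primes. if c Q \<in> insert a T then ?r Q else \<zero>\<^bsub>lf Q\<^esub>)"
        unfolding IA_simps(2,3)
      proof (rule restrict_ext)
        fix Q assume Q: "Q \<in> primes"
        interpret E: local_dvr Q "localization Q" "unif Q" by (rule dvr[OF Q])
        have c: "?r Q \<in> carrier (lf Q)" using IA_lf[OF r Q] by blast
        show "?p Q \<oplus>\<^bsub>li Q\<^esub> (\<lambda>Q\<in>primes. x Q \<otimes>\<^bsub>li Q\<^esub> diag a Q) Q =
            (if c Q \<in> insert a T then ?r Q else \<zero>\<^bsub>lf Q\<^esub>)"
        proof (cases "c Q = a")
          case True
          have "?r Q = y Q \<otimes>\<^bsub>lf Q\<^esub> to_local_field Q a" using cy[OF Q] True by simp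
          then show ?thesis using True Q c insert.hyps(2) by (simp add: x_def diagonal_def)
        next
          case False
          then show ?thesis using Q c by (simp add: x_def diagonal_def)
        qed
      qed
      moreover have "?p \<oplus>\<^bsub>IA\<^esub> x \<otimes>\<^bsub>IA\<^esub> diag a \<in> ?J"
        using additive_subgroup.a_closed[OF J.additive_subgroup_axioms insert.IH J.I_l_closed[OF da x]]
          insert.prems by blast
      ultimately show ?case by (simp only:)
    qed
    from this[OF order_refl] have "(\<lambda>Q\<in>primes. if c Q \<in> S then ?r Q else \<zero>\<^bsub>lf Q\<^esub>) \<in> ?J" .
    moreover have "(\<lambda>Q\<in>primes. if c Q \<in> S then ?r Q else \<zero>\<^bsub>lf Q\<^esub>) = ?r"
    proof
      fix Q
      show "(\<lambda>Q\<in>primes. if c Q \<in> S then ?r Q else \<zero>\<^bsub>lf Q\<^esub>) Q = ?r Q"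
        using cy[of Q] by (cases "Q \<in> primes") (simp_all add: single_component_def)
    qed
    ultimately show "?r \<in> ?J" by simp
  qed
  ultimately show ?thesis by blast
qed

text \<open>Existence comes from the power of P supplied by \<open>single_component_ideal\<close>.
  For uniqueness, equality of two classes yields a unit \<open>u\<close> whose reciprocity image
  appears on both sides and cancels.\<close>

lemma local_sigma_eq:
  assumes P: "P \<in> primes" and \<rho>: "\<rho> \<in> carrier (li P)" "\<rho> \<noteq> \<zero>\<^bsub>lf P\<^esub>"
  shows "local_sigma P \<rho> = explicit_hom (single_component P \<rho>)"
proof -
  let ?r = "single_component P \<rho>"
  have r: "?r \<in> carrier IA" "?r \<in> carrier FI"
    using single_component_IA[OF P \<rho>(1)] single_component_X[OF P integral_Units_factor(1)[OF P \<rho>]] by auto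
  have ar: "art ?r \<in> carrier GA" using r(2) by simp
  have emb: "local_embedding P \<rho> \<otimes>\<^bsub>DR\<^esub> unit_class s = dc ?r s" if "s \<in> carrier GA" for s
    unfolding local_embedding_def unit_class_def using r(1) that by (simp add: DR_mult)
  have \<Phi>: "explicit_hom ?r = unit_class (inv\<^bsub>GA\<^esub> (art ?r))" using r(2) by (simp add: explicit_hom_def)
  show ?thesis
    unfolding local_sigma_def
  proof (rule the_equality)
    obtain n where n: "PIdl\<^bsub>IA\<^esub> ?r = Idl\<^bsub>IA\<^esub> (diag ` ipow P n)" using single_component_ideal[OF P \<rho>] by blast
    have id: "ideal (ipow P n) ring_of_integers" by (rule ipow(3)[OF maximal_idealD(1)[OF P]])
    have "unif P ^ n \<in> ipow P n" by (rule ipow(4)[OF maximal_idealD(1)[OF P] unif(1)[OF P]])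
    moreover have "unif P ^ n \<noteq> 0" using local_dvr.pi_nz[OF dvr[OF P]] by simp
    ultimately have "ipow P n \<noteq> {0}" by blast
    then have "dc ?r (inv\<^bsub>GA\<^esub> (art ?r)) \<in> ideal_monoid"
      unfolding ideal_monoid_def using id n r by blast
    then show "explicit_hom ?r \<in> Units DR \<and> local_embedding P \<rho> \<otimes>\<^bsub>DR\<^esub> explicit_hom ?r \<in> ideal_monoid"
      unfolding \<Phi> using ar by (simp add: emb unit_class_Units)
  next
    fix \<sigma> assume \<sigma>: "\<sigma> \<in> Units DR \<and> local_embedding P \<rho> \<otimes>\<^bsub>DR\<^esub> \<sigma> \<in> ideal_monoid"
    then obtain s where s: "s \<in> carrier GA" "\<sigma> = unit_class s" by (auto simp: Units_DR)
    then have "dc ?r s \<in> ideal_monoid" using \<sigma> emb by simp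
    then obtain \<rho>' where \<rho>': "\<rho>' \<in> carrier IA" "\<rho>' \<in> carrier FI" "dc ?r s = dc \<rho>' (inv\<^bsub>GA\<^esub> (art \<rho>'))"
      unfolding ideal_monoid_def by blast
    then obtain u where u: "u \<in> V" "\<rho>' = ?r \<otimes>\<^bsub>IA\<^esub> u" "inv\<^bsub>GA\<^esub> (art \<rho>') = inv\<^bsub>GA\<^esub> (art u) \<otimes>\<^bsub>GA\<^esub> s"
      using dc_eq_iff[of ?r s \<rho>' "inv\<^bsub>GA\<^esub> (art \<rho>')"] r(1) s(1) by auto
    have uc: "u \<in> carrier FI" "art u \<in> carrier GA" using u(1) V_FI art_V(1) by auto
    have "art \<rho>' = art ?r \<otimes>\<^bsub>GA\<^esub> art u" unfolding u(2) V_mult using r(2) uc by (simp add: art_mult)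
    then have eq: "inv\<^bsub>GA\<^esub> (art u) \<otimes>\<^bsub>GA\<^esub> inv\<^bsub>GA\<^esub> (art ?r) = inv\<^bsub>GA\<^esub> (art u) \<otimes>\<^bsub>GA\<^esub> s"
      using u(3) ar uc by (simp add: GA.inv_mult_group)
    have "inv\<^bsub>GA\<^esub> (art ?r) = s"
      by (rule GA.l_cancel[OF eq GA.inv_closed[OF ar] s(1) GA.inv_closed[OF uc(2)]])
    then show "\<sigma> = explicit_hom ?r" unfolding s(2) \<Phi> by (rule arg_cong[OF sym])
  qed
qed

text \<open>Every element of K_P^* is integral or becomes so after multiplication by a power of the
  uniformizer, so a homomorphism is determined by its values on nonzero local integers.\<close>

lemma local_hom_eq:
  assumes P: "P \<in> primes"
  shows "local_hom P = (\<lambda>x\<in>Units (lf P). explicit_hom (single_component P x))"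
proof -
  interpret D: local_dvr P "localization P" "unif P" by (rule dvr[OF P])
  interpret G: comm_group "units_of (lf P)" by (rule comm_group_local_units[OF P])
  let ?h = "\<lambda>x\<in>Units (lf P). explicit_hom (single_component P x)"
  let ?C = "\<lambda>\<phi>. \<phi> \<in> hom (units_of (lf P)) (units_of DR) \<inter> extensional (Units (lf P)) \<and>
        (\<forall>\<rho>\<in>carrier (li P) - {\<zero>\<^bsub>li P\<^esub>}. \<phi> \<rho> = local_sigma P \<rho>)"
  have h: "?C ?h"
  proof (intro conjI ballI IntI homI)
    fix x assume "x \<in> carrier (units_of (lf P))"
    then have x: "x \<in> Units (lf P)" by (simp add: units_of_carrier)
    then show "?h x \<in> carrier (units_of DR)"
      using hom_in_carrier[OF explicit_hom_hom single_component_X[OF P x]] by simp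
    fix y assume "y \<in> carrier (units_of (lf P))"
    then have y: "y \<in> Units (lf P)" by (simp add: units_of_carrier)
    show "?h (x \<otimes>\<^bsub>units_of (lf P)\<^esub> y) = ?h x \<otimes>\<^bsub>units_of DR\<^esub> ?h y"
      using hom_mult[OF explicit_hom_hom single_component_X[OF P x] single_component_X[OF P y]] x y
      by (simp add: units_of_mult[of "lf P"] single_component_mult[OF P])
  next
    fix \<rho> assume "\<rho> \<in> carrier (li P) - {\<zero>\<^bsub>li P\<^esub>}"
    then have "\<rho> \<in> carrier (li P)" "\<rho> \<noteq> \<zero>\<^bsub>lf P\<^esub>" by auto
    then show "?h \<rho> = local_sigma P \<rho>" using local_sigma_eq[OF P] integral_Units_factor(1)[OF P] by simp
  qed simp
  have "\<phi> = ?h" if \<phi>: "?C \<phi>" for \<phi>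
  proof (rule extensionalityI[of _ "Units (lf P)"])
    show "\<phi> \<in> extensional (Units (lf P))" using \<phi> by blast
    show "?h \<in> extensional (Units (lf P))" by simp
    have \<phi>h: "\<phi> \<in> hom (units_of (lf P)) (units_of DR)" and hh: "?h \<in> hom (units_of (lf P)) (units_of DR)"
      using \<phi> h by blast+
    have int: "\<phi> \<rho> = ?h \<rho>" if "\<rho> \<in> Units (lf P)" "\<rho> \<in> D.M 0" for \<rho>
    proof -
      have "\<rho> \<in> carrier (li P) - {\<zero>\<^bsub>li P\<^esub>}"
        using that D.K.field_Units by (simp add: D.carrier_local_integers)
      then show ?thesis using \<phi> h by metis
    qed
    fix x assume x: "x \<in> Units (lf P)"
    obtain n U where U: "U \<in> Units (li P)" "x = to_local_field P (unif P ^ n) \<otimes>\<^bsub>lf P\<^esub> U \<or>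
      x = inv\<^bsub>lf P\<^esub> (to_local_field P (unif P ^ n)) \<otimes>\<^bsub>lf P\<^esub> U" using D.Units_factor[OF x] by blast
    let ?t = "to_local_field P (unif P ^ n)"
    have t: "?t \<in> Units (lf P)" "?t \<in> carrier (lf P)" "?t \<in> D.M 0"
      using D.to_local_Units[of "unif P ^ n"] D.pi_nz D.R_power[OF D.pi_R] by (auto simp: D.to_local_M D.L_zero)
    have U': "U \<in> Units (lf P)" "U \<in> D.M 0" "U \<in> carrier (lf P)"
      using U(1) D.Units_local_integers D.M_carrier by auto
    from U(2) show "\<phi> x = ?h x"
    proof
      assume "x = ?t \<otimes>\<^bsub>lf P\<^esub> U"
      then have "x \<in> D.M 0" using D.M_mult_0(1) t(3) U'(2) by blast
      then show ?thesis by (rule int[OF x])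
    next
      assume eq: "x = inv\<^bsub>lf P\<^esub> ?t \<otimes>\<^bsub>lf P\<^esub> U"
      \<comment> \<open>Writes \<open>x\<close> as the quotient of the integral elements
        \<open>U\<close> and \<open>?t\<close>, on which both homomorphisms agree; the common value
        at \<open>?t\<close> is then cancelled in the unit group.\<close>
      have "?t \<otimes>\<^bsub>lf P\<^esub> x = U" unfolding eq using t U' by (simp add: D.K.m_assoc[symmetric])
      then have tx: "?t \<otimes>\<^bsub>units_of (lf P)\<^esub> x = U" by (simp add: units_of_mult)
      have c: "?t \<in> carrier (units_of (lf P))" "x \<in> carrier (units_of (lf P))"
        using t x by (simp_all add: units_of_carrier)
      have "\<phi> ?t \<otimes>\<^bsub>units_of DR\<^esub> \<phi> x = \<phi> U" using hom_mult[OF \<phi>h c] tx by simp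
      also have "\<dots> = ?h U" by (rule int[OF U'(1,2)])
      also have "\<dots> = ?h ?t \<otimes>\<^bsub>units_of DR\<^esub> ?h x" using hom_mult[OF hh c] tx by metis
      also have "?h ?t = \<phi> ?t" using int[OF t(1,3)] by metis
      finally show ?thesis
        using UD.l_cancel hom_in_carrier[OF \<phi>h c(1)] hom_in_carrier[OF \<phi>h c(2)] hom_in_carrier[OF hh c(2)] by blast
    qed
  qed
  then show ?thesis unfolding local_hom_def using h by (intro the_equality) blast+
qed

text \<open>Two candidates agree on ideles concentrated at one place, hence on
  \<open>finite_support\<close>. This set is dense, and continuous maps into a Hausdorff space that
  agree on a dense set are equal.\<close>

lemma idele_hom_eq: "idele_hom = explicit_hom"
  unfolding idele_hom_def
proof (rule the_equality)
  show "explicit_hom \<in> hom FI (units_of DR) \<inter> extensional (carrier FI) \<and>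
    continuous_map finite_ideles_topology deligne_ribet_units_topology explicit_hom \<and>
    (\<forall>P\<in>primes. \<forall>x\<in>Units (lf P). explicit_hom (single_component P x) = local_hom P x)"
    using explicit_hom_hom explicit_hom_continuous by (auto simp: local_hom_eq explicit_hom_def)
next
  fix \<Phi> assume \<Phi>: "\<Phi> \<in> hom FI (units_of DR) \<inter> extensional (carrier FI) \<and>
    continuous_map finite_ideles_topology deligne_ribet_units_topology \<Phi> \<and>
    (\<forall>P\<in>primes. \<forall>x\<in>Units (lf P). \<Phi> (single_component P x) = local_hom P x)"
  show "\<Phi> = explicit_hom"
  proof (rule extensionalityI[of _ "carrier FI"])
    show "\<Phi> \<in> extensional (carrier FI)" "explicit_hom \<in> extensional (carrier FI)" using \<Phi> by (auto simp: explicit_hom_def)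
    fix x assume x: "x \<in> carrier FI"
    show "\<Phi> x = explicit_hom x"
    proof (rule forall_in_closure_of_eq[OF finite_support_dense[OF x] Hausdorff_DR_units _ explicit_hom_continuous])
      show "continuous_map finite_ideles_topology deligne_ribet_units_topology \<Phi>" using \<Phi> by blast
      fix y assume y: "y \<in> finite_support"
      show "\<Phi> y = explicit_hom y"
      proof (rule hom_eq_on_finite_support[OF UD.group_axioms _ explicit_hom_hom _ y])
        show "\<Phi> \<in> hom FI (units_of DR)" using \<Phi> by blast
        show "\<Phi> (single_component P a) = explicit_hom (single_component P a)" if "P \<in> primes" "a \<in> Units (lf P)" for P a
          using \<Phi> that by (simp add: local_hom_eq)
      qed
    qed
  qed
qed

lemma kernel_idele_hom: "kernel FI (units_of DR) idele_hom = DK"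
proof -
  have "explicit_hom x = \<one>\<^bsub>units_of DR\<^esub> \<longleftrightarrow> x \<in> DK" if x: "x \<in> carrier FI" for x
  proof -
    have "explicit_hom x = \<one>\<^bsub>units_of DR\<^esub> \<longleftrightarrow> unit_class (inv\<^bsub>GA\<^esub> (art x)) = unit_class \<one>\<^bsub>GA\<^esub>"
      using x by (simp add: explicit_hom_def units_of_one unit_class_one)
    also have "\<dots> \<longleftrightarrow> inv\<^bsub>GA\<^esub> (art x) = \<one>\<^bsub>GA\<^esub>" using x by (simp add: unit_class_inj)
    also have "\<dots> \<longleftrightarrow> art x = \<one>\<^bsub>GA\<^esub>" using x GA.inv_eq_1_iff by simp
    finally show ?thesis using art_eq_one_iff[OF x] by simp
  qed
  then show ?thesis
    using subgroup.subset[OF DK_subgroup] unfolding kernel_def idele_hom_eq by blast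
qed

lemma diagonal_iso: "diag \<in> iso (units_of (field_ring :: 'k ring)) (FI\<lparr>carrier := DK\<rparr>)"
proof -
  have U: "carrier (units_of (field_ring :: 'k ring)) = UNIV - {0}"
  proof -
    have "\<exists>y. y * x = 1 \<and> x * y = 1" if "x \<noteq> 0" for x :: 'k
      using that by (intro exI[of _ "inverse x"]) simp
    then show ?thesis by (auto simp: units_of_carrier Units_def ring_of_type_algebra_def)
  qed
  have "diag \<in> hom (units_of field_ring) (FI\<lparr>carrier := DK\<rparr>)"
  proof (rule homI)
    fix x y :: 'k assume "x \<in> carrier (units_of field_ring)"
    then have "x \<noteq> 0" unfolding U by simp
    then show "diag x \<in> carrier (FI\<lparr>carrier := DK\<rparr>)" by (auto simp: DK_def)
    show "diag (x \<otimes>\<^bsub>units_of field_ring\<^esub> y) = diag x \<otimes>\<^bsub>FI\<lparr>carrier := DK\<rparr>\<^esub> diag y"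
      by (simp add: units_of_mult ring_of_type_algebra_def diag_mult)
  qed
  moreover have "bij_betw diag (UNIV - {0}) DK"
    unfolding bij_betw_def DK_def by (simp add: inj_on_def diag_inj)
  ultimately show ?thesis by (simp add: iso_def U)
qed

end

theorem proposition3p6:
  assumes "imaginary_quadratic_field TYPE('k::field_char_0)"
  shows "units_of (field_ring :: 'k ring) \<cong>
    finite_ideles\<lparr>carrier :=
      kernel finite_ideles (units_of deligne_ribet)
        (idele_hom :: ('k set \<Rightarrow> (nat \<Rightarrow> 'k) set) \<Rightarrow> 'k dr_pair set)\<rparr>"
proof -
  obtain \<omega> :: 'k and D where "imaginary_quadratic \<omega> D"
    using imaginary_quadratic_field_obtain[OF assms] .
  then interpret imaginary_quadratic \<omega> D .
  show ?thesis unfolding kernel_idele_hom is_iso_def using diagonal_iso by blast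
qed

end
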